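(* Let $P(t)\in\mathbb Z[t]$ be a polynomial. Then $P(t)$ is the Alexander polynomial of some irreducible Hurwitz $C$-group $G$ if and only if all (complex) roots of $P(t)$ are roots of unity and $P(1)=1$.
   Context: **$C$-groups.** A $C$-group is a group $G$ together with a finite presentation (a $C$-presentation) on generators $x_1,\dots,x_m$ ($m\geq 1$) all of whose relations are conjugations between generators: $$G=G_W=\langle x_1,\dots,x_m \mid x_i=w_{i,j,k}^{-1}x_jw_{i,j,k},\ w_{i,j,k}\in W\rangle ,$$ where $W=\{w_{i,j,k}\in\mathbb F_m \mid 1\leq i,j\leq m,\ 1\leq k\leq \ell(i,j)\}$ is a finite family of elements (repetitions allowed) of the free group $\mathbb F_m$ on $x_1,\dots,x_m$, and $\ell(i,j)\ge 0$ are integers (if $\ell(i,j)=0$ there is no relation for the pair $(i,j)$). The images of $x_1,\dots,x_m$ in $G$ and all their conjugates are called the $C$-generators of $G$. A homomorphism of $C$-groups is a $C$-homomorphism if it sends $C$-generators to $C$-generators; $C$-groups are considered up to $C$-isomorphism. **Hurwitz $C$-groups.** A $C$-presentation $\langle x_1,\dots,x_m \mid x_i=w_{i,j,k}^{-1}x_jw_{i,j,k},\ w_{i,j,k}\in W\rangle$ is a Hurwitz $C$-presentation of degree $m$ if for each $i=1,\dots,m$ the word $w_{i,i,1}$ is the product $x_1x_2\cdots x_m$ (so the relations include that each $x_i$ commutes with $x_1\cdots x_m$). A $C$-group is a Hurwitz $C$-group if, for some $m$, it possesses a Hurwitz $C$-presentation of degree $m$. Equivalently, there are $C$-generators $x_1,\dots,x_m$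 generating $G$ (for some $m$) whose product $x_1\cdots x_m$ lies in the center of $G$. **Irreducibility.** For any $C$-group $G$, with commutator subgroup $G'$, the group $G/G'$ is a finitely generated free abelian group. $G$ is called irreducible if $G/G'\simeq\mathbb Z$. **Alexander polynomial.** For a $C$-group $G$ let $\nu:G\to\mathbb F_1\simeq \mathbb Z$ be the epimorphism sending every $C$-generator of $G$ to the fixed generator of the infinite cyclic group $\mathbb F_1$, and let $N=\ker\nu$, with commutator subgroup $N'$. Let $h$ be the automorphism of $N/N'$ induced by $g\mapsto \widetilde x^{-1}g\widetilde x$, $g\in N$, where $\widetilde x$ is any $C$-generator of $G$ (the result does not depend on $\widetilde x$), and let $h_{\mathbb C}$ be the induced automorphism of $(N/N')\otimes_{\mathbb Z}\mathbb C$. The Alexander polynomial of $G$ is $\Delta(t)=\det(h_{\mathbb C}-t\,\mathrm{Id})$ if $(N/N')\otimes\mathbb C$ is finite dimensional (equal to $1$ if this space is zero), and $\Delta(t)\equiv 0$ if it is infinite dimensional. *)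

theory Defs
  imports
    "HOL-Algebra.Algebra"
    "Jordan_Normal_Form.VS_Connect"
begin

section \<open>Free groups\<close>

text \<open>The letter \<open>(a, True)\<close> stands for the generator \<open>a\<close> and \<open>(a, False)\<close> for its formal
  inverse. The free group consists of the classes of words modulo insertion and deletion of
  adjacent mutually inverse letters.\<close>

type_synonym 'a word = "('a \<times> bool) list"

abbreviation words :: "'a set \<Rightarrow> 'a word set" where
  "words S \<equiv> lists (S \<times> UNIV)"

definition cancel_step :: "'a set \<Rightarrow> 'a word \<Rightarrow> 'a word \<Rightarrow> bool" where
  "cancel_step S u v \<longleftrightarrow>
     (\<exists>p q a b. p \<in> words S \<and> q \<in> words S \<and> a \<in> S \<and>
        u = p @ [(a, b), (a, \<not> b)] @ q \<and> v = p @ q)"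

definition free_eq :: "'a set \<Rightarrow> ('a word \<times> 'a word) set" where
  "free_eq S = {(u, v). u \<in> words S \<and> v \<in> words S \<and> equivclp (cancel_step S) u v}"

definition free_group :: "'a set \<Rightarrow> 'a word set monoid" where
  "free_group S =
     \<lparr>carrier = words S // free_eq S,
      monoid.mult = (\<lambda>U V. \<Union>x\<in>U. \<Union>y\<in>V. free_eq S `` {x @ y}),
      one = free_eq S `` {[]}\<rparr>"

definition free_gen :: "'a set \<Rightarrow> 'a \<Rightarrow> 'a word set" where
  "free_gen S a = free_eq S `` {[(a, True)]}"

definition normal_closure :: "('a, 'b) monoid_scheme \<Rightarrow> 'a set \<Rightarrow> 'a set" where
  "normal_closure G R = generate G {g \<otimes>\<^bsub>G\<^esub> r \<otimes>\<^bsub>G\<^esub> inv\<^bsub>G\<^esub> g | g r. g \<in> carrier G \<and> r \<in> R}"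

section \<open>\<open>C\<close>-groups\<close>

text \<open>A \<open>C\<close>-presentation is given by \<open>m\<close>, the numbers \<open>l i j\<close> of relations for the pair
  \<open>(i, j)\<close>, and the elements \<open>w i j k\<close> of the free group on \<open>{1..m}\<close>; the values of \<open>l\<close> and \<open>w\<close>
  outside \<open>1 \<le> i, j \<le> m\<close>, \<open>1 \<le> k \<le> l i j\<close> are irrelevant.\<close>

abbreviation FG :: "nat \<Rightarrow> nat word set monoid" where
  "FG m \<equiv> free_group {1..m}"

abbreviation fgen :: "nat \<Rightarrow> nat \<Rightarrow> nat word set" where
  "fgen m i \<equiv> free_gen {1..m} i"

definition C_presentation ::
  "nat \<Rightarrow> (nat \<Rightarrow> nat \<Rightarrow> nat) \<Rightarrow> (nat \<Rightarrow> nat \<Rightarrow> nat \<Rightarrow> nat word set) \<Rightarrow> bool" where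
  "C_presentation m l w \<longleftrightarrow>
     m \<ge> 1 \<and> (\<forall>i\<in>{1..m}. \<forall>j\<in>{1..m}. \<forall>k\<in>{1..l i j}. w i j k \<in> carrier (FG m))"

definition C_relators ::
  "nat \<Rightarrow> (nat \<Rightarrow> nat \<Rightarrow> nat) \<Rightarrow> (nat \<Rightarrow> nat \<Rightarrow> nat \<Rightarrow> nat word set) \<Rightarrow> nat word set set" where
  "C_relators m l w =
     {inv\<^bsub>FG m\<^esub> (fgen m i) \<otimes>\<^bsub>FG m\<^esub>
        (inv\<^bsub>FG m\<^esub> (w i j k) \<otimes>\<^bsub>FG m\<^esub> fgen m j \<otimes>\<^bsub>FG m\<^esub> w i j k)
      | i j k. i \<in> {1..m} \<and> j \<in> {1..m} \<and> k \<in> {1..l i j}}"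

definition presented_group ::
  "nat \<Rightarrow> (nat \<Rightarrow> nat \<Rightarrow> nat) \<Rightarrow> (nat \<Rightarrow> nat \<Rightarrow> nat \<Rightarrow> nat word set) \<Rightarrow> nat word set set monoid"
  where
  "presented_group m l w = FG m Mod normal_closure (FG m) (C_relators m l w)"

definition presented_C_generators ::
  "nat \<Rightarrow> (nat \<Rightarrow> nat \<Rightarrow> nat) \<Rightarrow> (nat \<Rightarrow> nat \<Rightarrow> nat \<Rightarrow> nat word set) \<Rightarrow> nat word set set set"
  where
  "presented_C_generators m l w =
     (let G = presented_group m l w in
      {inv\<^bsub>G\<^esub> g \<otimes>\<^bsub>G\<^esub> (normal_closure (FG m) (C_relators m l w) #>\<^bsub>FG m\<^esub> fgen m i) \<otimes>\<^bsub>G\<^esub> g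
       | g i. g \<in> carrier G \<and> i \<in> {1..m}})"

text \<open>A \<open>C\<close>-group up to \<open>C\<close>-isomorphism is a group \<open>G\<close> together with its set \<open>C\<close> of
  \<open>C\<close>-generators. Every \<open>C\<close>-group has a \<open>C\<close>-isomorphic copy on the type of
  \<open>presented_group m l w\<close>.\<close>

definition has_C_presentation ::
  "('g, 'b) monoid_scheme \<Rightarrow> 'g set \<Rightarrow>
   nat \<Rightarrow> (nat \<Rightarrow> nat \<Rightarrow> nat) \<Rightarrow> (nat \<Rightarrow> nat \<Rightarrow> nat \<Rightarrow> nat word set) \<Rightarrow> bool" where
  "has_C_presentation G C m l w \<longleftrightarrow>
     group G \<and> C_presentation m l w \<and>
     (\<exists>\<phi> \<in> iso (presented_group m l w) G. C = \<phi> ` presented_C_generators m l w)"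

definition Hurwitz_C_presentation ::
  "nat \<Rightarrow> (nat \<Rightarrow> nat \<Rightarrow> nat) \<Rightarrow> (nat \<Rightarrow> nat \<Rightarrow> nat \<Rightarrow> nat word set) \<Rightarrow> bool" where
  "Hurwitz_C_presentation m l w \<longleftrightarrow>
     C_presentation m l w \<and>
     (\<forall>i\<in>{1..m}. 1 \<le> l i i \<and>
        w i i 1 = foldr (\<lambda>j p. fgen m j \<otimes>\<^bsub>FG m\<^esub> p) [1..<Suc m] \<one>\<^bsub>FG m\<^esub>)"

definition Hurwitz_C_group :: "('g, 'b) monoid_scheme \<Rightarrow> 'g set \<Rightarrow> bool" where
  "Hurwitz_C_group G C \<longleftrightarrow>
     (\<exists>m l w. has_C_presentation G C m l w \<and> Hurwitz_C_presentation m l w)"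

definition irreducible_C_group :: "('g, 'b) monoid_scheme \<Rightarrow> bool" where
  "irreducible_C_group G \<longleftrightarrow> G Mod derived G (carrier G) \<cong> integer_group"

section \<open>Complexification of an abelian group\<close>

definition tensor_relations ::
  "('a, 'c) monoid_scheme \<Rightarrow> ('b, 'd) monoid_scheme \<Rightarrow> (('a \<times> 'b) \<Rightarrow>\<^sub>0 int) set" where
  "tensor_relations A B = generate (free_Abelian_group (carrier A \<times> carrier B))
     ({frag_of (a \<otimes>\<^bsub>A\<^esub> a', b) - frag_of (a, b) - frag_of (a', b)
       | a a' b. a \<in> carrier A \<and> a' \<in> carrier A \<and> b \<in> carrier B} \<union>
      {frag_of (a, b \<otimes>\<^bsub>B\<^esub> b') - frag_of (a, b) - frag_of (a, b')
       | a b b'. a \<in> carrier A \<and> b \<in> carrier B \<and> b' \<in> carrier B})"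

definition tensor_Z ::
  "('a, 'c) monoid_scheme \<Rightarrow> ('b, 'd) monoid_scheme \<Rightarrow> (('a \<times> 'b) \<Rightarrow>\<^sub>0 int) set monoid" where
  "tensor_Z A B = free_Abelian_group (carrier A \<times> carrier B) Mod tensor_relations A B"

text \<open>The map \<open>f \<otimes> g\<close> on \<open>A \<otimes>\<^sub>\<int> B\<close> for endomorphisms \<open>f\<close> of \<open>A\<close> and \<open>g\<close> of \<open>B\<close>. All members of
  the union coincide: the induced map on the free abelian group preserves the relations.\<close>

definition tensor_map ::
  "('a, 'c) monoid_scheme \<Rightarrow> ('b, 'd) monoid_scheme \<Rightarrow> ('a \<Rightarrow> 'a) \<Rightarrow> ('b \<Rightarrow> 'b) \<Rightarrow>
   (('a \<times> 'b) \<Rightarrow>\<^sub>0 int) set \<Rightarrow> (('a \<times> 'b) \<Rightarrow>\<^sub>0 int) set" where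
  "tensor_map A B f g U =
     (\<Union>p\<in>U. tensor_relations A B #>\<^bsub>free_Abelian_group (carrier A \<times> carrier B)\<^esub>
        frag_extend (\<lambda>(a, b). frag_of (f a, g b)) p)"

definition complex_group :: "complex monoid" where
  "complex_group = \<lparr>carrier = UNIV, monoid.mult = (+), one = 0\<rparr>"

text \<open>\<open>A \<otimes>\<^sub>\<int> \<complex>\<close> as a complex vector space. The fields \<open>mult\<close> and \<open>one\<close>, which \<open>module\<close>
  inherits from \<open>ring\<close>, play no role for modules.\<close>

definition complexification ::
  "('a, 'c) monoid_scheme \<Rightarrow> (complex, (('a \<times> complex) \<Rightarrow>\<^sub>0 int) set) module" where
  "complexification A =
     \<lparr>carrier = carrier (tensor_Z A complex_group),
      monoid.mult = undefined, one = undefined,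
      ring.zero = \<one>\<^bsub>tensor_Z A complex_group\<^esub>,
      ring.add = (\<otimes>\<^bsub>tensor_Z A complex_group\<^esub>),
      module.smult = (\<lambda>z. tensor_map A complex_group (\<lambda>a. a) (\<lambda>w. z * w))\<rparr>"

section \<open>The polynomial \<open>det (f - t Id)\<close> of an endomorphism\<close>

definition represents_endo ::
  "(complex, 'v) module \<Rightarrow> ('v \<Rightarrow> 'v) \<Rightarrow> 'v list \<Rightarrow> complex mat \<Rightarrow> bool" where
  "represents_endo V f bs M \<longleftrightarrow>
     distinct bs \<and> vectorspace.basis class_ring V (set bs) \<and>
     M \<in> carrier_mat (length bs) (length bs) \<and>
     (\<forall>j<length bs. f (bs ! j) = (\<Oplus>\<^bsub>V\<^esub>i\<in>{..<length bs}. M $$ (i, j) \<odot>\<^bsub>V\<^esub> bs ! i))"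

definition det_minus_t :: "complex mat \<Rightarrow> complex poly" where
  "det_minus_t M = det (map_mat (\<lambda>c. [:c:]) M - [:0, 1:] \<cdot>\<^sub>m 1\<^sub>m (dim_row M))"

definition endo_polynomial :: "(complex, 'v) module \<Rightarrow> ('v \<Rightarrow> 'v) \<Rightarrow> complex poly" where
  "endo_polynomial V f = (THE p. \<exists>bs M. represents_endo V f bs M \<and> p = det_minus_t M)"

section \<open>Alexander polynomial\<close>

text \<open>For a \<open>C\<close>-group, \<open>\<nu>\<close> is determined on \<open>carrier G\<close> by \<open>C\<close>, since \<open>C\<close> generates \<open>G\<close>.\<close>

definition C_kernel :: "('g, 'b) monoid_scheme \<Rightarrow> 'g set \<Rightarrow> 'g set" where
  "C_kernel G C =
     kernel G integer_group (SOME \<nu>. \<nu> \<in> hom G integer_group \<and> (\<forall>c\<in>C. \<nu> c = 1))"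

definition Alexander_group :: "('g, 'b) monoid_scheme \<Rightarrow> 'g set \<Rightarrow> 'g set monoid" where
  "Alexander_group G C =
     (let N = C_kernel G C in (G\<lparr>carrier := N\<rparr>) Mod derived (G\<lparr>carrier := N\<rparr>) N)"

text \<open>On cosets of \<open>N'\<close> the automorphism induced by \<open>g \<mapsto> x\<^sup>-\<^sup>1 g x\<close> is taking images, because \<open>N'\<close>
  is normal in \<open>G\<close>; it does not depend on the choice of the \<open>C\<close>-generator \<open>x\<close>.\<close>

definition Alexander_aut :: "('g, 'b) monoid_scheme \<Rightarrow> 'g set \<Rightarrow> 'g set \<Rightarrow> 'g set" where
  "Alexander_aut G C U = (let x = SOME x. x \<in> C in (\<lambda>g. inv\<^bsub>G\<^esub> x \<otimes>\<^bsub>G\<^esub> g \<otimes>\<^bsub>G\<^esub> x) ` U)"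

definition Alexander_polynomial :: "('g, 'b) monoid_scheme \<Rightarrow> 'g set \<Rightarrow> complex poly" where
  "Alexander_polynomial G C =
     (let A = Alexander_group G C; V = complexification A in
      if vectorspace.fin_dim class_ring V
      then endo_polynomial V (tensor_map A complex_group (Alexander_aut G C) (\<lambda>z. z))
      else 0)"

end

(* An additive map chi from N/N' to the complex numbers satisfying chi (h a) = z chi a (an
   eigencharacter) is the same as a linear functional on (N/N') tensor C that is an eigenvector of the
   transpose of h_C for z, so both directions can be read off from such characters.

   Let G be an irreducible Hurwitz C-group whose m generators have a central product. As the product
   is x^m times an element of N, h^m = 1, so every root z of the Alexander polynomial is a root of
   unity. The image L of an eigencharacter is a finitely generated Z[z]-module, and N = G' gives
   L = (z - 1) L. By Nakayama's lemma there is an integer polynomial F with F(z) = 0 and F(1) = 1,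
   whence P(1) is a unit; P has no real root, so its sign is +1.

   Conversely, P is a product of monic integer polynomials f with f(1) = 1, each dividing some t^n - 1.
   With n such that all roots z satisfy z^n = 1, repeat each of the generators x_0, x_1, ..., x_s n times
   and impose x_d = w^-1 x_0 w, where w is a word in x_0 and x_d representing u(h) a_d, for
   a_d = x_0^-1 x_d and (1 - t) u = 1 - f_d. In the Alexander module this says f_d(h) a_d = 0. Lagrange
   interpolation at the roots of the f_d yields eigenvectors spanning (N/N') tensor C, and they are
   linearly independent because the representations of the group by affine maps u |-> z^k u + b of the
   complex line, in which n-th powers of generators are central, give a dual family of
   eigencharacters. *)

theory Submission
  imports Defs "Jordan_Normal_Form.Char_Poly" "HOL-Computational_Algebra.Fundamental_Theorem_Algebra"
begin

section \<open>Linear endomorphisms of complex vector spaces\<close>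

text \<open>An element of the complexified Alexander module is a class modulo bilinear relations and
  is shown to be nonzero by mapping out of the module; hence the use of functionals, in the shape of
  characters of N, in both directions. Statements about all of N are reduced to generators by
  \<open>N_minimal\<close>: only N itself is a subgroup between N' and N that is stable under
  conjugation by one y of degree 1 and contains y^-1 x for every generator x. Together with h^m = 1
  this also gives finite dimension.

  The sign of P comes out because P(-1) has the parity of P(1): neither 1 nor -1 is a root, so the
  degree is even, and the leading coefficient (-1)^degree of det (h - t Id) is 1.

  In the realization, (1 - t) u = 1 - f is solvable because f(1) = 1, and it has this form because
  x_0^-1 w^-1 x_0 w has class (1 - h) applied to the class of w. The n-fold repetition turns the
  translation part of the product of all generators into a combination of sums 1 + z + ... + z^(n-1)
  = 0, so that this product acts as multiplication by z^m = 1 and the affine maps respect the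
  Hurwitz relations.\<close>

definition additive_scaling :: "(complex, 'v) module \<Rightarrow> ('v \<Rightarrow> complex) \<Rightarrow> bool" where
  "additive_scaling V \<xi> \<longleftrightarrow>
     (\<forall>u\<in>carrier V. \<forall>v\<in>carrier V. \<xi> (u \<oplus>\<^bsub>V\<^esub> v) = \<xi> u + \<xi> v) \<and>
     (\<forall>c. \<forall>v\<in>carrier V. \<xi> (c \<odot>\<^bsub>V\<^esub> v) = c * \<xi> v)"

definition linear_endo :: "(complex, 'v) module \<Rightarrow> ('v \<Rightarrow> 'v) \<Rightarrow> bool" where
  "linear_endo V f \<longleftrightarrow> f \<in> carrier V \<rightarrow> carrier V \<and>
     (\<forall>u\<in>carrier V. \<forall>v\<in>carrier V. f (u \<oplus>\<^bsub>V\<^esub> v) = f u \<oplus>\<^bsub>V\<^esub> f v) \<and>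
     (\<forall>c. \<forall>v\<in>carrier V. f (c \<odot>\<^bsub>V\<^esub> v) = c \<odot>\<^bsub>V\<^esub> f v)"

lemma sum_Kronecker:
  fixes a e :: "nat \<Rightarrow> 'a::semiring_1"
  assumes "i < n" "\<And>j. j < n \<Longrightarrow> e j = (if i = j then 1 else 0)"
  shows "(\<Sum>j<n. a j * e j) = a i"
proof -
  have "(\<Sum>j<n. a j * e j) = (\<Sum>j<n. if i = j then a j else 0)"
    using assms(2) by (intro sum.cong) auto
  then show ?thesis using assms(1) by simp
qed

locale complex_space = vectorspace "class_ring :: complex ring" V
  for V :: "(complex, 'v) module" (structure)
begin

lemma nth_carrier [simp, intro]:
  "set bs \<subseteq> carrier V \<Longrightarrow> i < length bs \<Longrightarrow> bs ! i \<in> carrier V"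
  using nth_mem by blast

lemma nth_funcset [simp, intro]: "set bs \<subseteq> carrier V \<Longrightarrow> (!) bs \<in> {..<length bs} \<rightarrow> carrier V"
  by auto

text \<open>From here on the module laws appear with the ordinary operations on complex numbers in
  place of those of the record \<open>class_ring\<close>, so that \<open>simp\<close> can do the
  arithmetic of scalars.\<close>

lemma smult_closed' [simp, intro]: "v \<in> carrier V \<Longrightarrow> c \<odot> v \<in> carrier V"
  using smult_closed by simp

lemma smult_zero_left [simp]: "v \<in> carrier V \<Longrightarrow> 0 \<odot> v = \<zero>"
  using smult_l_null by simp

lemma smult_one_left [simp]: "v \<in> carrier V \<Longrightarrow> 1 \<odot> v = v"
  using smult_one by simp

lemma smult_assoc': "v \<in> carrier V \<Longrightarrow> (a * b) \<odot> v = a \<odot> (b \<odot> v)"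
  using smult_assoc1[of a b v] by simp

lemma smult_add_left: "v \<in> carrier V \<Longrightarrow> (a + b) \<odot> v = a \<odot> v \<oplus> b \<odot> v"
  using smult_l_distr[of a b v] by simp

lemma smult_add_right: "u \<in> carrier V \<Longrightarrow> v \<in> carrier V \<Longrightarrow>
    a \<odot> (u \<oplus> v) = a \<odot> u \<oplus> a \<odot> v"
  using smult_r_distr[of a u v] by simp

lemma smult_neg: "v \<in> carrier V \<Longrightarrow> (- a) \<odot> v = \<ominus> (a \<odot> v)"
  by (metis M.add.inv_equality add.left_inverse smult_add_left smult_closed' smult_zero_left)

lemma additive_scaling_zero:
  assumes "additive_scaling V \<xi>" shows "\<xi> \<zero> = 0"
  using assms unfolding additive_scaling_def by (metis M.zero_closed mult_zero_left smult_zero_left)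

lemma additive_scaling_finsum:
  assumes \<xi>: "additive_scaling V \<xi>" and "finite I" "g \<in> I \<rightarrow> carrier V"
  shows "\<xi> (\<Oplus>i\<in>I. g i) = (\<Sum>i\<in>I. \<xi> (g i))"
  using assms(2,3)
proof (induction I rule: finite_induct)
  case (insert i I)
  then have "\<xi> (g i \<oplus> finsum V g I) = \<xi> (g i) + \<xi> (finsum V g I)"
    using \<xi> unfolding additive_scaling_def by (simp add: Pi_iff)
  with insert show ?case by (simp add: Pi_iff)
qed (simp add: additive_scaling_zero[OF \<xi>])

lemma additive_scaling_comb:
  assumes "additive_scaling V \<xi>" "finite I" "b \<in> I \<rightarrow> carrier V"
  shows "\<xi> (\<Oplus>i\<in>I. c i \<odot> b i) = (\<Sum>i\<in>I. c i * \<xi> (b i))"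
proof -
  have "\<xi> (\<Oplus>i\<in>I. c i \<odot> b i) = (\<Sum>i\<in>I. \<xi> (c i \<odot> b i))"
    using assms by (intro additive_scaling_finsum) auto
  also have "\<dots> = (\<Sum>i\<in>I. c i * \<xi> (b i))"
    using assms unfolding additive_scaling_def by (intro sum.cong) (auto simp: Pi_iff)
  finally show ?thesis .
qed

lemma linear_endo_zero:
  assumes "linear_endo V f" shows "f \<zero> = \<zero>"
proof -
  have "f (0 \<odot> \<zero>) = 0 \<odot> f \<zero>" "f \<zero> \<in> carrier V"
    using assms M.zero_closed unfolding linear_endo_def by blast+
  then show ?thesis by simp
qed

lemma linear_endo_comb:
  assumes f: "linear_endo V f" and "finite I" "b \<in> I \<rightarrow> carrier V"
  shows "f (\<Oplus>i\<in>I. c i \<odot> b i) = (\<Oplus>i\<in>I. c i \<odot> f (b i))"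
  using assms(2,3)
proof (induction I rule: finite_induct)
  case (insert i I)
  have fc: "f \<in> carrier V \<rightarrow> carrier V" using f by (simp add: linear_endo_def)
  have 1: "(\<lambda>i. c i \<odot> b i) \<in> I \<rightarrow> carrier V" "(\<lambda>i. c i \<odot> f (b i)) \<in> I \<rightarrow> carrier V"
    "b i \<in> carrier V" "f (b i) \<in> carrier V"
    using insert.prems fc by auto
  have "f (\<Oplus>i\<in>insert i I. c i \<odot> b i) = f (c i \<odot> b i \<oplus> (\<Oplus>i\<in>I. c i \<odot> b i))"
    using insert 1 by simp
  also have "\<dots> = c i \<odot> f (b i) \<oplus> f (\<Oplus>i\<in>I. c i \<odot> b i)"
    using f 1 unfolding linear_endo_def by simp
  also have "\<dots> = (\<Oplus>i\<in>insert i I. c i \<odot> f (b i))"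
    using insert 1 by simp
  finally show ?case .
qed (simp add: linear_endo_zero[OF f])

lemma lincomb_set_eq_comb:
  assumes "distinct bs" "set bs \<subseteq> carrier V"
  shows "lincomb a (set bs) = (\<Oplus>i\<in>{..<length bs}. a (bs ! i) \<odot> bs ! i)"
proof -
  have inj: "inj_on ((!) bs) {..<length bs}" and im: "(!) bs ` {..<length bs} = set bs"
    using assms(1) by (auto simp: inj_on_nth in_set_conv_nth)
  show ?thesis
    unfolding lincomb_def im[symmetric]
    using inj im assms(2) by (subst M.finsum_reindex) auto
qed

text \<open>A finite basis together with its dual basis. A list, rather than a set, indexes the rows
  and columns of matrices. Biorthogonality yields independence, the last clause yields
  spanning.\<close>

definition coordinates :: "'v list \<Rightarrow> ('v \<Rightarrow> nat \<Rightarrow> complex) \<Rightarrow> bool" where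
  "coordinates bs \<phi> \<longleftrightarrow> set bs \<subseteq> carrier V \<and> (\<forall>i<length bs. additive_scaling V (\<lambda>v. \<phi> v i)) \<and>
     (\<forall>i<length bs. \<forall>j<length bs. \<phi> (bs ! j) i = (if i = j then 1 else 0)) \<and>
     (\<forall>v\<in>carrier V. v = (\<Oplus>i\<in>{..<length bs}. \<phi> v i \<odot> bs ! i))"

lemma basis_coordinates:
  assumes d: "distinct bs" and b: "basis (set bs)"
  shows "\<exists>\<phi>. coordinates bs \<phi>"
proof -
  let ?n = "length bs"
  let ?C = "\<lambda>c. \<Oplus>i\<in>{..<?n}. c i \<odot> bs ! i"
  have carr: "set bs \<subseteq> carrier V" and li: "lin_indpt (set bs)" and gen: "span (set bs) = carrier V"
    using b by (auto simp: basis_def)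
  have bsc [simp]: "i < ?n \<Longrightarrow> bs ! i \<in> carrier V" for i using carr by auto
  have ex: "\<exists>c. v = ?C c" if "v \<in> carrier V" for v
  proof -
    have "v \<in> span (set bs)" using that gen by simp
    then obtain a where "v = lincomb a (set bs)"
      using finite_in_span[of "set bs" v] carr by auto
    then show ?thesis using lincomb_set_eq_comb[OF d carr] by auto
  qed
  \<comment> \<open>One identity for sums (\<open>z = 1\<close>), differences
    (\<open>z = - 1\<close>) and multiples (\<open>c\<close> zero) of combinations. With uniqueness
    it makes the chosen coordinates linear.\<close>
  have sub: "?C (\<lambda>i. c i + z * e i) = ?C c \<oplus> z \<odot> ?C e" for c e z
  proof -
    have "z \<odot> ?C e = (\<Oplus>i\<in>{..<?n}. z \<odot> (e i \<odot> bs ! i))"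
      using finsum_smult[of z "\<lambda>i. e i \<odot> bs ! i" "{..<?n}"] by auto
    moreover have "?C (\<lambda>i. c i + z * e i) =
        (\<Oplus>i\<in>{..<?n}. c i \<odot> bs ! i \<oplus> z \<odot> (e i \<odot> bs ! i))"
      by (intro M.finsum_cong') (auto simp: smult_add_left smult_assoc')
    moreover have "\<dots> = ?C c \<oplus> (\<Oplus>i\<in>{..<?n}. z \<odot> (e i \<odot> bs ! i))"
      by (intro M.finsum_addf) auto
    ultimately show ?thesis by simp
  qed
  have uniq0: "c i = 0" if c: "?C c = \<zero>" and i: "i < ?n" for c i
  proof (rule ccontr)
    assume nz: "c i \<noteq> 0"
    \<comment> \<open>\<open>lincomb\<close> attaches coefficients to vectors, not to positions; the
      translation is well defined because \<open>bs\<close> is distinct.\<close>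
    define a where "a v = c (THE j. j < ?n \<and> bs ! j = v)" for v
    have a: "a (bs ! j) = c j" if "j < ?n" for j
      unfolding a_def using d that
      by (metis (mono_tags, lifting) nth_eq_iff_index_eq the_equality)
    have "lincomb a (set bs) = ?C c"
      unfolding lincomb_set_eq_comb[OF d carr] using a by (intro M.finsum_cong') auto
    then have "lincomb a (set bs) = \<zero>" using c by simp
    then have "lin_dep (set bs)"
      using lin_dep_crit[of "set bs" "set bs" a "bs ! i"] i nz a by auto
    then show False using li by simp
  qed
  have uniq: "c i = e i" if "?C c = ?C e" "i < ?n" for c e i
  proof -
    have "?C (\<lambda>i. c i + (- 1) * e i) = \<zero>"
      unfolding sub that(1) by (subst smult_neg) (auto intro!: M.finsum_closed M.r_neg)
    then show ?thesis using uniq0[of "\<lambda>i. c i + (- 1) * e i", OF _ that(2)] by simp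
  qed
  define \<phi> where "\<phi> v = (SOME c. v = ?C c)" for v
  have \<phi>: "v = ?C (\<phi> v)" if "v \<in> carrier V" for v
    unfolding \<phi>_def using someI_ex[OF ex[OF that]] .
  have "additive_scaling V (\<lambda>v. \<phi> v i)" if i: "i < ?n" for i
    unfolding additive_scaling_def
  proof (intro conjI allI ballI)
    fix u v assume uv: "u \<in> carrier V" "v \<in> carrier V"
    have "?C (\<phi> (u \<oplus> v)) = ?C (\<lambda>i. \<phi> u i + 1 * \<phi> v i)"
      unfolding sub using \<phi>[of u] \<phi>[of v] \<phi>[of "u \<oplus> v"] uv by simp
    from uniq[OF this i] show "\<phi> (u \<oplus> v) i = \<phi> u i + \<phi> v i" by simp
  next
    fix c v assume v: "v \<in> carrier V"
    have z: "?C (\<lambda>i. 0) = \<zero>"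
      using M.finsum_cong'[of "{..<?n}" "{..<?n}" "\<lambda>i. \<zero>" "\<lambda>i. 0 \<odot> bs ! i"] by (simp add: M.finsum_zero)
    have "?C (\<phi> (c \<odot> v)) = ?C (\<lambda>i. 0 + c * \<phi> v i)"
      unfolding sub z using \<phi>[of v] \<phi>[of "c \<odot> v"] v by simp
    from uniq[OF this i] show "\<phi> (c \<odot> v) i = c * \<phi> v i" by simp
  qed
  moreover have "\<phi> (bs ! j) i = (if i = j then 1 else 0)" if ij: "i < ?n" "j < ?n" for i j
  proof -
    have "?C (\<lambda>i. if i = j then 1 else 0) = (\<Oplus>i\<in>{..<?n}. if j = i then bs ! i else \<zero>)"
      by (intro M.finsum_cong') auto
    also have "\<dots> = bs ! j"
      using ij M.finsum_singleton[of j "{..<?n}" "\<lambda>i. bs ! i"] by auto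
    finally have "?C (\<phi> (bs ! j)) = ?C (\<lambda>i. if i = j then 1 else 0)"
      using \<phi>[of "bs ! j"] ij by simp
    from uniq[OF this ij(1)] show ?thesis .
  qed
  ultimately show ?thesis
    unfolding coordinates_def using carr \<phi> by (intro exI[of _ \<phi>]) auto
qed

text \<open>The i-th functional maps a vanishing combination to its i-th coefficient. This direction
  produces a basis from eigenvectors and functionals dual to them.\<close>

lemma coordinates_basis:
  assumes c: "coordinates bs \<phi>"
  shows "distinct bs" "basis (set bs)"
proof -
  let ?n = "length bs"
  have carr: "set bs \<subseteq> carrier V" and as: "\<And>i. i < ?n \<Longrightarrow> additive_scaling V (\<lambda>v. \<phi> v i)"
    and \<delta>: "\<And>i j. i < ?n \<Longrightarrow> j < ?n \<Longrightarrow> \<phi> (bs ! j) i = (if i = j then 1 else 0)"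
    and rep: "\<And>v. v \<in> carrier V \<Longrightarrow> v = (\<Oplus>i\<in>{..<?n}. \<phi> v i \<odot> bs ! i)"
    using c by (auto simp: coordinates_def)
  show d: "distinct bs"
    unfolding distinct_conv_nth
    by (metis \<delta> zero_neq_one)
  have "lin_indpt (set bs)"
  proof
    assume "lin_dep (set bs)"
    then obtain a v where a: "lincomb a (set bs) = \<zero>" "v \<in> set bs" "a v \<noteq> 0"
      using finite_lin_dep[of "set bs"] carr by auto
    then obtain i where i: "i < ?n" "v = bs ! i" by (auto simp: in_set_conv_nth)
    have "0 = \<phi> (\<Oplus>i\<in>{..<?n}. a (bs ! i) \<odot> bs ! i) i"
      using a(1) additive_scaling_zero[OF as[OF i(1)]] lincomb_set_eq_comb[OF d carr, of a] by simp
    also have "\<dots> = (\<Sum>j<?n. a (bs ! j) * \<phi> (bs ! j) i)"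
      using carr by (intro additive_scaling_comb[OF as[OF i(1)]]) auto
    also have "\<dots> = a v"
      using i \<delta> by (subst sum_Kronecker[of i]) auto
    finally show False using a by simp
  qed
  moreover have "v \<in> span (set bs)" if v: "v \<in> carrier V" for v
  proof -
    define a where "a w = \<phi> v (THE j. j < ?n \<and> bs ! j = w)" for w
    have "a (bs ! j) = \<phi> v j" if "j < ?n" for j
      unfolding a_def using d that
      by (metis (mono_tags, lifting) nth_eq_iff_index_eq the_equality)
    then have "lincomb a (set bs) = (\<Oplus>i\<in>{..<?n}. \<phi> v i \<odot> bs ! i)"
      unfolding lincomb_set_eq_comb[OF d carr] using carr by (intro M.finsum_cong') auto
    then show ?thesis
      using rep[OF v] carr in_span unfolding span_def by force
  qed
  ultimately show "basis (set bs)"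
    unfolding basis_def using carr span_is_subset2[OF carr] by auto
qed

lemma coordinates_comb:
  assumes c: "coordinates bs \<phi>" and k: "k < length bs" and "v = (\<Oplus>i\<in>{..<length bs}. a i \<odot> bs ! i)"
  shows "\<phi> v k = a k"
proof -
  have "\<phi> v k = (\<Sum>i<length bs. a i * \<phi> (bs ! i) k)"
    unfolding assms(3) using c k
    by (intro additive_scaling_comb[where \<xi> = "\<lambda>v. \<phi> v k"]) (auto simp: coordinates_def)
  also have "\<dots> = a k"
    using c k by (intro sum_Kronecker) (auto simp: coordinates_def)
  finally show ?thesis .
qed

end

section \<open>Independence of det (f - t Id) from the basis, and eigenfunctionals at its
  roots\<close>

lemma det_minus_t_char_poly:
  assumes M: "M \<in> carrier_mat n n"
  shows "det_minus_t M = (- 1) ^ n * char_poly M"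
proof -
  have "map_mat (\<lambda>c. [:c:]) M - [:0, 1:] \<cdot>\<^sub>m 1\<^sub>m (dim_row M) = (- 1) \<cdot>\<^sub>m char_poly_matrix M"
    using M unfolding char_poly_matrix_def by (intro eq_matI) auto
  moreover have "dim_col (char_poly_matrix M) = n"
    using M unfolding char_poly_matrix_def by auto
  ultimately show ?thesis
    unfolding det_minus_t_def char_poly_def by (simp add: det_smult)
qed

text \<open>The definite description in \<open>endo_polynomial\<close> needs this. \<open>S\<close>
  and \<open>T\<close> are the transition matrices between the two bases; expanding
  \<open>f (bs' ! j)\<close> in two ways gives \<open>M * S = S * M'\<close>, so the matrices are
  similar.\<close>

lemma (in complex_space) represents_endo_unique:
  assumes f: "linear_endo V f" and r: "represents_endo V f bs M" "represents_endo V f bs' M'"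
  shows "det_minus_t M = det_minus_t M'"
proof -
  let ?n = "length bs" and ?n' = "length bs'"
  have d: "distinct bs" "distinct bs'" and b: "basis (set bs)" "basis (set bs')"
    and M: "M \<in> carrier_mat ?n ?n" and M': "M' \<in> carrier_mat ?n' ?n'"
    and fM: "\<And>j. j < ?n \<Longrightarrow> f (bs ! j) = (\<Oplus>i\<in>{..<?n}. M $$ (i, j) \<odot> bs ! i)"
    and fM': "\<And>j. j < ?n' \<Longrightarrow> f (bs' ! j) = (\<Oplus>i\<in>{..<?n'}. M' $$ (i, j) \<odot> bs' ! i)"
    using r by (auto simp: represents_endo_def)
  have nn: "?n' = ?n"
    using dim_basis[OF _ b(1)] dim_basis[OF _ b(2)] d by (simp add: distinct_card)
  obtain \<phi> \<phi>' where \<phi>: "coordinates bs \<phi>" and \<phi>': "coordinates bs' \<phi>'"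
    using basis_coordinates d b by blast
  have as: "\<And>i. i < ?n \<Longrightarrow> additive_scaling V (\<lambda>v. \<phi> v i)"
    and as': "\<And>i. i < ?n \<Longrightarrow> additive_scaling V (\<lambda>v. \<phi>' v i)"
    and rep: "\<And>v. v \<in> carrier V \<Longrightarrow> v = (\<Oplus>i\<in>{..<?n}. \<phi> v i \<odot> bs ! i)"
    and c: "set bs \<subseteq> carrier V" "set bs' \<subseteq> carrier V"
    and \<delta>': "\<And>i j. i < ?n \<Longrightarrow> j < ?n \<Longrightarrow> \<phi>' (bs' ! j) i = (if i = j then 1 else 0)"
    using \<phi> \<phi>' by (auto simp: coordinates_def nn)
  define S where "S = mat ?n ?n (\<lambda>(i, j). \<phi> (bs' ! j) i)"
  define T where "T = mat ?n ?n (\<lambda>(i, j). \<phi>' (bs ! j) i)"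
  have ST: "S \<in> carrier_mat ?n ?n" "T \<in> carrier_mat ?n ?n" by (auto simp: S_def T_def)
  have b'c: "bs' ! j \<in> carrier V" if "j < ?n" for j using c nn that by auto
  have TS: "T * S = 1\<^sub>m ?n"
  proof (rule eq_matI)
    fix k j assume "k < dim_row (1\<^sub>m ?n)" "j < dim_col (1\<^sub>m ?n)"
    then have kj: "k < ?n" "j < ?n" by auto
    have "\<phi>' (bs' ! j) k = (\<Sum>i<?n. \<phi> (bs' ! j) i * \<phi>' (bs ! i) k)"
      using additive_scaling_comb[OF as'[OF kj(1)], of "{..<?n}" "\<lambda>i. bs ! i" "\<phi> (bs' ! j)"]
        rep[OF b'c[OF kj(2)]] c by auto
    then show "(T * S) $$ (k, j) = 1\<^sub>m ?n $$ (k, j)"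
      using kj \<delta>' by (simp add: S_def T_def scalar_prod_def lessThan_atLeast0 mult.commute)
  qed (auto simp: S_def T_def)
  have MS: "M * S = S * M'"
  proof (rule eq_matI)
    fix k j assume "k < dim_row (S * M')" "j < dim_col (S * M')"
    then have kj: "k < ?n" "j < ?n" using M' ST nn by auto
    have "f (bs' ! j) = (\<Oplus>i\<in>{..<?n}. \<phi> (bs' ! j) i \<odot> f (bs ! i))"
      using linear_endo_comb[OF f, of "{..<?n}" "\<lambda>i. bs ! i" "\<phi> (bs' ! j)"]
        rep[OF b'c[OF kj(2)]] c by auto
    then have "\<phi> (f (bs' ! j)) k = (\<Sum>i<?n. \<phi> (bs' ! j) i * \<phi> (f (bs ! i)) k)"
      using additive_scaling_comb[OF as[OF kj(1)], of "{..<?n}" "\<lambda>i. f (bs ! i)" "\<phi> (bs' ! j)"] c f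
      by (auto simp: linear_endo_def Pi_iff)
    also have "\<dots> = (\<Sum>i<?n. \<phi> (bs' ! j) i * M $$ (k, i))"
      using coordinates_comb[OF \<phi> kj(1) fM] by (intro sum.cong) auto
    also have "\<dots> = (M * S) $$ (k, j)"
      using kj M by (simp add: S_def scalar_prod_def lessThan_atLeast0 mult.commute)
    finally have 1: "\<phi> (f (bs' ! j)) k = (M * S) $$ (k, j)" .
    have "\<phi> (f (bs' ! j)) k = (\<Sum>i<?n. M' $$ (i, j) * \<phi> (bs' ! i) k)"
      using additive_scaling_comb[OF as[OF kj(1)], of "{..<?n}" "\<lambda>i. bs' ! i" "\<lambda>i. M' $$ (i, j)"]
        fM'[of j] kj c nn by auto
    also have "\<dots> = (S * M') $$ (k, j)"
      using kj M' nn by (simp add: S_def scalar_prod_def lessThan_atLeast0 mult.commute)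
    finally show "(M * S) $$ (k, j) = (S * M') $$ (k, j)" using 1 by simp
  qed (use M M' nn in \<open>auto simp: S_def\<close>)
  have STI: "S * T = 1\<^sub>m ?n" using mat_mult_left_right_inverse[OF ST(2,1) TS] .
  have M'n: "M' \<in> carrier_mat ?n ?n" using M' nn by simp
  have "M = M * (S * T)" using M STI by simp
  also have "\<dots> = M * S * T" using M ST by (simp add: assoc_mult_mat)
  also have "\<dots> = S * M' * T" by (simp add: MS)
  finally have "M = S * M' * T" .
  then have "similar_mat M M'"
    using STI TS M M'n ST by (intro similar_matI[of _ _ S T ?n]) auto
  then show ?thesis
    using det_minus_t_char_poly[OF M] det_minus_t_char_poly[OF M'n] char_poly_similar by metis
qed

lemma (in complex_space) endo_polynomial_eq:
  assumes "linear_endo V f" "represents_endo V f bs M"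
  shows "endo_polynomial V f = det_minus_t M"
  unfolding endo_polynomial_def
  using assms represents_endo_unique[OF assms(1)] by (intro the_equality) blast+

lemma (in complex_space) represents_endo_exists:
  assumes f: "linear_endo V f" and fin: "fin_dim"
  shows "\<exists>bs M. represents_endo V f bs M"
proof -
  obtain B where B: "finite B" "basis B" using finite_basis_exists[OF fin] by auto
  obtain bs where bs: "distinct bs" "set bs = B" using finite_distinct_list[OF B(1)] by auto
  then have b: "basis (set bs)" using B by simp
  obtain \<phi> where \<phi>: "coordinates bs \<phi>" using basis_coordinates[OF bs(1) b] by auto
  have "bs ! j \<in> carrier V" if "j < length bs" for j
    using b that by (auto simp: basis_def)
  then have "represents_endo V f bs (mat (length bs) (length bs) (\<lambda>(i, j). \<phi> (f (bs ! j)) i))"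
    unfolding represents_endo_def using bs b
  proof (intro conjI allI impI)
    fix j assume j: "j < length bs" and *: "\<And>j. j < length bs \<Longrightarrow> bs ! j \<in> carrier V"
    have "f (bs ! j) \<in> carrier V" using f *[OF j] by (auto simp: linear_endo_def)
    then have "f (bs ! j) = (\<Oplus>i\<in>{..<length bs}. \<phi> (f (bs ! j)) i \<odot> bs ! i)"
      using \<phi> by (auto simp: coordinates_def)
    also have "\<dots> = (\<Oplus>i\<in>{..<length bs}.
        mat (length bs) (length bs) (\<lambda>(i, j). \<phi> (f (bs ! j)) i) $$ (i, j) \<odot> bs ! i)"
      using j * by (intro M.finsum_cong') auto
    finally show "f (bs ! j) = \<dots>" .
  qed auto
  then show ?thesis by blast
qed

text \<open>The transpose of \<open>M\<close> has the same characteristic polynomial. An eigenvector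
  \<open>y\<close> of the transpose lists the values on the basis of a functional that
  \<open>f\<close> pulls back to \<open>z\<close> times itself.\<close>

lemma (in complex_space) left_eigenfunctional:
  assumes f: "linear_endo V f" and r: "represents_endo V f bs M" and z: "poly (det_minus_t M) z = 0"
  shows "\<exists>\<xi>. additive_scaling V \<xi> \<and> (\<exists>v\<in>carrier V. \<xi> v \<noteq> 0) \<and> (\<forall>v\<in>carrier V. \<xi> (f v) = z * \<xi> v)"
proof -
  let ?n = "length bs"
  have d: "distinct bs" and b: "basis (set bs)" and M: "M \<in> carrier_mat ?n ?n"
    and fM: "\<And>j. j < ?n \<Longrightarrow> f (bs ! j) = (\<Oplus>i\<in>{..<?n}. M $$ (i, j) \<odot> bs ! i)"
    using r by (auto simp: represents_endo_def)
  obtain \<phi> where \<phi>: "coordinates bs \<phi>" using basis_coordinates[OF d b] by auto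
  then have c: "set bs \<subseteq> carrier V" and as: "\<And>i. i < ?n \<Longrightarrow> additive_scaling V (\<lambda>v. \<phi> v i)"
    and rep: "\<And>v. v \<in> carrier V \<Longrightarrow> v = (\<Oplus>i\<in>{..<?n}. \<phi> v i \<odot> bs ! i)"
    and \<delta>: "\<And>i j. i < ?n \<Longrightarrow> j < ?n \<Longrightarrow> \<phi> (bs ! j) i = (if i = j then 1 else 0)"
    by (auto simp: coordinates_def)
  have "poly (char_poly M) z = 0"
    using z det_minus_t_char_poly[OF M] by simp
  then have "poly (char_poly M\<^sup>T) z = 0"
    using char_poly_transpose_mat[OF M] by simp
  then obtain y where y: "y \<in> carrier_vec ?n" "y \<noteq> 0\<^sub>v ?n" "M\<^sup>T *\<^sub>v y = z \<cdot>\<^sub>v y"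
    using eigenvalue_root_char_poly[of "M\<^sup>T" ?n z] M by (auto simp: eigenvalue_def eigenvector_def)
  define \<xi> where "\<xi> v = (\<Sum>i<?n. y $ i * \<phi> v i)" for v
  have \<xi>: "additive_scaling V \<xi>"
    using as unfolding additive_scaling_def \<xi>_def
    by (auto simp: sum.distrib sum_distrib_left distrib_left mult.left_commute intro!: sum.cong)
  have \<xi>b: "\<xi> (bs ! j) = y $ j" if "j < ?n" for j
    unfolding \<xi>_def using that \<delta> by (intro sum_Kronecker) auto
  have \<xi>fb: "\<xi> (f (bs ! j)) = z * y $ j" if j: "j < ?n" for j
  proof -
    have "\<xi> (f (bs ! j)) = (\<Sum>i<?n. M $$ (i, j) * \<xi> (bs ! i))"
      unfolding fM[OF j] using c by (intro additive_scaling_comb[OF \<xi>]) auto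
    also have "\<dots> = (\<Sum>i<?n. M $$ (i, j) * y $ i)" using \<xi>b by simp
    also have "\<dots> = (M\<^sup>T *\<^sub>v y) $ j"
      using j M y(1) by (simp add: scalar_prod_def lessThan_atLeast0)
    also have "\<dots> = z * y $ j" using y j by auto
    finally show ?thesis .
  qed
  have "\<xi> (f v) = z * \<xi> v" if v: "v \<in> carrier V" for v
  proof -
    have "\<xi> (f v) = \<xi> (\<Oplus>i\<in>{..<?n}. \<phi> v i \<odot> f (bs ! i))"
      using linear_endo_comb[OF f, of "{..<?n}" "\<lambda>i. bs ! i" "\<phi> v"] rep[OF v] c by auto
    also have "\<dots> = (\<Sum>i<?n. \<phi> v i * \<xi> (f (bs ! i)))"
      using c f by (intro additive_scaling_comb[OF \<xi>]) (auto simp: linear_endo_def)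
    also have "\<dots> = z * \<xi> v"
      using \<xi>fb by (simp add: \<xi>_def sum_distrib_left algebra_simps)
    finally show ?thesis .
  qed
  moreover obtain i where "i < ?n" "y $ i \<noteq> 0"
    using y by (metis carrier_vecD eq_vecI index_zero_vec(1,2))
  then have "\<exists>v\<in>carrier V. \<xi> v \<noteq> 0"
    using \<xi>b c by (intro bexI[of _ "bs ! i"]) auto
  ultimately show ?thesis using \<xi> by blast
qed

lemma (in complex_space) endo_polynomial_eigenbasis:
  assumes f: "linear_endo V f" and c: "coordinates bs \<phi>"
    and ev: "\<And>i. i < length bs \<Longrightarrow> f (bs ! i) = ev i \<odot> bs ! i"
  shows "fin_dim" "endo_polynomial V f = (\<Prod>i<length bs. [:ev i, - 1:])"
proof -
  let ?n = "length bs"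
  note b = coordinates_basis[OF c]
  have carr: "set bs \<subseteq> carrier V" using c by (simp add: coordinates_def)
  show "fin_dim" using b(2) unfolding fin_dim_def basis_def by blast
  define M where "M = mat ?n ?n (\<lambda>(i, j). if i = j then ev i else 0)"
  have M: "M \<in> carrier_mat ?n ?n" by (simp add: M_def)
  have "represents_endo V f bs M"
    unfolding represents_endo_def
  proof (intro conjI allI impI b M)
    fix j assume j: "j < ?n"
    have "(\<Oplus>i\<in>{..<?n}. M $$ (i, j) \<odot> bs ! i)
        = (\<Oplus>i\<in>{..<?n}. if j = i then ev i \<odot> bs ! i else \<zero>)"
      using j carr by (intro M.finsum_cong') (auto simp: M_def)
    also have "\<dots> = ev j \<odot> bs ! j"
      using j carr M.finsum_singleton[of j "{..<?n}" "\<lambda>i. ev i \<odot> bs ! i"] by auto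
    finally show "f (bs ! j) = (\<Oplus>i\<in>{..<?n}. M $$ (i, j) \<odot> bs ! i)"
      using ev[OF j] by simp
  qed
  then have "endo_polynomial V f = det_minus_t M" by (rule endo_polynomial_eq[OF f])
  also have "\<dots> = (\<Prod>i<?n. [:ev i, - 1:])"
  proof -
    let ?A = "map_mat (\<lambda>c. [:c:]) M - [:0, 1:] \<cdot>\<^sub>m 1\<^sub>m (dim_row M)"
    have A: "?A \<in> carrier_mat ?n ?n" using M by auto
    have "upper_triangular ?A" using M by (auto simp: M_def)
    then have "det ?A = prod_list (diag_mat ?A)" using A by (rule det_upper_triangular)
    also have "\<dots> = (\<Prod>i<?n. ?A $$ (i, i))"
      unfolding prod_list_diag_prod using A by (intro prod.cong) auto
    also have "\<dots> = (\<Prod>i<?n. [:ev i, - 1:])"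
      by (intro prod.cong) (auto simp: M_def)
    finally show ?thesis by (simp add: det_minus_t_def)
  qed
  finally show "endo_polynomial V f = (\<Prod>i<?n. [:ev i, - 1:])" .
qed

section \<open>Complexification of abelian groups\<close>

lemma complex_group_simps [simp]:
  "carrier complex_group = UNIV" "x \<otimes>\<^bsub>complex_group\<^esub> y = x + y" "\<one>\<^bsub>complex_group\<^esub> = 0"
  by (simp_all add: complex_group_def)

lemma comm_group_complex_group: "comm_group complex_group"
  by (rule comm_groupI) (auto simp: complex_group_def intro: exI[of _ "- x" for x])

locale complexified = comm_group A for A :: "('a, 'c) monoid_scheme" (structure)
begin

abbreviation Fr :: "(('a \<times> complex) \<Rightarrow>\<^sub>0 int) monoid" where
  "Fr \<equiv> free_Abelian_group (carrier A \<times> UNIV)"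

abbreviation Rel :: "(('a \<times> complex) \<Rightarrow>\<^sub>0 int) set" where
  "Rel \<equiv> tensor_relations A complex_group"

abbreviation V :: "(complex, (('a \<times> complex) \<Rightarrow>\<^sub>0 int) set) module" where
  "V \<equiv> complexification A"

definition Rel_gens :: "(('a \<times> complex) \<Rightarrow>\<^sub>0 int) set" where
  "Rel_gens = {frag_of (a \<otimes> a', b) - frag_of (a, b) - frag_of (a', b)
       | a a' b. a \<in> carrier A \<and> a' \<in> carrier A} \<union>
      {frag_of (a, b + b') - frag_of (a, b) - frag_of (a, b') | a b b'. a \<in> carrier A}"

lemma Rel_eq: "Rel = generate Fr Rel_gens"
  unfolding tensor_relations_def Rel_gens_def by simp

lemma frag_diff_in_Fr: "x \<in> carrier Fr \<Longrightarrow> y \<in> carrier Fr \<Longrightarrow> x - y \<in> carrier Fr"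
  using keys_diff[of x y] by auto

lemma frag_of_in_Fr: "a \<in> carrier A \<Longrightarrow> frag_of (a, z) \<in> carrier Fr"
  by simp

lemma Rel_gens_carrier: "Rel_gens \<subseteq> carrier Fr"
  unfolding Rel_gens_def
  by (auto simp del: carrier_free_Abelian_group_iff intro!: frag_diff_in_Fr frag_of_in_Fr)

lemma Rel_subgroup: "subgroup Rel Fr"
  unfolding Rel_eq using group.generate_is_subgroup[OF group_free_Abelian_group Rel_gens_carrier] .

lemma Rel_normal: "Rel \<lhd> Fr"
  using comm_group.subgroup_imp_normal[OF abelian_free_Abelian_group Rel_subgroup] .

lemma Rel_minus: "x \<in> Rel \<Longrightarrow> - x \<in> Rel"
  using subgroup.m_inv_closed[OF Rel_subgroup, of x] subgroup.subset[OF Rel_subgroup]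
  by (metis carrier_free_Abelian_group_iff inv_free_Abelian_group subsetD)

definition cl :: "(('a \<times> complex) \<Rightarrow>\<^sub>0 int) \<Rightarrow> (('a \<times> complex) \<Rightarrow>\<^sub>0 int) set" where
  "cl p = Rel #>\<^bsub>Fr\<^esub> p"

lemma cl_eq: "cl p = (\<lambda>r. r + p) ` Rel"
  unfolding cl_def r_coset_def by auto

lemma cl_add_Rel: "r \<in> Rel \<Longrightarrow> cl (r + p) = cl p"
proof -
  assume r: "r \<in> Rel"
  have "s + r \<in> Rel" if "s \<in> Rel" for s
    using subgroup.m_closed[OF Rel_subgroup that r] by simp
  moreover have "\<exists>t\<in>Rel. s = t + r" if "s \<in> Rel" for s
    using subgroup.m_closed[OF Rel_subgroup that Rel_minus[OF r]] by (intro bexI[of _ "s - r"]) auto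
  ultimately show ?thesis
    unfolding cl_eq by (auto simp: image_iff add.assoc)
qed

lemma carrier_V: "carrier V = cl ` carrier Fr"
  unfolding complexification_def tensor_Z_def cl_def by (simp add: carrier_FactGroup)

lemma add_V: "p \<in> carrier Fr \<Longrightarrow> q \<in> carrier Fr \<Longrightarrow> cl p \<oplus>\<^bsub>V\<^esub> cl q = cl (p + q)"
  unfolding complexification_def tensor_Z_def cl_def using normal.rcos_sum[OF Rel_normal] by simp

lemma zero_V: "\<zero>\<^bsub>V\<^esub> = cl 0"
  unfolding complexification_def tensor_Z_def cl_eq by simp

lemma abelian_group_V: "abelian_group V"
proof -
  interpret Q: comm_group "Fr Mod Rel"
    using comm_group.abelian_FactGroup[OF abelian_free_Abelian_group Rel_subgroup] .
  have e: "carrier V = carrier (Fr Mod Rel)" "(\<oplus>\<^bsub>V\<^esub>) = (\<otimes>\<^bsub>Fr Mod Rel\<^esub>)" "\<zero>\<^bsub>V\<^esub> = \<one>\<^bsub>Fr Mod Rel\<^esub>"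
    by (simp_all add: complexification_def tensor_Z_def)
  show ?thesis
    apply (rule abelian_groupI; unfold e)
         apply (erule (1) Q.m_closed)
        apply (rule Q.one_closed)
       apply (erule (2) Q.m_assoc)
      apply (erule (1) Q.m_comm)
     apply (erule Q.l_one)
    apply (rule bexI, erule Q.l_inv, erule Q.inv_closed)
    done
qed

definition tens :: "'a \<Rightarrow> complex \<Rightarrow> (('a \<times> complex) \<Rightarrow>\<^sub>0 int) set" where
  "tens a z = cl (frag_of (a, z))"

lemma tens_carrier [simp, intro]: "a \<in> carrier A \<Longrightarrow> tens a z \<in> carrier V"
  unfolding carrier_V tens_def by auto

lemma cl_eqI: "p - q \<in> Rel \<Longrightarrow> cl p = cl q"
  using cl_add_Rel[of "p - q" q] by simp

lemma tens_mult_left: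
  assumes "a \<in> carrier A" "b \<in> carrier A"
  shows "tens (a \<otimes> b) z = tens a z \<oplus>\<^bsub>V\<^esub> tens b z"
proof -
  have "frag_of (a \<otimes> b, z) - (frag_of (a, z) + frag_of (b, z)) \<in> Rel_gens"
    unfolding Rel_gens_def diff_diff_eq[symmetric] using assms by blast
  then have "cl (frag_of (a \<otimes> b, z)) = cl (frag_of (a, z) + frag_of (b, z))"
    unfolding Rel_eq[symmetric] by (intro cl_eqI) (simp add: Rel_eq generate.incl)
  then show ?thesis using assms by (simp add: tens_def add_V del: carrier_free_Abelian_group_iff add: frag_of_in_Fr)
qed

lemma tens_add_right:
  assumes "a \<in> carrier A"
  shows "tens a (z + w) = tens a z \<oplus>\<^bsub>V\<^esub> tens a w"
proof -
  have "frag_of (a, z + w) - (frag_of (a, z) + frag_of (a, w)) \<in> Rel_gens"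
    unfolding Rel_gens_def diff_diff_eq[symmetric] using assms by blast
  then have "cl (frag_of (a, z + w)) = cl (frag_of (a, z) + frag_of (a, w))"
    unfolding Rel_eq[symmetric] by (intro cl_eqI) (simp add: Rel_eq generate.incl)
  then show ?thesis using assms by (simp add: tens_def add_V del: carrier_free_Abelian_group_iff add: frag_of_in_Fr)
qed

lemma tens_zero: "a \<in> carrier A \<Longrightarrow> tens a 0 = \<zero>\<^bsub>V\<^esub>"
proof -
  interpret abelian_group V by (rule abelian_group_V)
  assume a: "a \<in> carrier A"
  then have "tens a 0 \<oplus>\<^bsub>V\<^esub> tens a 0 = tens a 0" using tens_add_right[of a 0 0] by simp
  then show ?thesis using a tens_carrier[OF a, of 0]
    by (metis add.r_cancel_one')
qed

text \<open>Pure tensors generate \<open>V\<close> under addition alone, because the negative of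
  \<open>tens a z\<close> is \<open>tens a (- z)\<close>.\<close>

lemma V_induct [consumes 1, case_names tens add]:
  assumes v: "v \<in> carrier V"
    and t: "\<And>a z. a \<in> carrier A \<Longrightarrow> Q (tens a z)"
    and add: "\<And>u w. u \<in> carrier V \<Longrightarrow> w \<in> carrier V \<Longrightarrow> Q u \<Longrightarrow> Q w \<Longrightarrow> Q (u \<oplus>\<^bsub>V\<^esub> w)"
  shows "Q v"
proof -
  interpret abelian_group V by (rule abelian_group_V)
  have zero: "Q (cl 0)" using t[of "\<one>" 0] tens_zero[of "\<one>"] by (simp add: zero_V)
  obtain p where p: "p \<in> carrier Fr" "v = cl p" using v by (auto simp: carrier_V)
  have Fr_minus: "x \<in> carrier Fr \<Longrightarrow> - x \<in> carrier Fr" for x by simp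
  \<comment> \<open>The induction on the free abelian group passes through differences, while
    \<open>Q\<close> is only assumed to be closed under sums; so the claim is carried for
    \<open>p\<close> and \<open>- p\<close> together.\<close>
  have "Q (cl p) \<and> Q (cl (- p))"
  proof (rule free_Abelian_group_induct[where P = "\<lambda>p. Q (cl p) \<and> Q (cl (- p))"])
    show "Poly_Mapping.keys p \<subseteq> carrier A \<times> UNIV" using p(1) by simp
    show "Q (cl 0) \<and> Q (cl (- 0))" using zero by simp
  next
    fix x y assume 2: "Poly_Mapping.keys x \<subseteq> carrier A \<times> UNIV" "Poly_Mapping.keys y \<subseteq> carrier A \<times> (UNIV :: complex set)"
      "Q (cl x) \<and> Q (cl (- x))" "Q (cl y) \<and> Q (cl (- y))"
    then have c: "x \<in> carrier Fr" "y \<in> carrier Fr" "- x \<in> carrier Fr" "- y \<in> carrier Fr" by auto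
    have "cl (x - y) = cl x \<oplus>\<^bsub>V\<^esub> cl (- y)" "cl (- (x - y)) = cl (- x) \<oplus>\<^bsub>V\<^esub> cl y"
      using add_V[OF c(1,4)] add_V[OF c(3,2)] by simp_all
    then show "Q (cl (x - y)) \<and> Q (cl (- (x - y)))" using 2 c by (auto intro!: add simp: carrier_V)
  next
    fix az :: "'a \<times> complex" assume "az \<in> carrier A \<times> UNIV"
    then obtain a z where az: "az = (a, z)" "a \<in> carrier A" by auto
    have c: "frag_of (a, z) \<in> carrier Fr" using az(2) by simp
    have "cl (- frag_of az) \<oplus>\<^bsub>V\<^esub> tens a z = \<zero>\<^bsub>V\<^esub>"
      unfolding tens_def az(1) using add_V[OF Fr_minus[OF c] c] by (simp add: zero_V)
    moreover have "tens a (- z) \<oplus>\<^bsub>V\<^esub> tens a z = \<zero>\<^bsub>V\<^esub>"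
      using tens_add_right[OF az(2), of "- z" z] tens_zero[OF az(2)] by simp
    moreover have "cl (- frag_of az) \<in> carrier V"
      using Fr_minus[OF c] by (simp add: carrier_V az del: carrier_free_Abelian_group_iff)
    ultimately have "cl (- frag_of az) = tens a (- z)"
      using az(2) by (metis add.right_cancel tens_carrier)
    then show "Q (cl (frag_of az)) \<and> Q (cl (- frag_of az))"
      using t[OF az(2)] az by (simp add: tens_def)
  qed
  then show ?thesis using p by simp
qed

abbreviation ext :: "('a \<Rightarrow> 'a) \<Rightarrow> (complex \<Rightarrow> complex) \<Rightarrow> (('a \<times> complex) \<Rightarrow>\<^sub>0 int) \<Rightarrow> (('a \<times> complex) \<Rightarrow>\<^sub>0 int)" where
  "ext h k \<equiv> frag_extend (\<lambda>(a, b). frag_of (h a, k b))"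

context
  fixes h :: "'a \<Rightarrow> 'a" and k :: "complex \<Rightarrow> complex"
  assumes h: "h \<in> hom A A" and k: "\<And>z w. k (z + w) = k z + k w"
begin

lemma h_closed: "a \<in> carrier A \<Longrightarrow> h a \<in> carrier A"
  using h by (auto simp: hom_def)

lemma ext_Fr: assumes "p \<in> carrier Fr" shows "ext h k p \<in> carrier Fr"
proof (rule free_Abelian_group_induct[where P = "\<lambda>p. ext h k p \<in> carrier Fr"])
  show "Poly_Mapping.keys p \<subseteq> carrier A \<times> UNIV" using assms by simp
next
  fix x y assume "ext h k x \<in> carrier Fr" "ext h k y \<in> carrier Fr"
  then show "ext h k (x - y) \<in> carrier Fr"
    unfolding frag_extend_diff by (rule frag_diff_in_Fr)
next
  fix x :: "'a \<times> complex" assume "x \<in> carrier A \<times> UNIV"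
  then show "ext h k (frag_of x) \<in> carrier Fr" by (cases x) (simp add: h_closed)
qed simp

lemma ext_Rel_gens: assumes "s \<in> Rel_gens" shows "ext h k s \<in> Rel_gens"
proof -
  consider (l) a a' b where "s = frag_of (a \<otimes> a', b) - frag_of (a, b) - frag_of (a', b)"
      "a \<in> carrier A" "a' \<in> carrier A"
    | (r) a b b' where "s = frag_of (a, b + b') - frag_of (a, b) - frag_of (a, b')" "a \<in> carrier A"
    using assms unfolding Rel_gens_def by blast
  then show ?thesis
  proof cases
    case l
    then have "ext h k s = frag_of (h a \<otimes> h a', k b) - frag_of (h a, k b) - frag_of (h a', k b)"
      by (simp add: frag_extend_diff hom_mult[OF h])
    then show ?thesis unfolding Rel_gens_def using l h_closed by blast
  next
    case r
    then have "ext h k s = frag_of (h a, k b + k b') - frag_of (h a, k b) - frag_of (h a, k b')"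
      by (simp add: frag_extend_diff k)
    then show ?thesis unfolding Rel_gens_def using r h_closed by blast
  qed
qed

lemma ext_Rel: assumes "p \<in> Rel" shows "ext h k p \<in> Rel"
  using assms unfolding Rel_eq
proof (induction p rule: generate.induct)
  case one
  show ?case using generate.one[of Fr] by simp
next
  case (incl s)
  then show ?case by (intro generate.incl ext_Rel_gens)
next
  case (inv s)
  then have "ext h k s \<in> Rel" unfolding Rel_eq by (intro generate.incl ext_Rel_gens)
  moreover have "s \<in> carrier Fr" using inv Rel_gens_carrier by blast
  then have "inv\<^bsub>Fr\<^esub> s = - s" by simp
  ultimately show ?case
    using Rel_minus by (simp add: frag_extend_minus flip: Rel_eq)
next
  case (eng x y)
  then show ?case using generate.eng[of _ Fr] by (simp add: frag_extend_add)
qed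

text \<open>The members of \<open>cl p\<close> differ by relations, and \<open>ext h k\<close> maps
  relations to relations; so the union in \<open>tensor_map\<close> runs over copies of a single
  coset, and over at least one.\<close>

lemma tensor_map_cl:
  assumes p: "p \<in> carrier Fr"
  shows "tensor_map A complex_group h k (cl p) = cl (ext h k p)"
proof -
  have "Rel #>\<^bsub>Fr\<^esub> ext h k q = cl (ext h k p)" if q: "q \<in> cl p" for q
  proof -
    obtain r where r: "r \<in> Rel" "q = r + p" using q by (auto simp: cl_eq)
    show ?thesis
      using cl_add_Rel[OF ext_Rel[OF r(1)], of "ext h k p"] by (simp add: r frag_extend_add cl_def)
  qed
  moreover have "p \<in> cl p"
    unfolding cl_eq using subgroup.one_closed[OF Rel_subgroup] by (intro image_eqI[of _ _ 0]) auto
  ultimately show ?thesis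
    unfolding tensor_map_def complex_group_simps by blast
qed

lemma tensor_map_tens:
  "a \<in> carrier A \<Longrightarrow> tensor_map A complex_group h k (tens a z) = tens (h a) (k z)"
  using tensor_map_cl[of "frag_of (a, z)"] by (simp add: tens_def)

lemma tensor_map_add:
  assumes "u \<in> carrier V" "v \<in> carrier V"
  shows "tensor_map A complex_group h k (u \<oplus>\<^bsub>V\<^esub> v)
    = tensor_map A complex_group h k u \<oplus>\<^bsub>V\<^esub> tensor_map A complex_group h k v"
proof -
  obtain p q where pq: "p \<in> carrier Fr" "q \<in> carrier Fr" "u = cl p" "v = cl q"
    using assms by (auto simp: carrier_V)
  have "p + q \<in> carrier Fr"
    using subgroup.m_closed[OF group.subgroup_self[OF group_free_Abelian_group] pq(1,2)] by simp
  then show ?thesis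
    unfolding pq using pq(1,2)
    by (simp add: add_V tensor_map_cl frag_extend_add ext_Fr del: carrier_free_Abelian_group_iff)
qed

lemma tensor_map_closed:
  "u \<in> carrier V \<Longrightarrow> tensor_map A complex_group h k u \<in> carrier V"
  unfolding carrier_V by (auto simp: tensor_map_cl ext_Fr simp del: carrier_free_Abelian_group_iff)

end

lemma smult_V: "c \<odot>\<^bsub>V\<^esub> v = tensor_map A complex_group (\<lambda>a. a) (\<lambda>w. c * w) v"
  by (simp add: complexification_def)

lemma id_hom: "(\<lambda>a. a) \<in> hom A A"
  by (simp add: hom_def)

lemma smult_tens: "a \<in> carrier A \<Longrightarrow> c \<odot>\<^bsub>V\<^esub> tens a z = tens a (c * z)"
  unfolding smult_V by (rule tensor_map_tens[OF id_hom]) (auto simp: algebra_simps)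

lemma smult_V_add:
  "u \<in> carrier V \<Longrightarrow> v \<in> carrier V \<Longrightarrow> c \<odot>\<^bsub>V\<^esub> (u \<oplus>\<^bsub>V\<^esub> v) = c \<odot>\<^bsub>V\<^esub> u \<oplus>\<^bsub>V\<^esub> c \<odot>\<^bsub>V\<^esub> v"
  unfolding smult_V by (rule tensor_map_add[OF id_hom]) (auto simp: algebra_simps)

lemma smult_V_closed: "v \<in> carrier V \<Longrightarrow> c \<odot>\<^bsub>V\<^esub> v \<in> carrier V"
  unfolding smult_V by (rule tensor_map_closed[OF id_hom]) (auto simp: algebra_simps)

text \<open>The laws for scalars are compatible with addition of vectors, so \<open>V_induct\<close>
  reduces them to pure tensors.\<close>

lemma complex_space_V: "complex_space V"
proof -
  interpret abelian_group V by (rule abelian_group_V)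
  have "module class_ring V"
  proof (rule moduleI)
    show "cring (class_ring :: complex ring)" by (rule class_cring.is_cring)
    show "abelian_group V" by (rule abelian_group_V)
  next
    fix a b :: complex and x assume x: "x \<in> carrier V"
    then have "(a + b) \<odot>\<^bsub>V\<^esub> x = a \<odot>\<^bsub>V\<^esub> x \<oplus>\<^bsub>V\<^esub> b \<odot>\<^bsub>V\<^esub> x"
    proof (induction x rule: V_induct)
      case (add u w)
      then show ?case by (simp add: smult_V_add smult_V_closed a_ac)
    qed (simp add: smult_tens tens_add_right distrib_right)
    then show "(a \<oplus>\<^bsub>class_ring\<^esub> b) \<odot>\<^bsub>V\<^esub> x = a \<odot>\<^bsub>V\<^esub> x \<oplus>\<^bsub>V\<^esub> b \<odot>\<^bsub>V\<^esub> x" by simp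
    show "(a \<otimes>\<^bsub>class_ring\<^esub> b) \<odot>\<^bsub>V\<^esub> x = a \<odot>\<^bsub>V\<^esub> (b \<odot>\<^bsub>V\<^esub> x)"
      using x by (induction x rule: V_induct) (auto simp: smult_tens smult_V_add smult_V_closed mult.assoc)
  next
    fix x assume "x \<in> carrier V"
    then show "\<one>\<^bsub>class_ring\<^esub> \<odot>\<^bsub>V\<^esub> x = x"
      by (induction x rule: V_induct) (auto simp: smult_tens smult_V_add)
  qed (auto simp: smult_V_add smult_V_closed)
  then show ?thesis
    by (simp add: complex_space_def vectorspace_def class_field)
qed

sublocale complex_space V
  by (rule complex_space_V)

lemma linear_endo_tensor_map:
  assumes h: "h \<in> hom A A"
  shows "linear_endo V (tensor_map A complex_group h (\<lambda>z. z))"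
    and "a \<in> carrier A \<Longrightarrow> tensor_map A complex_group h (\<lambda>z. z) (tens a z) = tens (h a) z"
proof -
  show t: "a \<in> carrier A \<Longrightarrow> tensor_map A complex_group h (\<lambda>z. z) (tens a z) = tens (h a) z" for a z
    by (rule tensor_map_tens[OF h]) auto
  let ?T = "tensor_map A complex_group h (\<lambda>z. z)"
  have add: "?T (u \<oplus>\<^bsub>V\<^esub> v) = ?T u \<oplus>\<^bsub>V\<^esub> ?T v" if "u \<in> carrier V" "v \<in> carrier V" for u v
    using that by (intro tensor_map_add[OF h]) auto
  have closed: "?T u \<in> carrier V" if "u \<in> carrier V" for u
    using that by (intro tensor_map_closed[OF h]) auto
  have "?T (c \<odot>\<^bsub>V\<^esub> v) = c \<odot>\<^bsub>V\<^esub> ?T v" if "v \<in> carrier V" for c v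
    using that
  proof (induction v rule: V_induct)
    case (tens a z)
    then show ?case using h by (auto simp: smult_tens t hom_def Pi_iff)
  qed (simp add: smult_V_add smult_V_closed add closed)
  then show "linear_endo V ?T" using add closed by (auto simp: linear_endo_def)
qed

text \<open>The universal property of the tensor product, applied to the biadditive map that sends
  the pair of \<open>a\<close> and \<open>z\<close> to \<open>z * \<chi> a\<close>.\<close>

lemma functional_extension:
  assumes \<chi>: "\<And>a b. a \<in> carrier A \<Longrightarrow> b \<in> carrier A \<Longrightarrow> \<chi> (a \<otimes> b) = \<chi> a + (\<chi> b :: complex)"
  shows "\<exists>\<xi>. additive_scaling V \<xi> \<and> (\<forall>a\<in>carrier A. \<forall>z. \<xi> (tens a z) = z * \<chi> a)"
proof -
  obtain H where H: "H \<in> hom Fr complex_group"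
    "\<And>x. x \<in> carrier A \<times> UNIV \<Longrightarrow> H (frag_of x) = (case x of (a, z) \<Rightarrow> z * \<chi> a)"
    using comm_group.free_Abelian_group_universal[OF comm_group_complex_group,
        of "\<lambda>(a, z). z * \<chi> a" "carrier A \<times> UNIV"] by auto
  interpret H: group_hom Fr complex_group H
    using H(1) comm_group_complex_group by (simp add: group_hom_def group_hom_axioms_def comm_group_def)
  have Hadd: "H (p + q) = H p + H q" if "p \<in> carrier Fr" "q \<in> carrier Fr" for p q
    using hom_mult[OF H(1) that] by simp
  have Hdiff: "H (p - q) = H p - H q" if "p \<in> carrier Fr" "q \<in> carrier Fr" for p q
    using Hadd[OF frag_diff_in_Fr[OF that] that(2)] by simp
  have "Rel_gens \<subseteq> kernel Fr complex_group H"
  proof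
    fix s assume s: "s \<in> Rel_gens"
    consider (l) a a' b where "s = frag_of (a \<otimes> a', b) - frag_of (a, b) - frag_of (a', b)"
        "a \<in> carrier A" "a' \<in> carrier A"
      | (r) a b b' where "s = frag_of (a, b + b') - frag_of (a, b) - frag_of (a, b')" "a \<in> carrier A"
      using s unfolding Rel_gens_def by blast
    then have "H s = 0"
      by cases (simp_all add: Hdiff frag_diff_in_Fr frag_of_in_Fr H(2) \<chi> distrib_left distrib_right
          del: carrier_free_Abelian_group_iff)
    then show "s \<in> kernel Fr complex_group H"
      using s Rel_gens_carrier by (auto simp: kernel_def simp del: carrier_free_Abelian_group_iff)
  qed
  then have "Rel \<subseteq> kernel Fr complex_group H"
    unfolding Rel_eq
    by (intro group.generate_subgroup_incl[OF group_free_Abelian_group] H.subgroup_kernel)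
  then obtain \<xi> where \<xi>: "\<xi> \<in> hom (Fr Mod Rel) complex_group"
    "\<And>p. p \<in> carrier Fr \<Longrightarrow> \<xi> (cl p) = H p"
    using H.FactGroup_universal_kernel[OF Rel_normal] unfolding cl_def by metis
  have t: "\<xi> (tens a z) = z * \<chi> a" if "a \<in> carrier A" for a z
    using \<xi>(2)[of "frag_of (a, z)"] H(2)[of "(a, z)"] that by (simp add: tens_def)
  have add: "\<xi> (u \<oplus>\<^bsub>V\<^esub> v) = \<xi> u + \<xi> v" if "u \<in> carrier V" "v \<in> carrier V" for u v
    using hom_mult[OF \<xi>(1), of u v] that by (simp add: complexification_def tensor_Z_def)
  have "\<xi> (c \<odot>\<^bsub>V\<^esub> v) = c * \<xi> v" if "v \<in> carrier V" for c v
    using that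
    by (induction v rule: V_induct) (auto simp: smult_tens t smult_V_add add smult_V_closed algebra_simps)
  then show ?thesis using add t unfolding additive_scaling_def by blast
qed

end

section \<open>The Alexander module and its characters\<close>

lemma (in group) inv_cancel:
  assumes "x \<in> carrier G" "y \<in> carrier G"
  shows "x \<otimes> (inv x \<otimes> y) = y" "inv x \<otimes> (x \<otimes> y) = y"
  using assms by (simp_all add: m_assoc[symmetric])

lemmas (in group) group_simps = m_assoc inv_cancel inv_mult_group

text \<open>\<open>Alexander_aut\<close> takes images of cosets; this identifies the image with the
  coset of the conjugate. All of the coset is reached because \<open>H\<close> is also stable under
  the inverse conjugation.\<close>

lemma (in normal) coset_conj_image:
  assumes "x \<in> carrier G" "g \<in> carrier G"
  shows "(\<lambda>g. inv x \<otimes> g \<otimes> x) ` (H #> g) = H #> (inv x \<otimes> g \<otimes> x)"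
proof -
  have *: "inv x \<otimes> (h \<otimes> g) \<otimes> x = (inv x \<otimes> h \<otimes> x) \<otimes> (inv x \<otimes> g \<otimes> x)" if "h \<in> H" for h
    using assms that by (simp add: group_simps)
  have "\<exists>h'\<in>H. h = inv x \<otimes> h' \<otimes> x" if "h \<in> H" for h
  proof (intro bexI)
    show "x \<otimes> h \<otimes> inv x \<in> H" using inv_op_closed2 assms that by blast
    show "h = inv x \<otimes> (x \<otimes> h \<otimes> inv x) \<otimes> x" using assms that by (simp add: group_simps)
  qed
  moreover have "inv x \<otimes> h \<otimes> x \<in> H" if "h \<in> H" for h
    using inv_op_closed1 assms that by blast
  ultimately show ?thesis
    unfolding r_coset_def image_UN by (auto simp: *)
qed

text \<open>What the arguments use of a Hurwitz C-group: \<open>gs\<close> are the generators of the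
  presentation, \<open>C\<close> all C-generators, and \<open>c\<close> will be the product of the
  generators, of degree \<open>e\<close>. The assumption \<open>kernel_eq\<close> ties
  \<open>\<nu>\<close> to the choice made inside \<open>C_kernel\<close>.\<close>

locale C_group_degree = group G for G (structure) +
  fixes C gs :: "'a set" and \<nu> :: "'a \<Rightarrow> int" and c :: 'a and e :: nat
  assumes gs_sub: "gs \<subseteq> C" and gs_ne: "gs \<noteq> {}" and gs_fin: "finite gs" and C_sub: "C \<subseteq> carrier G"
    and generated: "carrier G = generate G gs"
    and \<nu>_hom: "\<nu> \<in> hom G integer_group" and \<nu>_C: "\<And>x. x \<in> C \<Longrightarrow> \<nu> x = 1"
    and kernel_eq: "C_kernel G C = kernel G integer_group \<nu>"
    and c_carrier: "c \<in> carrier G" and c_central: "\<And>g. g \<in> carrier G \<Longrightarrow> g \<otimes> c = c \<otimes> g"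
    and \<nu>_c: "\<nu> c = int e" and e_pos: "e \<ge> 1"
begin

sublocale \<nu>: group_hom G integer_group \<nu>
  by (simp add: group_hom_def group_hom_axioms_def is_group \<nu>_hom)

lemma \<nu>_mult: "g \<in> carrier G \<Longrightarrow> k \<in> carrier G \<Longrightarrow> \<nu> (g \<otimes> k) = \<nu> g + \<nu> k"
  using \<nu>.hom_mult by simp

definition N :: "'a set" where "N = {g \<in> carrier G. \<nu> g = 0}"

lemma N_eq: "C_kernel G C = N"
  by (simp add: kernel_eq kernel_def N_def)

lemma N_I: "g \<in> carrier G \<Longrightarrow> \<nu> g = 0 \<Longrightarrow> g \<in> N"
  by (simp add: N_def)

lemma N_\<nu>: "g \<in> N \<Longrightarrow> \<nu> g = 0"
  by (simp add: N_def)

sublocale N: normal N G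
  using \<nu>.normal_kernel by (simp add: N_eq[symmetric] kernel_eq)

section \<open>The quotient N/N' and the action of the group on it\<close>

definition D :: "'a set" where "D = derived G N"

sublocale D: normal D G
  unfolding D_def by (rule derived_is_normal[OF N.normal_axioms])

lemma D_sub_N: "D \<subseteq> N"
  unfolding D_def using derived_incl[OF _ N.is_subgroup] by simp

abbreviation A :: "'a set monoid" where "A \<equiv> Alexander_group G C"

lemma A_eq: "A = (G\<lparr>carrier := N\<rparr>) Mod D"
  using derived_consistent[OF subset_refl N.is_subgroup]
  by (simp add: Alexander_group_def N_eq D_def Let_def)

abbreviation V where "V \<equiv> complexification A"

definition cls :: "'a \<Rightarrow> 'a set" where "cls g = D #> g"

lemma carrier_A: "carrier A = cls ` N"
  unfolding A_eq carrier_FactGroup cls_def by (simp add: r_coset_def)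

lemma D_normal_N: "D \<lhd> G\<lparr>carrier := N\<rparr>"
  unfolding D_def by (rule derived_subgroup_is_normal[OF N.is_subgroup])

lemma comm_group_A: "comm_group A"
  using group.derived_quot_is_comm_group[OF N.subgroup_is_group[OF is_group]]
    derived_consistent[OF subset_refl N.is_subgroup]
  by (simp add: A_eq D_def)

sublocale Z: complexified A
  by (simp add: complexified_def comm_group_A)

lemma cls_carrier: "g \<in> N \<Longrightarrow> cls g \<in> carrier A"
  by (simp add: carrier_A)

lemma cls_mult: "g \<in> N \<Longrightarrow> k \<in> N \<Longrightarrow> cls (g \<otimes> k) = cls g \<otimes>\<^bsub>A\<^esub> cls k"
  using normal.rcos_sum[OF D_normal_N, of g k]
  by (simp add: A_eq cls_def r_coset_def set_mult_def)

lemma cls_D: "g \<in> D \<Longrightarrow> cls g = \<one>\<^bsub>A\<^esub>"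
  using D.rcos_const[OF is_group] by (simp add: cls_def A_eq)

lemma conj_N: "y \<in> carrier G \<Longrightarrow> g \<in> N \<Longrightarrow> inv y \<otimes> g \<otimes> y \<in> N"
  by (rule N.inv_op_closed1)

lemma cls_conj_N: "b \<in> N \<Longrightarrow> g \<in> N \<Longrightarrow> cls (inv b \<otimes> g \<otimes> b) = cls g"
proof -
  assume b: "b \<in> N" and g: "g \<in> N"
  have "cls (inv b \<otimes> g \<otimes> b) = cls (inv b) \<otimes>\<^bsub>A\<^esub> cls g \<otimes>\<^bsub>A\<^esub> cls b"
    using b g by (simp add: cls_mult)
  also have "\<dots> = cls (inv b) \<otimes>\<^bsub>A\<^esub> cls b \<otimes>\<^bsub>A\<^esub> cls g"
    using b g by (simp add: Z.m_assoc Z.m_comm Z.m_lcomm cls_carrier)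
  also have "cls (inv b) \<otimes>\<^bsub>A\<^esub> cls b = cls (inv b \<otimes> b)"
    by (rule cls_mult[OF N.m_inv_closed[OF b] b, symmetric])
  also have "\<dots> \<otimes>\<^bsub>A\<^esub> cls g = cls (\<one> \<otimes> g)"
    using b g by (subst cls_mult) auto
  finally show ?thesis using g by simp
qed

text \<open>The group acts on N/N' through the degree: elements of equal degree differ by a factor
  in N, and N acts trivially on its abelianization.\<close>

lemma cls_conj_cong:
  assumes y: "y \<in> carrier G" "z \<in> carrier G" "\<nu> y = \<nu> z" and g: "g \<in> N"
  shows "cls (inv y \<otimes> g \<otimes> y) = cls (inv z \<otimes> g \<otimes> z)"
proof -
  define b where "b = inv z \<otimes> y"
  have b: "b \<in> N" using y by (intro N_I) (simp_all add: b_def \<nu>_mult)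
  have "y = z \<otimes> b" using y by (simp add: b_def group_simps)
  then have "inv y \<otimes> g \<otimes> y = inv b \<otimes> (inv z \<otimes> g \<otimes> z) \<otimes> b"
    using y b g by (simp add: group_simps)
  then show ?thesis using cls_conj_N[OF b conj_N[OF y(2) g]] by simp
qed

text \<open>The power \<open>y [^] e\<close> has the degree of the central element \<open>c\<close>,
  which acts trivially. This is h^e = 1.\<close>

lemma cls_conj_period:
  assumes y: "y \<in> carrier G" "\<nu> y = 1" and g: "g \<in> N"
  shows "cls (inv (y [^] e) \<otimes> g \<otimes> y [^] e) = cls g"
proof -
  have "\<nu> (y [^] e) = \<nu> c" using y \<nu>_c \<nu>.hom_nat_pow[of y e] by simp
  then have "cls (inv (y [^] e) \<otimes> g \<otimes> y [^] e) = cls (inv c \<otimes> g \<otimes> c)"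
    using y g c_carrier by (intro cls_conj_cong) auto
  also have "inv c \<otimes> g \<otimes> c = g"
    using g c_carrier c_central[of g] by (simp add: group_simps)
  finally show ?thesis .
qed

lemma conj_nat_pow:
  assumes "y \<in> carrier G" "U \<subseteq> carrier G" and conj: "\<And>u. u \<in> U \<Longrightarrow> inv y \<otimes> u \<otimes> y \<in> U" and "u \<in> U"
  shows "inv (y [^] n) \<otimes> u \<otimes> y [^] (n::nat) \<in> U"
proof (induction n)
  case 0
  then show ?case using assms(2,4) by auto
next
  case (Suc n)
  have "inv (y [^] Suc n) \<otimes> u \<otimes> y [^] Suc n = inv y \<otimes> (inv (y [^] n) \<otimes> u \<otimes> y [^] n) \<otimes> y"
    using assms(1,2,4) by (auto simp: group_simps)
  then show ?case using conj[OF Suc] by simp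
qed

text \<open>Modulo \<open>N'\<close>, conjugation by \<open>y\<close> has finite order, so a set containing \<open>N'\<close> that is closed
  under it is also closed under its inverse.\<close>

lemma conj_inverse_closed:
  assumes y: "y \<in> carrier G" "\<nu> y = 1" and U: "subgroup U G" "U \<subseteq> N" "D \<subseteq> U"
    and conj: "\<And>u. u \<in> U \<Longrightarrow> inv y \<otimes> u \<otimes> y \<in> U" and u: "u \<in> U"
  shows "y \<otimes> u \<otimes> inv y \<in> U"
proof -
  interpret U: subgroup U G by fact
  have uc: "u \<in> carrier G" using u by simp
  obtain k where k: "e = Suc k" using e_pos by (cases e) auto
  define v where "v = y \<otimes> u \<otimes> inv y"
  have v: "v \<in> N" using N.inv_op_closed2[OF y(1)] u U(2) by (auto simp: v_def)
  then have vc: "v \<in> carrier G" by simp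
  have yv: "inv y \<otimes> v \<otimes> y = u" using y uc by (simp add: v_def group_simps)
  \<comment> \<open>Modulo N', \<open>v\<close> equals its conjugate by \<open>y [^] e\<close>. The
    first of these \<open>e\<close> conjugations turns \<open>v\<close> into \<open>u\<close>, and
    the remaining \<open>e - 1\<close> do not leave \<open>U\<close>.\<close>
  have "inv (y [^] e) \<otimes> v \<otimes> y [^] e = inv (y [^] k) \<otimes> (inv y \<otimes> v \<otimes> y) \<otimes> y [^] k"
    unfolding k nat_pow_Suc2[OF y(1)] using y(1) vc by (simp add: group_simps)
  then have "inv (y [^] e) \<otimes> v \<otimes> y [^] e \<in> U"
    unfolding yv using conj_nat_pow[OF y(1) U.subset conj u] by simp
  moreover have "cls (inv (y [^] e) \<otimes> v \<otimes> y [^] e) = cls v" by (rule cls_conj_period[OF y v])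
  moreover have "v \<in> cls v" unfolding cls_def using rcos_self[OF vc D.is_subgroup] by simp
  ultimately have "v \<in> D #> (inv (y [^] e) \<otimes> v \<otimes> y [^] e)" by (simp add: cls_def)
  then obtain d where "d \<in> D" "v = d \<otimes> (inv (y [^] e) \<otimes> v \<otimes> y [^] e)" by (auto simp: r_coset_def)
  then show ?thesis
    using \<open>inv (y [^] e) \<otimes> v \<otimes> y [^] e \<in> U\<close> U(3) U.m_closed unfolding v_def by (metis subsetD)
qed

text \<open>The classes of the \<open>inv y \<otimes> x\<close> generate N/N' as a module over Z[h].
  A property is proved for all of N by taking for \<open>U\<close> the set of elements that have
  it.\<close>

lemma N_minimal:
  assumes y: "y \<in> carrier G" "\<nu> y = 1" and U: "subgroup U G" "U \<subseteq> N" "D \<subseteq> U"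
    and conj: "\<And>u. u \<in> U \<Longrightarrow> inv y \<otimes> u \<otimes> y \<in> U"
    and gens: "\<And>x. x \<in> gs \<Longrightarrow> inv y \<otimes> x \<in> U"
  shows "N \<subseteq> U"
proof -
  interpret U: subgroup U G by fact
  have conj': "y \<otimes> u \<otimes> inv y \<in> U" if "u \<in> U" for u
    using conj_inverse_closed[OF y U conj that] .
  \<comment> \<open>This lets powers of \<open>y\<close> move past elements of \<open>U\<close>,
    which makes the set \<open>W\<close> below closed under products and inverses;
    \<open>conj'\<close> serves the negative exponents.\<close>
  have shift: "\<exists>u'\<in>U. u \<otimes> y [^] k = y [^] k \<otimes> u'" if u: "u \<in> U" for u and k :: int
  proof -
    have uc: "u \<in> carrier G" using u by simp
    have "inv (y [^] k) \<otimes> u \<otimes> y [^] k \<in> U"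
    proof (cases k rule: int_cases2)
      case (nonneg n)
      then show ?thesis
        using conj_nat_pow[OF y(1) U.subset conj u, of n] by (simp add: int_pow_int)
    next
      case (nonpos n)
      have "inv (inv y [^] n) \<otimes> u \<otimes> inv y [^] n \<in> U"
        using conj' y(1) by (intro conj_nat_pow[OF _ U.subset _ u]) auto
      then show ?thesis
        using y(1) nonpos by (simp add: int_pow_neg int_pow_int nat_pow_inv)
    qed
    moreover have "u \<otimes> y [^] k = y [^] k \<otimes> (inv (y [^] k) \<otimes> u \<otimes> y [^] k)"
      using y(1) uc by (simp add: group_simps)
    ultimately show ?thesis by blast
  qed
  \<comment> \<open>A subgroup containing the generators, hence everything. For an element of N the
    degree then forces \<open>k = 0\<close>.\<close>
  define W where "W = {y [^] k \<otimes> u | k u. (k :: int) \<in> UNIV \<and> u \<in> U}"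
  have "subgroup W G"
  proof (rule subgroupI)
    show "W \<subseteq> carrier G" using y(1) by (auto simp: W_def)
    show "W \<noteq> {}" unfolding W_def using U.one_closed by blast
  next
    fix a assume "a \<in> W"
    then obtain k u where a: "a = y [^] (k::int) \<otimes> u" "u \<in> U" by (auto simp: W_def)
    obtain u' where "u' \<in> U" "inv u \<otimes> y [^] (- k) = y [^] (- k) \<otimes> u'"
      using shift[of "inv u" "- k"] a(2) by auto
    then have "inv a = y [^] (- k) \<otimes> u'" "u' \<in> U"
      using a y(1) by (simp_all add: inv_mult_group int_pow_neg)
    then show "inv a \<in> W" unfolding W_def by blast
  next
    fix a b assume "a \<in> W" "b \<in> W"
    then obtain k u j v where ab: "a = y [^] (k::int) \<otimes> u" "u \<in> U" "b = y [^] (j::int) \<otimes> v" "v \<in> U"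
      by (auto simp: W_def)
    obtain u' where u': "u' \<in> U" "u \<otimes> y [^] j = y [^] j \<otimes> u'"
      using shift[of u j] ab(2) by auto
    have "a \<otimes> b = y [^] k \<otimes> (u \<otimes> y [^] j) \<otimes> v"
      using ab y(1) by (simp add: m_assoc)
    also have "\<dots> = y [^] (k + j) \<otimes> (u' \<otimes> v)"
      unfolding u'(2) using ab u' y(1) by (simp add: m_assoc int_pow_mult)
    finally show "a \<otimes> b \<in> W" unfolding W_def using u'(1) ab(4) by blast
  qed
  moreover have "gs \<subseteq> W"
  proof
    fix x assume x: "x \<in> gs"
    then have "x \<in> carrier G" using gs_sub C_sub by blast
    then have "x = y [^] (1::int) \<otimes> (inv y \<otimes> x)" using y(1) by (simp add: group_simps int_pow_1)
    then show "x \<in> W" unfolding W_def using gens[OF x] by blast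
  qed
  ultimately have "carrier G \<subseteq> W"
    unfolding generated by (intro generate_subgroup_incl)
  show ?thesis
  proof
    fix g assume g: "g \<in> N"
    then have "g \<in> W" using \<open>carrier G \<subseteq> W\<close> N.subset by blast
    then obtain k u where ku: "g = y [^] (k::int) \<otimes> u" "u \<in> U" by (auto simp: W_def)
    have "\<nu> g = k + \<nu> u" unfolding ku using y ku(2) \<nu>.hom_int_pow[of y k] by (simp add: \<nu>_mult)
    moreover have "\<nu> u = 0" using ku(2) U(2) by (auto intro: N_\<nu>)
    ultimately have "k = 0" using N_\<nu>[OF g] by simp
    then show "g \<in> U" using ku by simp
  qed
qed

text \<open>The C-generator chosen inside \<open>Alexander_aut\<close>;
  \<open>Alexander_aut_cls\<close> trades it for any element of degree 1.\<close>

definition x0 :: 'a where "x0 = (SOME x. x \<in> C)"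

lemma x0: "x0 \<in> C" "x0 \<in> carrier G" "\<nu> x0 = 1"
proof -
  show "x0 \<in> C" unfolding x0_def using gs_ne gs_sub by (metis ex_in_conv someI subsetD)
  then show "x0 \<in> carrier G" "\<nu> x0 = 1" using C_sub \<nu>_C by auto
qed

lemma Alexander_aut_cls:
  assumes "y \<in> carrier G" "\<nu> y = 1" "g \<in> N"
  shows "Alexander_aut G C (cls g) = cls (inv y \<otimes> g \<otimes> y)"
proof -
  have "Alexander_aut G C (cls g) = cls (inv x0 \<otimes> g \<otimes> x0)"
    using D.coset_conj_image[OF x0(2), of g] assms(3)
    by (simp add: Alexander_aut_def cls_def x0_def[symmetric] Let_def)
  also have "\<dots> = cls (inv y \<otimes> g \<otimes> y)" using x0 assms by (intro cls_conj_cong) auto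
  finally show ?thesis .
qed

lemma Alexander_aut_hom: "Alexander_aut G C \<in> hom A A"
proof (rule homI)
  show "Alexander_aut G C a \<in> carrier A" if "a \<in> carrier A" for a
    using that x0 by (auto simp: carrier_A Alexander_aut_cls[of x0] conj_N)
  fix a b assume "a \<in> carrier A" "b \<in> carrier A"
  then obtain g k where gk: "g \<in> N" "k \<in> N" "a = cls g" "b = cls k" by (auto simp: carrier_A)
  have gkc: "g \<in> carrier G" "k \<in> carrier G" using gk by auto
  have "inv x0 \<otimes> (g \<otimes> k) \<otimes> x0 = (inv x0 \<otimes> g \<otimes> x0) \<otimes> (inv x0 \<otimes> k \<otimes> x0)"
    using x0 gkc by (simp add: group_simps)
  then show "Alexander_aut G C (a \<otimes>\<^bsub>A\<^esub> b) = Alexander_aut G C a \<otimes>\<^bsub>A\<^esub> Alexander_aut G C b"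
    unfolding gk(3,4) using gk(1,2) x0
    by (simp add: cls_mult[symmetric] Alexander_aut_cls[of x0] conj_N)
qed

section \<open>The complexified Alexander module and its dual\<close>

abbreviation T where "T \<equiv> tensor_map A complex_group (Alexander_aut G C) (\<lambda>z. z)"

lemma T_linear: "linear_endo V T"
  by (rule Z.linear_endo_tensor_map(1)[OF Alexander_aut_hom])

definition \<tau> where "\<tau> g = Z.tens (cls g) 1"

lemma \<tau>_carrier [simp]: "g \<in> N \<Longrightarrow> \<tau> g \<in> carrier V"
  by (simp add: \<tau>_def cls_carrier)

lemma \<tau>_mult: "g \<in> N \<Longrightarrow> k \<in> N \<Longrightarrow> \<tau> (g \<otimes> k) = \<tau> g \<oplus>\<^bsub>V\<^esub> \<tau> k"
  by (simp add: \<tau>_def cls_mult Z.tens_mult_left cls_carrier)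

lemma \<tau>_D: "g \<in> D \<Longrightarrow> \<tau> g = \<zero>\<^bsub>V\<^esub>"
proof -
  assume g: "g \<in> D"
  then have gN: "g \<in> N" using D_sub_N by blast
  have "\<tau> (g \<otimes> g) = \<tau> g"
    unfolding \<tau>_def using cls_D[OF g] cls_D[OF D.m_closed[OF g g]] by simp
  then have "\<tau> g \<oplus>\<^bsub>V\<^esub> \<tau> g = \<tau> g" by (simp add: \<tau>_mult gN)
  then show ?thesis using \<tau>_carrier[OF gN] by (metis Z.M.add.r_cancel_one')
qed

lemma \<tau>_one: "\<tau> \<one> = \<zero>\<^bsub>V\<^esub>"
  by (rule \<tau>_D) simp

lemma \<tau>_inv: "g \<in> N \<Longrightarrow> \<tau> (inv g) = \<ominus>\<^bsub>V\<^esub> \<tau> g"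
  using \<tau>_mult[of "inv g" g] Z.M.minus_equality[of "\<tau> (inv g)" "\<tau> g"] by (simp add: \<tau>_one)

lemma T_\<tau>:
  assumes "y \<in> carrier G" "\<nu> y = 1" "g \<in> N"
  shows "T (\<tau> g) = \<tau> (inv y \<otimes> g \<otimes> y)"
  using assms unfolding \<tau>_def
  by (subst Z.linear_endo_tensor_map(2)[OF Alexander_aut_hom]) (auto simp: cls_carrier Alexander_aut_cls)

lemma spanned_induct [consumes 1, case_names \<tau> add smult]:
  assumes "v \<in> carrier V" and "\<And>g. g \<in> N \<Longrightarrow> Q (\<tau> g)"
    and "\<And>u w. u \<in> carrier V \<Longrightarrow> w \<in> carrier V \<Longrightarrow> Q u \<Longrightarrow> Q w \<Longrightarrow> Q (u \<oplus>\<^bsub>V\<^esub> w)"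
    and "\<And>z u. u \<in> carrier V \<Longrightarrow> Q u \<Longrightarrow> Q (z \<odot>\<^bsub>V\<^esub> u)"
  shows "Q v"
  using assms(1)
proof (induction v rule: Z.V_induct)
  case (tens a z)
  then obtain g where g: "g \<in> N" "a = cls g" by (auto simp: carrier_A)
  have "Z.tens a z = z \<odot>\<^bsub>V\<^esub> \<tau> g" using Z.smult_tens[OF cls_carrier[OF g(1)], of z 1] g by (simp add: \<tau>_def)
  then show ?case using assms(2,4) g by simp
qed (use assms(3) in blast)

text \<open>By \<open>character_extension\<close> and \<open>functional_character\<close>, these are
  the linear functionals on \<open>V\<close>, seen on N through \<open>\<tau>\<close>.\<close>

definition character :: "('a \<Rightarrow> complex) \<Rightarrow> bool" where
  "character \<chi> \<longleftrightarrow> (\<forall>g\<in>N. \<forall>k\<in>N. \<chi> (g \<otimes> k) = \<chi> g + \<chi> k)"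

lemma character_one: "character \<chi> \<Longrightarrow> \<chi> \<one> = 0"
  unfolding character_def using N.one_closed by (metis add_cancel_right_left r_one one_closed)

lemma character_inv:
  assumes "character \<chi>" "g \<in> N" shows "\<chi> (inv g) = - \<chi> g"
proof -
  have "\<chi> (inv g \<otimes> g) = \<chi> (inv g) + \<chi> g" using assms N.m_inv_closed unfolding character_def by blast
  moreover have "inv g \<otimes> g = \<one>" using assms(2) by simp
  ultimately show ?thesis using character_one[OF assms(1)] by (simp add: eq_neg_iff_add_eq_0)
qed

lemma character_D:
  assumes \<chi>: "character \<chi>" and "g \<in> D" shows "\<chi> g = 0"
proof -
  define U where "U = {g \<in> N. \<chi> g = 0}"
  have "subgroup U G"
    using \<chi> by (intro subgroupI)
      (auto simp: U_def character_def character_inv[OF \<chi>] character_one[OF \<chi>] intro: exI[of _ \<one>])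
  moreover have "derived_set G N \<subseteq> U"
    using \<chi> by (auto simp: U_def character_def character_inv[OF \<chi>])
  ultimately have "D \<subseteq> U"
    unfolding D_def derived_def by (intro generate_subgroup_incl)
  then show ?thesis using assms(2) by (auto simp: U_def)
qed

text \<open>A character vanishes on N' because its target is commutative; so it descends to N/N',
  where \<open>functional_extension\<close> applies.\<close>

lemma character_extension:
  assumes \<chi>: "character \<chi>"
  shows "\<exists>\<xi>. additive_scaling V \<xi> \<and> (\<forall>g\<in>N. \<xi> (\<tau> g) = \<chi> g)"
proof -
  have wd: "\<chi> g = \<chi> k" if "g \<in> N" "k \<in> N" "cls g = cls k" for g k
  proof -
    have "g \<in> D #> k" using that rcos_self[OF _ D.is_subgroup, of g] by (simp add: cls_def)
    then obtain d where d: "d \<in> D" "g = d \<otimes> k" by (auto simp: r_coset_def)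
    then show ?thesis
      using \<chi> that D_sub_N character_D[OF \<chi> d(1)] by (auto simp: character_def)
  qed
  define \<chi>' where "\<chi>' a = \<chi> (SOME g. g \<in> N \<and> cls g = a)" for a
  have \<chi>': "\<chi>' (cls g) = \<chi> g" if "g \<in> N" for g
    unfolding \<chi>'_def using someI[of "\<lambda>k. k \<in> N \<and> cls k = cls g" g] that wd by blast
  have "\<chi>' (a \<otimes>\<^bsub>A\<^esub> b) = \<chi>' a + \<chi>' b" if "a \<in> carrier A" "b \<in> carrier A" for a b
    using that \<chi> by (auto simp: carrier_A cls_mult[symmetric] \<chi>' character_def)
  from Z.functional_extension[OF this] show ?thesis
    by (auto simp: \<tau>_def cls_carrier \<chi>')
qed

lemma functional_character:
  "additive_scaling V \<xi> \<Longrightarrow> character (\<lambda>g. \<xi> (\<tau> g))"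
  by (simp add: character_def additive_scaling_def \<tau>_mult)

text \<open>N/N' is generated over Z[h] by the classes of the \<open>inv y \<otimes> x\<close>, and
  h^e = 1 leaves only their images under h^k with \<open>k < e\<close>. This excludes the default
  value 0 in \<open>Alexander_polynomial\<close>.\<close>

lemma fin_dim_V: "Z.fin_dim"
proof -
  define y where "y = x0"
  have y: "y \<in> carrier G" "\<nu> y = 1" using x0 by (auto simp: y_def)
  have a: "inv y \<otimes> x \<in> N" if "x \<in> gs" for x
    using that gs_sub C_sub \<nu>_C y by (intro N_I) (auto simp: \<nu>_mult subset_iff)
  let ?a = "\<lambda>k x. inv (y [^] k) \<otimes> (inv y \<otimes> x) \<otimes> y [^] (k::nat)"
  have aN: "?a k x \<in> N" if "x \<in> gs" for k x using a[OF that] y by (intro conj_N) auto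
  define B where "B = (\<lambda>(k, x). \<tau> (?a k x)) ` ({..<e} \<times> gs)"
  have B: "finite B" "B \<subseteq> carrier V" unfolding B_def using gs_fin aN by auto
  interpret S: submodule class_ring "Z.span B" V by (rule Z.span_is_submodule[OF B(2)])
  have B_span: "B \<subseteq> Z.span B" by (rule Z.in_own_span[OF B(2)])
  have smult: "z \<odot>\<^bsub>V\<^esub> v \<in> Z.span B" if "v \<in> Z.span B" for z v
    using S.smult_closed[of z v] that by simp
  have TB: "T b \<in> B" if "b \<in> B" for b
  proof -
    obtain k x where kx: "k < e" "x \<in> gs" "b = \<tau> (?a k x)" using \<open>b \<in> B\<close> by (auto simp: B_def)
    have xc: "x \<in> carrier G" using kx gs_sub C_sub by blast
    have "T b = \<tau> (inv y \<otimes> ?a k x \<otimes> y)" unfolding kx(3) using T_\<tau>[OF y aN[OF kx(2)]] .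
    also have "inv y \<otimes> ?a k x \<otimes> y = ?a (Suc k) x"
      using y xc by (simp add: group_simps)
    finally have Tb: "T b = \<tau> (?a (Suc k) x)" .
    \<comment> \<open>\<open>T\<close> raises the exponent by one; at \<open>e\<close> it wraps
      around to 0.\<close>
    show ?thesis
    proof (cases "Suc k = e")
      case True
      then have "T b = \<tau> (inv y \<otimes> x)" unfolding Tb \<tau>_def using cls_conj_period[OF y a[OF kx(2)]] by simp
      also have "\<dots> = \<tau> (?a 0 x)" using y xc by simp
      finally show ?thesis unfolding B_def using kx e_pos by (intro image_eqI[of _ _ "(0, x)"]) auto
    next
      case False
      then show ?thesis unfolding B_def Tb using kx by (intro image_eqI[of _ _ "(Suc k, x)"]) auto
    qed
  qed
  have Tspan: "T v \<in> Z.span B" if v: "v \<in> Z.span B" for v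
  proof -
    obtain f E where v: "v = Z.lincomb f E" "finite E" "E \<subseteq> B"
      using v unfolding Z.span_def by auto
    have "T v = (\<Oplus>\<^bsub>V\<^esub>b\<in>E. f b \<odot>\<^bsub>V\<^esub> T b)"
      unfolding v(1) Z.lincomb_def using v B by (intro Z.linear_endo_comb[OF T_linear]) auto
    also have "\<dots> \<in> Z.span B"
      using v(2,3)
    proof (induction E rule: finite_induct)
      case (insert b E)
      have Tc: "T b \<in> carrier V" if "b \<in> B" for b using TB[OF that] B by blast
      show ?case
        using insert Tc TB B_span
        by (subst Z.M.finsum_insert) (auto intro!: S.m_closed smult)
    qed (simp add: Z.span_zero)
    finally show ?thesis .
  qed
  \<comment> \<open>The part of N whose image lies in the span satisfies the hypotheses of
    \<open>N_minimal\<close>.\<close>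
  define U where "U = {g \<in> N. \<tau> g \<in> Z.span B}"
  have neg: "\<ominus>\<^bsub>V\<^esub> v \<in> Z.span B" if "v \<in> Z.span B" for v
  proof -
    have "v \<in> carrier V" using that S.subset by blast
    then have "- 1 \<odot>\<^bsub>V\<^esub> v = \<ominus>\<^bsub>V\<^esub> v" using Z.smult_neg[of v 1] by simp
    then show ?thesis using smult[OF that, of "- 1"] by simp
  qed
  have "subgroup U G"
    by (rule subgroupI)
      (auto simp: U_def \<tau>_one \<tau>_mult \<tau>_inv neg N.subset[THEN subsetD] intro: S.m_closed exI[of _ \<one>] Z.span_zero)
  moreover have "D \<subseteq> U" using D_sub_N \<tau>_D by (auto simp: U_def Z.span_zero)
  moreover have "inv y \<otimes> u \<otimes> y \<in> U" if "u \<in> U" for u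
    using that conj_N[OF y(1)] T_\<tau>[OF y] Tspan[of "\<tau> u"] by (simp add: U_def)
  moreover have "inv y \<otimes> x \<in> U" if x: "x \<in> gs" for x
  proof -
    have "x \<in> carrier G" using x gs_sub C_sub by blast
    then have "\<tau> (inv y \<otimes> x) = \<tau> (?a 0 x)" using y by simp
    also have "\<dots> \<in> B" unfolding B_def using x e_pos by (intro image_eqI[of _ _ "(0, x)"]) auto
    finally show ?thesis using a[OF x] B_span by (auto simp: U_def)
  qed
  ultimately have NU: "N \<subseteq> U" by (intro N_minimal[OF y]) (auto simp: U_def)
  have "v \<in> Z.span B" if "v \<in> carrier V" for v
    using that
    by (induction v rule: spanned_induct) (use NU in \<open>auto simp: U_def intro: smult S.m_closed\<close>)
  then have "Z.span B = carrier V" using S.subset by auto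
  then show ?thesis unfolding Z.fin_dim_def using B by auto
qed

lemma Alexander_polynomial_eq: "Alexander_polynomial G C = endo_polynomial V T"
  using fin_dim_V by (simp add: Alexander_polynomial_def Let_def)

text \<open>The character is an eigenfunctional of the transpose of \<open>T\<close> composed with
  \<open>\<tau>\<close>; it is nonzero on N because the values of \<open>\<tau>\<close> span
  \<open>V\<close>.\<close>

lemma Alexander_polynomial_root_character:
  assumes "poly (Alexander_polynomial G C) z = 0"
  shows "\<exists>\<chi>. character \<chi> \<and> (\<exists>g\<in>N. \<chi> g \<noteq> 0) \<and>
    (\<forall>y g. y \<in> carrier G \<longrightarrow> \<nu> y = 1 \<longrightarrow> g \<in> N \<longrightarrow> \<chi> (inv y \<otimes> g \<otimes> y) = z * \<chi> g)"
proof -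
  obtain bs M where r: "represents_endo V T bs M"
    using Z.represents_endo_exists[OF T_linear fin_dim_V] by blast
  have "poly (det_minus_t M) z = 0"
    using assms Z.endo_polynomial_eq[OF T_linear r] by (simp add: Alexander_polynomial_eq)
  then obtain \<xi> v where \<xi>: "additive_scaling V \<xi>" and v: "v \<in> carrier V" "\<xi> v \<noteq> 0"
    and T: "\<forall>v\<in>carrier V. \<xi> (T v) = z * \<xi> v"
    using Z.left_eigenfunctional[OF T_linear r] by blast
  have "\<exists>g\<in>N. \<xi> (\<tau> g) \<noteq> 0"
  proof (rule ccontr)
    assume zero: "\<not> (\<exists>g\<in>N. \<xi> (\<tau> g) \<noteq> 0)"
    have "\<xi> w = 0" if "w \<in> carrier V" for w
      using that
      by (induction w rule: spanned_induct) (use zero \<xi> in \<open>auto simp: additive_scaling_def\<close>)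
    then show False using v by simp
  qed
  moreover have "\<xi> (\<tau> (inv y \<otimes> g \<otimes> y)) = z * \<xi> (\<tau> g)"
    if "y \<in> carrier G" "\<nu> y = 1" "g \<in> N" for y g
    using T_\<tau>[OF that] T \<tau>_carrier[OF that(3)] by metis
  ultimately show ?thesis
    using functional_character[OF \<xi>] by (intro exI[of _ "\<lambda>g. \<xi> (\<tau> g)"]) blast
qed

lemma Alexander_polynomial_lead_coeff:
  "lead_coeff (Alexander_polynomial G C) = (- 1) ^ degree (Alexander_polynomial G C)"
proof -
  obtain bs M where r: "represents_endo V T bs M"
    using Z.represents_endo_exists[OF T_linear fin_dim_V] by blast
  let ?n = "length bs"
  have M: "M \<in> carrier_mat ?n ?n" using r by (simp add: represents_endo_def)
  have d: "degree (char_poly M) = ?n" "coeff (char_poly M) ?n = 1"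
    using degree_monic_char_poly[OF M] by auto
  have e: "Alexander_polynomial G C = (- 1) ^ ?n * char_poly M"
    using Z.endo_polynomial_eq[OF T_linear r] det_minus_t_char_poly[OF M] by (simp add: Alexander_polynomial_eq)
  show ?thesis using d unfolding e by (cases "even ?n") auto
qed

end

section \<open>Integer polynomials whose roots are roots of unity\<close>

abbreviation cpoly :: "int poly \<Rightarrow> complex poly" where
  "cpoly P \<equiv> map_poly of_int P"

definition root_of_unity :: "complex \<Rightarrow> bool" where
  "root_of_unity z \<longleftrightarrow> (\<exists>n\<ge>1::nat. z ^ n = 1)"

lemma root_of_unity_norm: "root_of_unity z \<Longrightarrow> norm z = 1"
  unfolding root_of_unity_def using power_eq_1_iff by fastforce

lemma cpoly_mult: "cpoly (p * q) = cpoly p * cpoly q"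
  by (rule of_int_poly_hom.hom_mult)

text \<open>Gauss's lemma: contents multiply, so \<open>c\<close> divides the content of
  \<open>S\<close> and can be cancelled.\<close>

lemma primitive_dvd_of_smult:
  fixes g Q :: "int poly"
  assumes g: "content g = 1" and c: "c \<noteq> 0" and e: "smult c Q = g * S"
  shows "g dvd Q"
proof -
  have "content S = content (smult c Q)" using g by (simp add: e content_mult)
  then have "c dvd content S" by simp
  then have "[:c:] dvd S" by (meson const_poly_dvd_iff content_dvd_coeff dvd_trans)
  then obtain S' where "S = smult c S'" by (auto simp: dvd_def)
  then have "smult c Q = smult c (g * S')" using e by simp
  then have "Q = g * S'" using c smult_cancel by blast
  then show ?thesis by simp
qed

text \<open>The integer polynomials vanishing at an algebraic integer form a principal ideal with a
  monic generator. The primitive part \<open>g\<close> of a nonzero one of least degree divides all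
  of them, by pseudo-division and Gauss's lemma; dividing the monic \<open>Q0\<close>, it has
  leading coefficient 1 or -1.\<close>

lemma monic_minimal_polynomial:
  fixes z :: complex
  assumes Q0: "lead_coeff Q0 = 1" "poly (cpoly Q0) z = 0"
  shows "\<exists>g :: int poly. lead_coeff g = 1 \<and> degree g > 0 \<and> (\<forall>Q. poly (cpoly Q) z = 0 \<longleftrightarrow> g dvd Q)"
proof -
  let ?A = "\<lambda>Q. Q \<noteq> 0 \<and> poly (cpoly Q) z = 0"
  have "?A Q0" using Q0 by auto
  then obtain Q where Q: "?A Q" and min: "\<And>R. ?A R \<Longrightarrow> degree Q \<le> degree R"
    using ex_has_least_nat[of ?A Q0 degree] by blast
  define g where "g = primitive_part Q"
  have g0: "g \<noteq> 0" "content g = 1" "degree g = degree Q" using Q by (auto simp: g_def)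
  have "poly (cpoly (smult (content Q) g)) z = 0" using Q by (simp add: g_def)
  then have gz: "poly (cpoly g) z = 0" using Q by (simp add: of_int_hom.map_poly_hom_smult)
  have gd: "g dvd R" if R: "poly (cpoly R) z = 0" for R
  proof -
    obtain q r where qr: "pseudo_divmod R g = (q, r)" by force
    define c where "c = coeff g (degree g) ^ (Suc (degree R) - degree g)"
    have e: "smult c R = g * q + r" and r: "r = 0 \<or> degree r < degree g"
      using pseudo_divmod[OF g0(1) qr] by (auto simp: c_def)
    have "poly (cpoly (smult c R)) z = 0" using R by (simp add: of_int_hom.map_poly_hom_smult)
    then have "poly (cpoly r) z = 0"
      unfolding e using gz by (simp add: of_int_poly_hom.hom_add cpoly_mult)
    then have "r = 0" using min[of r] r g0 by force
    moreover have "c \<noteq> 0" unfolding c_def using g0(1) by (metis leading_coeff_0_iff power_not_zero)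
    ultimately show ?thesis using primitive_dvd_of_smult[OF g0(2)] e by simp
  qed
  have "g dvd Q0" using gd Q0 by simp
  then have u: "lead_coeff g dvd 1"
    using Q0 by (metis dvd_def lead_coeff_mult)
  \<comment> \<open>Multiplication by the leading coefficient, a unit, makes \<open>g\<close> monic
    without changing its multiples.\<close>
  define h where "h = smult (lead_coeff g) g"
  have u2: "lead_coeff g * lead_coeff g = 1"
    using u by (metis abs_mult_self_eq mult_1 zdvd1_eq)
  have h1: "lead_coeff h = 1" using u2 g0(1) by (simp add: h_def)
  have "g dvd h" by (simp add: h_def dvd_smult)
  moreover have "g = smult (lead_coeff g) h" using u2 by (simp add: h_def)
  then have "h dvd g" by (metis dvd_refl dvd_smult)
  ultimately have hd: "h dvd R \<longleftrightarrow> g dvd R" for R by (meson dvd_trans)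
  have iff: "poly (cpoly R) z = 0 \<longleftrightarrow> h dvd R" for R
    unfolding hd using gd gz by (auto simp: dvd_def cpoly_mult)
  moreover have "degree h > 0"
  proof (rule ccontr)
    assume "\<not> degree h > 0"
    then have "h = 1" using h1 by (metis degree_eq_zeroE gr0I lead_coeff_pCons(2) one_pCons pCons_0_0 coeff_pCons_0 degree_pCons_0)
    then show False using iff[of 1] by simp
  qed
  ultimately show ?thesis using h1 by blast
qed

lemma lead_coeff_monom_minus_one: "n \<ge> 1 \<Longrightarrow> lead_coeff (monom 1 n - 1 :: int poly) = 1"
proof -
  assume n: "n \<ge> 1"
  then have "degree (monom (1 :: int) n + (- 1)) = degree (monom (1 :: int) n)"
    by (intro degree_add_eq_left) (simp add: degree_monom_eq)
  then show ?thesis using n by (simp add: degree_monom_eq)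
qed

lemma poly_monom_minus_one: "poly (cpoly (monom 1 n - 1)) z = z ^ n - 1"
  by (simp add: of_int_poly_hom.hom_minus of_int_hom.map_poly_hom_monom poly_monom)

lemma root_of_unity_minimal_polynomial:
  assumes "root_of_unity z"
  shows "\<exists>g :: int poly. lead_coeff g = 1 \<and> degree g > 0 \<and> (\<forall>Q. poly (cpoly Q) z = 0 \<longleftrightarrow> g dvd Q)"
proof -
  obtain n where n: "n \<ge> 1" "z ^ n = 1" using assms by (auto simp: root_of_unity_def)
  show ?thesis
    by (rule monic_minimal_polynomial[of "monom 1 n - 1"])
      (use n lead_coeff_monom_minus_one poly_monom_minus_one in auto)
qed

section \<open>Real roots, signs at 1 and parity of degrees\<close>

lemma poly_cpoly_of_real: "poly (cpoly P) (of_real x) = of_real (poly (map_poly of_int P) x)"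
  by (induction P) (auto simp: map_poly_pCons)

lemma poly_rpoly_one: "poly (map_poly of_int P :: real poly) 1 = of_int (poly P 1)"
  by (induction P) (auto simp: map_poly_pCons)

lemma poly_rpoly_minus_one: "poly (map_poly of_int P :: real poly) (- 1) = of_int (poly P (- 1))"
  by (induction P) (auto simp: map_poly_pCons)

text \<open>A negative value at 1 would force a real root beyond 1, but roots of unity have absolute
  value 1.\<close>

lemma poly_one_pos:
  assumes roots: "\<And>z. poly (cpoly P) z = 0 \<Longrightarrow> root_of_unity z"
    and lc: "lead_coeff P > 0" and nz: "poly P 1 \<noteq> 0"
  shows "poly P 1 > 0"
proof (rule ccontr)
  assume "\<not> poly P 1 > 0"
  then have neg: "poly (map_poly of_int P :: real poly) 1 < 0" using nz by (simp add: poly_rpoly_one)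
  have "lead_coeff (map_poly of_int P :: real poly) > 0" using lc by simp
  then obtain n where n: "\<forall>x\<ge>n. poly (map_poly of_int P :: real poly) x > 0"
    using poly_pinfty_gt_lc by (metis order_less_le_trans)
  then have "poly (map_poly of_int P :: real poly) (max n 2) > 0" by simp
  moreover have "1 < max n 2" by simp
  ultimately obtain x where x: "x > 1" "poly (map_poly of_int P :: real poly) x = 0"
    using poly_IVT_pos[OF _ neg, of "max n 2"] by blast
  then have "root_of_unity (of_real x)" by (intro roots) (simp add: poly_cpoly_of_real)
  then show False using x(1) root_of_unity_norm by fastforce
qed

text \<open>Excludes -1 as a root of a polynomial whose value at 1 is odd.\<close>

lemma poly_parity: "even (poly P 1 - poly P (- 1 :: int))"
proof (induction P)
  case (pCons a P)
  have "poly (pCons a P) 1 - poly (pCons a P) (- 1) = poly P 1 - poly P (- 1) + 2 * poly P (- 1)"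
    by simp
  then show ?case using pCons.IH by simp
qed simp

text \<open>The only real roots of unity are 1 and -1, and the values at both are odd, hence
  nonzero; but a real polynomial of odd degree has a real root.\<close>

lemma even_degree:
  assumes roots: "\<And>z. poly (cpoly P) z = 0 \<Longrightarrow> root_of_unity z"
    and odd1: "odd (poly P 1)"
  shows "even (degree P)"
proof (rule ccontr)
  assume oddd: "odd (degree P)"
  let ?p = "map_poly of_int P :: real poly"
  have nz: "poly P 1 \<noteq> 0" "poly P (- 1) \<noteq> 0"
    using odd1 poly_parity[of P] by auto
  have noroot: "poly ?p x \<noteq> 0" for x
  proof
    assume x: "poly ?p x = 0"
    then have "root_of_unity (of_real x)" by (intro roots) (simp add: poly_cpoly_of_real)
    then have "\<bar>x\<bar> = 1" using root_of_unity_norm by fastforce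
    then have "x = 1 \<or> x = - 1" by auto
    then show False using x nz by (auto simp: poly_rpoly_one poly_rpoly_minus_one)
  qed
  have P0: "lead_coeff ?p \<noteq> 0" using oddd by auto
  define p where "p = (if lead_coeff ?p > 0 then ?p else - ?p)"
  have p: "lead_coeff p > 0" "odd (degree p)" using P0 oddd by (auto simp: p_def)
  have nr: "poly p x \<noteq> 0" for x using noroot[of x] by (auto simp: p_def)
  obtain a where a: "\<forall>x\<ge>a. poly p x > 0"
    using poly_pinfty_gt_lc[OF p(1)] p(1) by (meson order_less_le_trans)
  \<comment> \<open>This is the polynomial -p(-x). As the degree is odd, its leading coefficient is
    that of \<open>p\<close>; so \<open>p\<close> is negative far to the left.\<close>
  have "lead_coeff (- pcompose p [:0, - 1:]) > 0"
    using p lead_coeff_comp[of "[:0, - 1:]" p] by simp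
  then obtain b where b: "\<forall>x\<ge>b. poly (- pcompose p [:0, - 1:]) x > 0"
    using poly_pinfty_gt_lc by (meson order_less_le_trans)
  define c where "c = max 1 (max a b)"
  have "poly p c > 0" using a by (simp add: c_def)
  moreover have "poly p (- c) < 0" using b[rule_format, of c] by (simp add: c_def poly_pcompose)
  moreover have "- c < c" by (simp add: c_def)
  ultimately show False using poly_IVT_pos[of "- c" c p] nr by auto
qed

lemma root_exists:
  assumes "degree (P :: int poly) > 0" shows "\<exists>z. poly (cpoly P) z = 0"
  using assms fundamental_theorem_of_algebra[of "cpoly P"] by (simp add: constant_degree)

text \<open>The minimal polynomial \<open>g\<close> of a root is split off. From g(1) R(1) = 1
  alone, g(1) could be -1; \<open>poly_one_pos\<close> excludes this, so both factors take the value
  1 at 1 and the induction continues with \<open>R\<close>.\<close>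

lemma unity_factorization:
  assumes "\<And>z. poly (cpoly P) z = 0 \<Longrightarrow> root_of_unity z" and "poly P 1 = 1"
  shows "\<exists>fs. P = prod_list fs \<and>
    (\<forall>f\<in>set fs. lead_coeff f = 1 \<and> poly f 1 = 1 \<and> (\<exists>n\<ge>1. f dvd monom 1 n - 1))"
  using assms
proof (induction "degree P" arbitrary: P rule: less_induct)
  case less
  show ?case
  proof (cases "degree P > 0")
    case False
    then obtain c where "P = [:c:]" by (auto elim: degree_eq_zeroE)
    then have "P = prod_list []" using less.prems by (simp add: one_pCons)
    then show ?thesis by (intro exI[of _ "[]"]) auto
  next
    case True
    then obtain z where z: "poly (cpoly P) z = 0" using root_exists by blast
    then have zu: "root_of_unity z" by (rule less.prems)
    then obtain g where g: "lead_coeff g = 1" "degree g > 0" "\<And>Q. poly (cpoly Q) z = 0 \<longleftrightarrow> g dvd Q"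
      using root_of_unity_minimal_polynomial by blast
    obtain n where n: "n \<ge> 1" "z ^ n = 1" using zu by (auto simp: root_of_unity_def)
    have gn: "g dvd monom 1 n - 1" unfolding g(3)[symmetric] using n poly_monom_minus_one[of n z] by simp
    obtain R where R: "P = g * R" using g(3) z by (auto simp: dvd_def)
    have prod1: "poly g 1 * poly R 1 = 1" using less.prems(2) R by simp
    have roots: "root_of_unity w" if "poly (cpoly g) w = 0 \<or> poly (cpoly R) w = 0" for w
      using that less.prems(1)[of w] by (auto simp: R cpoly_mult)
    have "poly g 1 > 0"
      using prod1 g(1) roots by (intro poly_one_pos) auto
    then have one: "poly g 1 = 1" "poly R 1 = 1"
      using prod1 pos_zmult_eq_1_iff by auto
    have "R \<noteq> 0" "g \<noteq> 0" using one by auto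
    then have "degree R < degree P" using g(2) by (simp add: R degree_mult_eq)
    from less.hyps[OF this] roots one obtain fs where "R = prod_list fs"
      "\<forall>f\<in>set fs. lead_coeff f = 1 \<and> poly f 1 = 1 \<and> (\<exists>n\<ge>1. f dvd monom 1 n - 1)" by blast
    then show ?thesis
      using R g one gn n by (intro exI[of _ "g # fs"]) auto
  qed
qed

text \<open>The minimal polynomial of a root divides the given \<open>F\<close>, so its value at 1
  divides F(1) = 1. These units multiply up to P(1), up to a constant factor that the hypothesis on
  the leading coefficient makes a unit.\<close>

lemma poly_one_unit:
  assumes "\<And>z. poly (cpoly P) z = 0 \<Longrightarrow> root_of_unity z \<and> (\<exists>F. poly F 1 = 1 \<and> poly (cpoly F) z = 0)"
    and "lead_coeff P dvd 1"
  shows "poly P 1 dvd 1"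
  using assms
proof (induction "degree P" arbitrary: P rule: less_induct)
  case less
  show ?case
  proof (cases "degree P > 0")
    case False
    then obtain c where "P = [:c:]" by (auto elim: degree_eq_zeroE)
    then show ?thesis using less.prems by simp
  next
    case True
    then obtain z where z: "poly (cpoly P) z = 0" using root_exists by blast
    then obtain F where zu: "root_of_unity z" and F: "poly F 1 = 1" "poly (cpoly F) z = 0"
      using less.prems by blast
    obtain g where g: "lead_coeff g = 1" "degree g > 0" "\<And>Q. poly (cpoly Q) z = 0 \<longleftrightarrow> g dvd Q"
      using root_of_unity_minimal_polynomial[OF zu] by blast
    obtain R where R: "P = g * R" using g(3) z by (auto simp: dvd_def)
    obtain S where S: "F = g * S" using g(3) F by (auto simp: dvd_def)
    have g1: "poly g 1 dvd 1" using F(1) S by (metis dvd_triv_left poly_mult)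
    have lR: "lead_coeff R = lead_coeff P" using g(1) by (simp add: R lead_coeff_mult)
    then have "R \<noteq> 0" "g \<noteq> 0" using less.prems(2) g by auto
    then have "degree R < degree P" using g(2) by (simp add: R degree_mult_eq)
    then have "poly R 1 dvd 1"
      using less.prems lR by (intro less.hyps) (auto simp: R cpoly_mult)
    then show ?thesis using g1 by (simp add: R abs_mult)
  qed
qed

text \<open>A divisor of t^n - 1 has only simple roots: at a double root \<open>a\<close>, the
  derivative n a^(n-1) would vanish, so \<open>a\<close> would be 0, which is not a root of t^n -
  1.\<close>

lemma unity_divisor_splits:
  assumes n: "n \<ge> 1" and f: "f dvd monom 1 n - 1" "lead_coeff f = 1"
  shows "cpoly f = (\<Prod>z | poly (cpoly f) z = 0. [:- z, 1:])"
    and "poly (cpoly f) z = 0 \<Longrightarrow> z ^ n = 1"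
proof -
  obtain k where k: "monom 1 n - 1 = f * k" using f by (auto simp: dvd_def)
  have ck: "cpoly (monom 1 n - 1) = cpoly f * cpoly k" by (simp add: k cpoly_mult)
  have rt: "z ^ n = 1" if "poly (cpoly f) z = 0" for z
    using poly_monom_minus_one[of n z] that by (simp add: ck)
  then show "poly (cpoly f) z = 0 \<Longrightarrow> z ^ n = 1" .
  have "rsquarefree (cpoly f)"
    unfolding rsquarefree_roots
  proof (intro allI notI)
    fix a assume a: "poly (cpoly f) a = 0 \<and> poly (pderiv (cpoly f)) a = 0"
    have "pderiv (cpoly (monom 1 n - 1)) = monom (of_nat n) (n - 1)"
      by (simp add: of_int_poly_hom.hom_minus of_int_hom.map_poly_hom_monom pderiv_diff pderiv_monom)
    moreover have "poly (pderiv (cpoly (monom 1 n - 1))) a = 0"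
      using a unfolding ck by (simp add: pderiv_mult)
    ultimately have "of_nat n * a ^ (n - 1) = 0" by (simp add: poly_monom)
    then have "a = 0" using n by auto
    then show False using rt[of a] a n by (simp add: power_0_left)
  qed
  from complex_poly_decompose_rsquarefree[OF this]
  show "cpoly f = (\<Prod>z | poly (cpoly f) z = 0. [:- z, 1:])" using f(2) by simp
qed

section \<open>Free groups and presented \<open>C\<close>-groups\<close>

declare in_listsD [rule del] in_listsI [rule del] listsE [rule del]

text \<open>Otherwise \<open>{1..m}\<close> is rewritten to \<open>{Suc 0..m}\<close>, and facts about \<open>FG m\<close> no longer apply.\<close>

declare One_nat_def [simp del]

lemma equiv_free_eq: "equiv (words S) (free_eq S)"
proof (rule equivI)
  show "refl_on (words S) (free_eq S)" by (auto simp: free_eq_def refl_on_def)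
  show "sym (free_eq S)" by (rule symI, clarsimp simp: free_eq_def) (erule equivclp_sym)
  show "trans (free_eq S)" by (rule transI, clarsimp simp: free_eq_def) (erule (1) equivclp_trans)
qed (auto simp: free_eq_def)

lemma cancel_step_append:
  assumes "cancel_step S u v" "w \<in> words S"
  shows "cancel_step S (u @ w) (v @ w)" "cancel_step S (w @ u) (w @ v)"
proof -
  obtain p q a b where pq: "p \<in> words S" "q \<in> words S" "a \<in> S"
    "u = p @ [(a, b), (a, \<not> b)] @ q" "v = p @ q"
    using assms(1) unfolding cancel_step_def by blast
  have "q @ w \<in> words S" "w @ p \<in> words S" using pq assms(2) by auto
  moreover have "u @ w = p @ [(a, b), (a, \<not> b)] @ (q @ w)" "v @ w = p @ (q @ w)"
    "w @ u = (w @ p) @ [(a, b), (a, \<not> b)] @ q" "w @ v = (w @ p) @ q" using pq by auto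
  ultimately show "cancel_step S (u @ w) (v @ w)" "cancel_step S (w @ u) (w @ v)"
    unfolding cancel_step_def using pq(1-3) by blast+
qed

lemma equivclp_map:
  assumes "equivclp r u v" and step: "\<And>a b. r a b \<Longrightarrow> equivclp s (f a) (f b)"
  shows "equivclp s (f u) (f v)"
  using assms(1)
proof (induction rule: equivclp_induct)
  case (step y z)
  have "equivclp s (f y) (f z)" using step.hyps(2)
  proof
    assume "r y z" then show ?thesis by (rule assms(2))
  next
    assume "r z y" then show ?thesis by (rule equivclp_sym[OF assms(2)])
  qed
  with step.IH show ?case by (rule equivclp_trans)
qed simp

lemma free_eq_append:
  assumes "(u, u') \<in> free_eq S" "(v, v') \<in> free_eq S"
  shows "(u @ v, u' @ v') \<in> free_eq S"
proof -
  have w: "u \<in> words S" "u' \<in> words S" "v \<in> words S" "v' \<in> words S"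
    using assms by (auto simp: free_eq_def)
  have "equivclp (cancel_step S) u u'" "equivclp (cancel_step S) v v'"
    using assms by (simp_all add: free_eq_def)
  note e = this
  have "equivclp (cancel_step S) (u @ v) (u' @ v)"
    using e(1) by (rule equivclp_map[where f = "\<lambda>u. u @ v"])
      (rule r_into_equivclp, rule cancel_step_append(1)[OF _ w(3)])
  moreover have "equivclp (cancel_step S) (u' @ v) (u' @ v')"
    using e(2) by (rule equivclp_map[where f = "\<lambda>v. u' @ v"])
      (rule r_into_equivclp, rule cancel_step_append(2)[OF _ w(2)])
  ultimately have "equivclp (cancel_step S) (u @ v) (u' @ v')" by (rule equivclp_trans)
  then show ?thesis using w by (simp add: free_eq_def)
qed

definition fcls :: "'a set \<Rightarrow> 'a word \<Rightarrow> 'a word set" where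
  "fcls S u = free_eq S `` {u}"

lemma fcls_self: "u \<in> words S \<Longrightarrow> u \<in> fcls S u"
  unfolding fcls_def by (rule equiv_class_self[OF equiv_free_eq])

lemma carrier_free_group: "carrier (free_group S) = fcls S ` words S"
  unfolding free_group_def quotient_def fcls_def by auto

lemma one_free_group: "\<one>\<^bsub>free_group S\<^esub> = fcls S []"
  by (simp add: free_group_def fcls_def)

lemma fcls_eq_iff: "u \<in> words S \<Longrightarrow> v \<in> words S \<Longrightarrow> fcls S u = fcls S v \<longleftrightarrow> (u, v) \<in> free_eq S"
  unfolding fcls_def by (rule eq_equiv_class_iff[OF equiv_free_eq])

lemma mult_free_group:
  assumes "u \<in> words S" "v \<in> words S"
  shows "fcls S u \<otimes>\<^bsub>free_group S\<^esub> fcls S v = fcls S (u @ v)"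
proof -
  have "fcls S (x @ y) = fcls S (u @ v)" if "x \<in> fcls S u" "y \<in> fcls S v" for x y
  proof -
    have "(u, x) \<in> free_eq S" "(v, y) \<in> free_eq S" using that by (auto simp: fcls_def)
    then have "(u @ v, x @ y) \<in> free_eq S" by (rule free_eq_append)
    then show ?thesis unfolding fcls_def by (metis equiv_class_eq equiv_free_eq)
  qed
  then have "(\<Union>x\<in>fcls S u. \<Union>y\<in>fcls S v. fcls S (x @ y))
      = (\<Union>x\<in>fcls S u. \<Union>y\<in>fcls S v. fcls S (u @ v))" by simp
  also have "\<dots> = fcls S (u @ v)" using fcls_self assms by blast
  finally show ?thesis unfolding free_group_def by (simp add: fcls_def)
qed

lemma words_simps [simp]: "[] \<in> words S" "x # u \<in> words S \<longleftrightarrow> fst x \<in> S \<and> u \<in> words S"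
  "u @ v \<in> words S \<longleftrightarrow> u \<in> words S \<and> v \<in> words S"
  by (cases x, auto)+

lemma fcls_cancel:
  assumes "a \<in> S" "u \<in> words S" shows "fcls S ((a, b) # (a, \<not> b) # u) = fcls S u"
proof -
  have "cancel_step S ((a, b) # (a, \<not> b) # u) u"
    unfolding cancel_step_def using assms by (intro exI[of _ "[]"] exI[of _ u] exI[of _ a] exI[of _ b]) simp
  then have "equivclp (cancel_step S) ((a, b) # (a, \<not> b) # u) u" by blast
  then show ?thesis using assms by (subst fcls_eq_iff) (auto simp: free_eq_def)
qed

definition inv_word :: "'a word \<Rightarrow> 'a word" where
  "inv_word u = rev (map (\<lambda>(a, b). (a, \<not> b)) u)"

lemma inv_word_words: "u \<in> words S \<Longrightarrow> inv_word u \<in> words S"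
  unfolding inv_word_def by (induction u) auto

lemma inv_word_cancel:
  assumes "u \<in> words S" "v \<in> words S" shows "fcls S (inv_word u @ u @ v) = fcls S v"
  using assms
proof (induction u arbitrary: v rule: list.induct)
  case Nil
  then show ?case by (simp add: inv_word_def)
next
  case (Cons x u)
  obtain a b where x: "x = (a, b)" by (cases x)
  have c: "a \<in> S" "u \<in> words S" "v \<in> words S" using Cons.prems x by auto
  have iw: "inv_word u \<in> words S" using inv_word_words[OF c(2)] .
  have "inv_word (x # u) @ (x # u) @ v = inv_word u @ ((a, \<not> b) # (a, b) # u @ v)"
    by (simp add: inv_word_def x)
  also have "fcls S \<dots> = fcls S (inv_word u) \<otimes>\<^bsub>free_group S\<^esub> fcls S ((a, \<not> b) # (a, b) # u @ v)"
    using c iw by (subst mult_free_group) auto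
  also have "fcls S ((a, \<not> b) # (a, b) # u @ v) = fcls S (u @ v)"
    using fcls_cancel[of a S "u @ v" "\<not> b"] c by simp
  also have "fcls S (inv_word u) \<otimes>\<^bsub>free_group S\<^esub> \<dots> = fcls S (inv_word u @ u @ v)"
    using c iw by (subst mult_free_group) auto
  finally show ?case using Cons.IH c by simp
qed

lemma group_free_group: "group (free_group S)"
proof (rule groupI)
  fix x assume "x \<in> carrier (free_group S)"
  then obtain u where u: "u \<in> words S" "x = fcls S u" by (auto simp: carrier_free_group)
  have "fcls S (inv_word u) \<otimes>\<^bsub>free_group S\<^esub> x = \<one>\<^bsub>free_group S\<^esub>"
    using u inv_word_words[OF u(1)] inv_word_cancel[OF u(1), of "[]"]
    by (simp add: mult_free_group one_free_group)
  then show "\<exists>y\<in>carrier (free_group S). y \<otimes>\<^bsub>free_group S\<^esub> x = \<one>\<^bsub>free_group S\<^esub>"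
    using inv_word_words[OF u(1)] by (intro bexI[of _ "fcls S (inv_word u)"]) (auto simp: carrier_free_group)
qed (auto simp: carrier_free_group mult_free_group one_free_group)

lemma free_gen_carrier: "a \<in> S \<Longrightarrow> free_gen S a \<in> carrier (free_group S)"
  by (auto simp: free_gen_def carrier_free_group fcls_def)

lemma free_group_generated: "carrier (free_group S) = generate (free_group S) (free_gen S ` S)"
proof -
  interpret F: group "free_group S" by (rule group_free_group)
  have sub: "free_gen S ` S \<subseteq> carrier (free_group S)" by (rule image_subsetI) (rule free_gen_carrier)
  have "fcls S u \<in> generate (free_group S) (free_gen S ` S)" if "u \<in> words S" for u
    using that
  proof (induction u rule: list.induct)
    case Nil
    show ?case unfolding one_free_group[symmetric] by (rule generate.one)
  next
    case (Cons x u)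
    obtain a b where x: "x = (a, b)" by (cases x)
    have c: "a \<in> S" "u \<in> words S" using Cons.prems x by auto
    have "fcls S [(a, False)] \<otimes>\<^bsub>free_group S\<^esub> fcls S [(a, True)] = \<one>\<^bsub>free_group S\<^esub>"
      using c fcls_cancel[of a S "[]" False] by (simp add: mult_free_group one_free_group)
    then have "inv\<^bsub>free_group S\<^esub> (free_gen S a) = fcls S [(a, False)]"
      using c by (intro F.inv_equality) (auto simp: free_gen_def fcls_def[symmetric] carrier_free_group)
    then have "fcls S [(a, b)] \<in> generate (free_group S) (free_gen S ` S)"
      using c generate.incl[of "free_gen S a" "free_gen S ` S" "free_group S"]
        generate.inv[of "free_gen S a" "free_gen S ` S" "free_group S"]
      by (cases b) (auto simp: free_gen_def fcls_def)
    then have "fcls S [(a, b)] \<otimes>\<^bsub>free_group S\<^esub> fcls S u \<in> generate (free_group S) (free_gen S ` S)"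
      using Cons.IH c by (intro generate.eng) auto
    then show ?case using c x by (simp add: mult_free_group)
  qed
  then show ?thesis
    using F.generate_incl[OF sub] by (auto simp: carrier_free_group)
qed

lemma free_group_universal:
  fixes H :: "('h, 'e) monoid_scheme" (structure)
  assumes "group H" and \<phi>: "\<And>a. a \<in> S \<Longrightarrow> \<phi> a \<in> carrier H"
  shows "\<exists>\<Phi>\<in>hom (free_group S) H. \<forall>a\<in>S. \<Phi> (free_gen S a) = \<phi> a"
proof -
  interpret H: group H by fact
  define ev where "ev = (\<lambda>u. foldr (\<lambda>x p. (if snd x then \<phi> (fst x) else inv \<phi> (fst x)) \<otimes> p) u \<one>)"
  have ev_simps: "ev [] = \<one>"
    "ev (x # u) = (if snd x then \<phi> (fst x) else inv \<phi> (fst x)) \<otimes> ev u" for x u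
    by (simp_all add: ev_def)
  have ev_closed: "ev u \<in> carrier H" if "u \<in> words S" for u
    using that by (induction u) (auto simp: ev_simps \<phi>)
  have ev_append: "ev (u @ v) = ev u \<otimes> ev v" if "u \<in> words S" "v \<in> words S" for u v
    using that by (induction u) (auto simp: ev_simps \<phi> ev_closed H.m_assoc)
  have ev_step: "ev u = ev v" if st: "cancel_step S u v" for u v
  proof -
    obtain p q a b where pq: "p \<in> words S" "q \<in> words S" "a \<in> S"
      "u = p @ [(a, b), (a, \<not> b)] @ q" "v = p @ q"
      using st unfolding cancel_step_def by blast
    have "ev ([(a, b), (a, \<not> b)] @ q) = ev q"
      using pq(2,3) by (cases b) (auto simp: ev_simps \<phi> ev_closed H.m_assoc[symmetric])
    then show ?thesis using pq(1-3) unfolding pq(4,5) by (subst (1 2) ev_append) auto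
  qed
  have ev_eq: "ev u = ev v" if "(u, v) \<in> free_eq S" for u v
  proof -
    have "equivclp (cancel_step S) u v" using that by (simp add: free_eq_def)
    then show ?thesis
      by (induction rule: equivclp_induct) (auto dest: ev_step)
  qed
  define \<Phi> where "\<Phi> U = ev (SOME u. u \<in> U)" for U
  have \<Phi>: "\<Phi> (fcls S u) = ev u" if "u \<in> words S" for u
  proof -
    have "u \<in> fcls S u" using that by (rule fcls_self)
    then have "(SOME u'. u' \<in> fcls S u) \<in> fcls S u" by (rule someI)
    then have "(u, SOME u'. u' \<in> fcls S u) \<in> free_eq S" by (simp add: fcls_def)
    then show ?thesis unfolding \<Phi>_def using ev_eq by metis
  qed
  have "\<Phi> \<in> hom (free_group S) H"
    by (rule homI) (auto simp: carrier_free_group mult_free_group \<Phi> ev_closed ev_append)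
  moreover have "\<Phi> (free_gen S a) = \<phi> a" if "a \<in> S" for a
    using that \<Phi>[of "[(a, True)]"] \<phi>[OF that] by (simp add: free_gen_def fcls_def ev_simps)
  ultimately show ?thesis by blast
qed

lemma normal_closure_normal:
  fixes G (structure)
  assumes "group G" "R \<subseteq> carrier G"
  shows "normal_closure G R \<lhd> G" "R \<subseteq> normal_closure G R"
proof -
  interpret group G by fact
  let ?S = "{g \<otimes> r \<otimes> inv g | g r. g \<in> carrier G \<and> r \<in> R}"
  show "normal_closure G R \<lhd> G"
    unfolding normal_closure_def
  proof (rule normal_generateI)
    fix h g assume "h \<in> ?S" and g: "g \<in> carrier G"
    then obtain k r where k: "k \<in> carrier G" "r \<in> R" "h = k \<otimes> r \<otimes> inv k" by blast
    then have "g \<otimes> h \<otimes> inv g = (g \<otimes> k) \<otimes> r \<otimes> inv (g \<otimes> k)"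
      using assms(2) g by (auto simp: m_assoc inv_mult_group subset_iff)
    then show "g \<otimes> h \<otimes> inv g \<in> ?S" using g k by blast
  qed (use assms(2) in auto)
  show "R \<subseteq> normal_closure G R"
  proof
    fix r assume r: "r \<in> R"
    then have "r = \<one> \<otimes> r \<otimes> inv \<one>" using assms(2) by auto
    then have "r \<in> ?S" using r by blast
    then show "r \<in> normal_closure G R" unfolding normal_closure_def by (rule generate.incl)
  qed
qed

lemma normal_closure_minimal:
  assumes "group G" "R \<subseteq> K" "K \<lhd> G"
  shows "normal_closure G R \<subseteq> K"
proof -
  interpret normal K G by fact
  show ?thesis
    unfolding normal_closure_def
    using assms(2) inv_op_closed2 by (intro generate_subgroup_incl is_subgroup) auto
qed

section \<open>Groups given by a C-presentation\<close>

locale C_presented =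
  fixes m :: nat and l :: "nat \<Rightarrow> nat \<Rightarrow> nat" and w :: "nat \<Rightarrow> nat \<Rightarrow> nat \<Rightarrow> nat word set"
  assumes pres: "C_presentation m l w"
begin

sublocale F: group "FG m" by (rule group_free_group)

abbreviation K :: "nat word set set" where "K \<equiv> normal_closure (FG m) (C_relators m l w)"

abbreviation PG :: "nat word set set monoid" where "PG \<equiv> presented_group m l w"

abbreviation q :: "nat word set \<Rightarrow> nat word set set" where "q g \<equiv> K #>\<^bsub>FG m\<^esub> g"

lemma fgen_carrier: "i \<in> {1..m} \<Longrightarrow> fgen m i \<in> carrier (FG m)"
  by (rule free_gen_carrier)

lemma w_carrier:
  "i \<in> {1..m} \<Longrightarrow> j \<in> {1..m} \<Longrightarrow> k \<in> {1..l i j} \<Longrightarrow> w i j k \<in> carrier (FG m)"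
  using pres by (auto simp: C_presentation_def)

lemma relators_carrier: "C_relators m l w \<subseteq> carrier (FG m)"
  unfolding C_relators_def using fgen_carrier w_carrier by blast

sublocale K: normal K "FG m"
  by (rule normal_closure_normal[OF F.is_group relators_carrier])

sublocale PG: group PG
  unfolding presented_group_def by (rule K.factorgroup_is_group)

lemma q_hom: "q \<in> hom (FG m) PG"
  unfolding presented_group_def by (rule K.r_coset_hom_Mod)

lemma q_surj: "carrier PG = q ` carrier (FG m)"
  by (simp add: presented_group_def carrier_FactGroup)

sublocale Q: group_hom "FG m" PG q
  by unfold_locales (rule q_hom)

lemma PG_generated: "carrier PG = generate PG ((\<lambda>i. q (fgen m i)) ` {1..m})"
proof -
  have "q ` generate (FG m) (fgen m ` {1..m}) = generate PG (q ` fgen m ` {1..m})"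
    using fgen_carrier by (intro Q.generate_img[symmetric]) auto
  then show ?thesis
    unfolding q_surj by (simp add: free_group_generated[symmetric] image_image)
qed

lemma relation:
  assumes "i \<in> {1..m}" "j \<in> {1..m}" "k \<in> {1..l i j}"
  shows "q (fgen m i) = inv\<^bsub>PG\<^esub> q (w i j k) \<otimes>\<^bsub>PG\<^esub> q (fgen m j) \<otimes>\<^bsub>PG\<^esub> q (w i j k)"
proof -
  note c = fgen_carrier[OF assms(1)] fgen_carrier[OF assms(2)] w_carrier[OF assms]
  let ?v = "inv\<^bsub>FG m\<^esub> w i j k \<otimes>\<^bsub>FG m\<^esub> fgen m j \<otimes>\<^bsub>FG m\<^esub> w i j k"
  have "inv\<^bsub>FG m\<^esub> fgen m i \<otimes>\<^bsub>FG m\<^esub> ?v \<in> C_relators m l w"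
    unfolding C_relators_def using assms by blast
  then have "inv\<^bsub>FG m\<^esub> fgen m i \<otimes>\<^bsub>FG m\<^esub> ?v \<in> K"
    using normal_closure_normal(2)[OF F.is_group relators_carrier] by blast
  then have "q (inv\<^bsub>FG m\<^esub> fgen m i \<otimes>\<^bsub>FG m\<^esub> ?v) = \<one>\<^bsub>PG\<^esub>"
    by (simp add: presented_group_def K.rcos_const F.is_group)
  then have "inv\<^bsub>PG\<^esub> q (fgen m i) \<otimes>\<^bsub>PG\<^esub> q ?v = \<one>\<^bsub>PG\<^esub>" using c by simp
  then have "q ?v = q (fgen m i)"
    using c by (metis F.inv_closed F.m_closed PG.inv_equality PG.inv_inv Q.hom_closed PG.inv_closed PG.inv_comm)
  then show ?thesis using c by simp
qed

text \<open>Von Dyck's theorem for C-presentations.\<close>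

lemma universal:
  fixes H :: "('h, 'e) monoid_scheme" (structure)
  assumes "group H" and \<Phi>: "\<Phi> \<in> hom (FG m) H"
    and rel: "\<And>i j k. i \<in> {1..m} \<Longrightarrow> j \<in> {1..m} \<Longrightarrow> k \<in> {1..l i j} \<Longrightarrow>
      \<Phi> (fgen m i) = inv \<Phi> (w i j k) \<otimes> \<Phi> (fgen m j) \<otimes> \<Phi> (w i j k)"
  shows "\<exists>\<Psi>\<in>hom PG H. \<forall>g\<in>carrier (FG m). \<Psi> (q g) = \<Phi> g"
proof -
  interpret H: group H by fact
  interpret \<Phi>: group_hom "FG m" H \<Phi> by unfold_locales (rule \<Phi>)
  have "C_relators m l w \<subseteq> kernel (FG m) H \<Phi>"
  proof
    fix r assume r: "r \<in> C_relators m l w"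
    then obtain i j k where ijk: "i \<in> {1..m}" "j \<in> {1..m}" "k \<in> {1..l i j}"
      "r = inv\<^bsub>FG m\<^esub> fgen m i \<otimes>\<^bsub>FG m\<^esub> (inv\<^bsub>FG m\<^esub> w i j k \<otimes>\<^bsub>FG m\<^esub> fgen m j \<otimes>\<^bsub>FG m\<^esub> w i j k)"
      unfolding C_relators_def by blast
    note c = fgen_carrier[OF ijk(1)] fgen_carrier[OF ijk(2)] w_carrier[OF ijk(1-3)]
    have "\<Phi> r = inv \<Phi> (fgen m i) \<otimes>
        (inv \<Phi> (w i j k) \<otimes> \<Phi> (fgen m j) \<otimes> \<Phi> (w i j k))"
      unfolding ijk(4) using c by simp
    also have "\<dots> = \<one>"
      unfolding rel[OF ijk(1-3), symmetric] using c by simp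
    finally show "r \<in> kernel (FG m) H \<Phi>" using r relators_carrier by (auto simp: kernel_def)
  qed
  then have "K \<subseteq> kernel (FG m) H \<Phi>"
    by (intro normal_closure_minimal F.is_group \<Phi>.normal_kernel)
  then show ?thesis
    using \<Phi>.FactGroup_universal_kernel[OF K.normal_axioms] unfolding presented_group_def by metis
qed

text \<open>In an abelian target a conjugation relation only asks two generators to have equal
  images, so sending all of them to 1 respects every relation.\<close>

lemma degree_hom: "\<exists>\<nu>\<in>hom PG integer_group. \<forall>i\<in>{1..m}. \<nu> (q (fgen m i)) = 1"
proof -
  obtain \<Phi> where \<Phi>: "\<Phi> \<in> hom (FG m) integer_group" "\<forall>i\<in>{1..m}. \<Phi> (fgen m i) = 1"
    using free_group_universal[OF group_integer_group, of "{1..m}" "\<lambda>_. 1"] by auto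
  have "\<exists>\<Psi>\<in>hom PG integer_group. \<forall>g\<in>carrier (FG m). \<Psi> (q g) = \<Phi> g"
    by (rule universal[OF group_integer_group \<Phi>(1)]) (use \<Phi>(2) in \<open>auto\<close>)
  then obtain \<Psi> where \<Psi>: "\<Psi> \<in> hom PG integer_group" "\<forall>g\<in>carrier (FG m). \<Psi> (q g) = \<Phi> g" by blast
  then have "\<forall>i\<in>{1..m}. \<Psi> (q (fgen m i)) = 1" using \<Phi>(2) fgen_carrier by metis
  then show ?thesis using \<Psi>(1) by blast
qed

end

section \<open>Alexander polynomials of irreducible Hurwitz \<open>C\<close>-groups\<close>

text \<open>The Z[z]-submodule of the complex numbers generated by the first \<open>n\<close> values
  of \<open>\<beta>\<close>.\<close>

definition int_poly_span :: "complex \<Rightarrow> nat \<Rightarrow> (nat \<Rightarrow> complex) \<Rightarrow> complex set" where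
  "int_poly_span z n \<beta> = {\<Sum>j<n. poly (cpoly (p j)) z * \<beta> j | p. True}"

lemma int_poly_spanI: "u = (\<Sum>j<n. poly (cpoly (p j)) z * \<beta> j) \<Longrightarrow> u \<in> int_poly_span z n \<beta>"
  unfolding int_poly_span_def by blast

lemma int_poly_span_add:
  assumes "u \<in> int_poly_span z n \<beta>" "v \<in> int_poly_span z n \<beta>"
  shows "u + v \<in> int_poly_span z n \<beta>"
proof -
  obtain p q where "u = (\<Sum>j<n. poly (cpoly (p j)) z * \<beta> j)" "v = (\<Sum>j<n. poly (cpoly (q j)) z * \<beta> j)"
    using assms unfolding int_poly_span_def by blast
  then show ?thesis
    by (intro int_poly_spanI[where p = "\<lambda>j. p j + q j"])
      (simp add: of_int_poly_hom.hom_add sum.distrib distrib_right)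
qed

lemma int_poly_span_mult:
  assumes "u \<in> int_poly_span z n \<beta>"
  shows "poly (cpoly f) z * u \<in> int_poly_span z n \<beta>"
proof -
  obtain p where "u = (\<Sum>j<n. poly (cpoly (p j)) z * \<beta> j)"
    using assms unfolding int_poly_span_def by blast
  then show ?thesis
    by (intro int_poly_spanI[where p = "\<lambda>j. f * p j"])
      (simp add: cpoly_mult sum_distrib_left mult.assoc)
qed

lemma cpoly_X_minus_one: "poly (cpoly [:- 1, 1:]) z = z - 1"
  by (simp add: map_poly_pCons)

text \<open>Nakayama's lemma for the \<open>\<int>[z]\<close>-module \<open>L\<close> and the ideal generated by \<open>z - 1\<close>, by
  successive elimination of the generators.\<close>

lemma Nakayama:
  assumes span: "L \<subseteq> int_poly_span z n \<beta>" and \<beta>: "\<And>j. j < n \<Longrightarrow> \<exists>u\<in>L. \<beta> j = (z - 1) * u"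
    and nz: "\<exists>u\<in>L. u \<noteq> 0"
  shows "\<exists>F. poly F 1 = 1 \<and> poly (cpoly F) z = 0"
proof -
  \<comment> \<open>For \<open>k = n\<close> this is the hypothesis \<open>span\<close>;
    \<open>inc_induct\<close> descends to \<open>k = 0\<close>, where the span is zero and F(z)
    annihilates \<open>L\<close>.\<close>
  have "\<exists>F. poly F 1 = 1 \<and> (\<forall>u\<in>L. poly (cpoly F) z * u \<in> int_poly_span z k \<beta>)" if "k \<le> n" for k
    using that
  proof (induction k rule: inc_induct)
    case base
    then show ?case using span by (intro exI[of _ 1]) auto
  next
    case (step k)
    then obtain F where F: "poly F 1 = 1" "\<forall>u\<in>L. poly (cpoly F) z * u \<in> int_poly_span z (Suc k) \<beta>"
      by blast
    obtain u0 where u0: "u0 \<in> L" "\<beta> k = (z - 1) * u0" using \<beta> step.hyps by blast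
    obtain p where p: "poly (cpoly F) z * u0 = (\<Sum>j<Suc k. poly (cpoly (p j)) z * \<beta> j)"
      using F(2) u0(1) unfolding int_poly_span_def by blast
    define s where "s = (\<Sum>j<k. poly (cpoly (p j)) z * \<beta> j)"
    have s: "s \<in> int_poly_span z k \<beta>" unfolding s_def by (rule int_poly_spanI) simp
    \<comment> \<open>Multiplying the expansion of F(z) \<open>u0\<close> by z - 1 gives an equation
      for \<open>\<beta> k\<close>; \<open>E\<close> collects its coefficients, so that E(z)
      \<open>\<beta> k\<close> lies in the span of the first \<open>k\<close> generators. The
      correction has the factor t - 1, whence E(1) = F(1).\<close>
    define E where "E = F - [:- 1, 1:] * p k"
    have Ez: "poly (cpoly E) z = poly (cpoly F) z - (z - 1) * poly (cpoly (p k)) z"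
      by (simp add: E_def of_int_poly_hom.hom_minus cpoly_mult cpoly_X_minus_one
          del: mult_pCons_left)
    have "poly (cpoly F) z * \<beta> k = (z - 1) * (s + poly (cpoly (p k)) z * \<beta> k)"
      using p u0(2) by (simp add: s_def mult.left_commute)
    then have E\<beta>: "poly (cpoly E) z * \<beta> k = (z - 1) * s"
      unfolding Ez by (simp add: algebra_simps)
    have "poly (E * F) 1 = 1" using F(1) by (simp add: E_def)
    moreover have "poly (cpoly (E * F)) z * u \<in> int_poly_span z k \<beta>" if u: "u \<in> L" for u
    proof -
      obtain q where q: "poly (cpoly F) z * u = (\<Sum>j<Suc k. poly (cpoly (q j)) z * \<beta> j)"
        using F(2) u unfolding int_poly_span_def by blast
      define t where "t = (\<Sum>j<k. poly (cpoly (q j)) z * \<beta> j)"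
      have t: "t \<in> int_poly_span z k \<beta>" unfolding t_def by (rule int_poly_spanI) simp
      have "poly (cpoly (E * F)) z * u = poly (cpoly E) z * (t + poly (cpoly (q k)) z * \<beta> k)"
        using q by (simp add: t_def cpoly_mult mult.assoc)
      also have "\<dots> = poly (cpoly E) z * t + poly (cpoly (q k)) z * (poly (cpoly E) z * \<beta> k)"
        by (simp add: algebra_simps)
      also have "\<dots> = poly (cpoly E) z * t + poly (cpoly (q k * [:- 1, 1:])) z * s"
        unfolding E\<beta> by (simp only: cpoly_mult poly_mult cpoly_X_minus_one mult.assoc)
      finally show ?thesis
        using int_poly_span_add int_poly_span_mult s t by metis
    qed
    ultimately show ?case by blast
  qed
  from this[of 0] obtain F where "poly F 1 = 1" "\<forall>u\<in>L. poly (cpoly F) z * u = 0"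
    by (auto simp: int_poly_span_def)
  then show ?thesis using nz by auto
qed

section \<open>Eigencharacters of Hurwitz C-groups\<close>

context C_group_degree
begin

lemma character_cls:
  assumes \<chi>: "character \<chi>" and "g \<in> N" "k \<in> N" "cls g = cls k"
  shows "\<chi> g = \<chi> k"
  using character_extension[OF \<chi>] assms by (metis \<tau>_def)

text \<open>The condition is imposed for every \<open>y\<close> of degree 1, which by
  \<open>cls_conj_cong\<close> is no more than for a single one.\<close>

definition eigencharacter :: "complex \<Rightarrow> ('a \<Rightarrow> complex) \<Rightarrow> bool" where
  "eigencharacter z \<chi> \<longleftrightarrow> character \<chi> \<and> (\<exists>g\<in>N. \<chi> g \<noteq> 0) \<and>
    (\<forall>y g. y \<in> carrier G \<longrightarrow> \<nu> y = 1 \<longrightarrow> g \<in> N \<longrightarrow> \<chi> (inv y \<otimes> g \<otimes> y) = z * \<chi> g)"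

context
  fixes z \<chi> assumes ev: "eigencharacter z \<chi>"
begin

lemma \<chi>_character: "character \<chi>"
  using ev by (simp add: eigencharacter_def)

lemma \<chi>_mult: "g \<in> N \<Longrightarrow> k \<in> N \<Longrightarrow> \<chi> (g \<otimes> k) = \<chi> g + \<chi> k"
  using \<chi>_character by (simp add: character_def)

lemma \<chi>_conj: "g \<in> N \<Longrightarrow> \<chi> (inv x0 \<otimes> g \<otimes> x0) = z * \<chi> g"
  using ev x0 by (simp add: eigencharacter_def)

lemma \<chi>_conj_pow: "g \<in> N \<Longrightarrow> \<chi> (inv (x0 [^] n) \<otimes> g \<otimes> x0 [^] (n::nat)) = z ^ n * \<chi> g"
proof (induction n)
  case (Suc n)
  have "inv (x0 [^] Suc n) \<otimes> g \<otimes> x0 [^] Suc n = inv x0 \<otimes> (inv (x0 [^] n) \<otimes> g \<otimes> x0 [^] n) \<otimes> x0"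
    using x0 Suc.prems by (simp add: group_simps)
  then show ?case using Suc x0 by (simp add: \<chi>_conj conj_N)
qed simp

text \<open>Conjugation by \<open>x0 [^] e\<close> multiplies \<open>\<chi>\<close> by
  \<open>z ^ e\<close>, yet it is trivial modulo N'.\<close>

lemma eigenvalue_power: "z ^ e = 1"
proof -
  obtain g where g: "g \<in> N" "\<chi> g \<noteq> 0" using ev by (auto simp: eigencharacter_def)
  have "\<chi> (inv (x0 [^] e) \<otimes> g \<otimes> x0 [^] e) = \<chi> g"
    using x0 g by (intro character_cls[OF \<chi>_character] conj_N cls_conj_period) auto
  then show ?thesis using \<chi>_conj_pow[OF g(1), of e] g(2) by simp
qed

lemma eigenvalue_nonzero: "z \<noteq> 0"
  using eigenvalue_power e_pos by (auto simp: power_0_left)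

lemma \<chi>_conj_int_pow:
  assumes g: "g \<in> N" shows "\<chi> (inv (x0 [^] k) \<otimes> g \<otimes> x0 [^] (k::int)) = z powi k * \<chi> g"
proof (cases k rule: int_cases2)
  case (nonneg n)
  then show ?thesis using \<chi>_conj_pow[OF g] by (simp add: int_pow_int)
next
  case (nonpos n)
  let ?h = "x0 [^] n \<otimes> g \<otimes> inv (x0 [^] n)"
  have h: "?h \<in> N" using N.inv_op_closed2[of "x0 [^] n" g] x0 g by simp
  have "inv (x0 [^] n) \<otimes> ?h \<otimes> x0 [^] n = g" using x0 g by (simp add: group_simps)
  then have "\<chi> g = z ^ n * \<chi> ?h" using \<chi>_conj_pow[OF h, of n] by simp
  moreover have "inv (x0 [^] k) \<otimes> g \<otimes> x0 [^] k = ?h"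
    using x0 nonpos by (simp add: int_pow_neg int_pow_int)
  ultimately show ?thesis
    using eigenvalue_nonzero nonpos by (simp add: power_int_minus field_simps)
qed

definition L :: "complex set" where "L = \<chi> ` N"

lemma L_add: "u \<in> L \<Longrightarrow> v \<in> L \<Longrightarrow> u + v \<in> L"
  unfolding L_def by (auto simp: \<chi>_mult[symmetric])

lemma L_zero: "0 \<in> L"
  unfolding L_def using character_one[OF \<chi>_character] N.one_closed by force

lemma L_minus: "u \<in> L \<Longrightarrow> - u \<in> L"
  unfolding L_def by (auto simp: character_inv[OF \<chi>_character, symmetric])

lemma L_powi: "u \<in> L \<Longrightarrow> z powi k * u \<in> L"
proof -
  assume "u \<in> L"
  then obtain g where g: "g \<in> N" "u = \<chi> g" by (auto simp: L_def)
  then have "inv (x0 [^] k) \<otimes> g \<otimes> x0 [^] k \<in> N" using x0 by (intro conj_N) auto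
  then show ?thesis unfolding g(2) \<chi>_conj_int_pow[OF g(1), of k, symmetric] L_def by (rule imageI)
qed

text \<open>In the ring of integer Laurent polynomials in z, over which \<open>L\<close> is a
  module, z^k - 1 is a multiple of z - 1.\<close>

lemma L_powi_minus_one: "u \<in> L \<Longrightarrow> \<exists>v\<in>L. (z powi k - 1) * u = (z - 1) * v"
proof -
  assume u: "u \<in> L"
  have pos: "\<exists>v\<in>L. (z ^ n - 1) * u = (z - 1) * v" if u: "u \<in> L" for n u
  proof (induction n)
    case 0
    then show ?case using L_zero by (intro bexI[of _ 0]) auto
  next
    case (Suc n)
    then obtain v where v: "v \<in> L" "(z ^ n - 1) * u = (z - 1) * v" by blast
    have "(z ^ Suc n - 1) * u = (z - 1) * (z powi int n * u) + (z ^ n - 1) * u"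
      by (simp add: algebra_simps)
    also have "\<dots> = (z - 1) * (z powi int n * u + v)" unfolding v(2) by (simp add: algebra_simps)
    finally show ?case using L_add[OF L_powi[OF u] v(1)] by blast
  qed
  show ?thesis
  proof (cases k rule: int_cases2)
    case (nonneg n)
    then show ?thesis using pos[OF u, of n] by simp
  next
    case (nonpos n)
    obtain v where v: "v \<in> L" "(z ^ n - 1) * (z powi k * u) = (z - 1) * v"
      using pos[OF L_powi[OF u]] by blast
    have "z ^ n * z powi k = 1"
      using eigenvalue_nonzero nonpos by (simp add: power_int_minus)
    then have "(z powi k - 1) * u = - ((z ^ n - 1) * (z powi k * u))"
      by (simp add: algebra_simps flip: mult.assoc)
    also have "\<dots> = (z - 1) * (- v)" unfolding v(2) by simp
    finally show ?thesis using L_minus[OF v(1)] by blast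
  qed
qed

text \<open>The extension of \<open>\<chi>\<close> to a crossed homomorphism on the whole group.\<close>

definition \<delta> :: "'a \<Rightarrow> complex" where "\<delta> g = \<chi> (inv (x0 [^] \<nu> g) \<otimes> g)"

lemma degree_zero_part: "g \<in> carrier G \<Longrightarrow> inv (x0 [^] \<nu> g) \<otimes> g \<in> N"
  using x0 \<nu>.hom_int_pow[of x0 "\<nu> g"] by (intro N_I) (auto simp: \<nu>_mult)

lemma \<delta>_L: "g \<in> carrier G \<Longrightarrow> \<delta> g \<in> L"
  unfolding \<delta>_def L_def using degree_zero_part by blast

lemma \<delta>_mult:
  assumes g: "g \<in> carrier G" "k \<in> carrier G"
  shows "\<delta> (g \<otimes> k) = z powi \<nu> k * \<delta> g + \<delta> k"
proof -
  let ?i = "x0 [^] \<nu> g" and ?j = "x0 [^] \<nu> k"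
  have "inv (x0 [^] \<nu> (g \<otimes> k)) \<otimes> (g \<otimes> k) = (inv ?j \<otimes> (inv ?i \<otimes> g) \<otimes> ?j) \<otimes> (inv ?j \<otimes> k)"
    using x0 g by (simp add: \<nu>_mult int_pow_mult group_simps)
  then show ?thesis
    unfolding \<delta>_def using x0 degree_zero_part[OF g(1)] degree_zero_part[OF g(2)]
    by (simp add: \<chi>_mult conj_N \<chi>_conj_int_pow)
qed

lemma \<delta>_N: "g \<in> N \<Longrightarrow> \<delta> g = \<chi> g"
  by (simp add: \<delta>_def N_\<nu>)

text \<open>Comparing \<open>\<delta>\<close> on the products of g and k in the two orders expresses
  the value at the commutator, up to a power of z, as the difference of
  \<open>(z powi \<nu> k - 1) * \<delta> g\<close> and
  \<open>(z powi \<nu> g - 1) * \<delta> k\<close>, and both lie in (z - 1) L.\<close>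

lemma commutator_eigencharacter:
  assumes g: "g \<in> carrier G" "k \<in> carrier G"
  shows "\<exists>v\<in>L. \<chi> (g \<otimes> k \<otimes> inv g \<otimes> inv k) = (z - 1) * v"
proof -
  let ?h = "g \<otimes> k \<otimes> inv g \<otimes> inv k"
  have h: "?h \<in> N" using g by (intro N_I) (auto simp: \<nu>_mult)
  have "?h \<otimes> (k \<otimes> g) = g \<otimes> k" using g by (simp add: group_simps)
  then have "\<delta> (g \<otimes> k) = z powi \<nu> (k \<otimes> g) * \<chi> ?h + \<delta> (k \<otimes> g)"
    using \<delta>_mult[of ?h "k \<otimes> g"] \<delta>_N[OF h] g by simp
  then have e: "z powi \<nu> (k \<otimes> g) * \<chi> ?h = (z powi \<nu> k - 1) * \<delta> g - (z powi \<nu> g - 1) * \<delta> k"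
    using g by (simp add: \<delta>_mult algebra_simps)
  obtain v1 v2 where v: "v1 \<in> L" "v2 \<in> L" "(z powi \<nu> k - 1) * \<delta> g = (z - 1) * v1"
    "(z powi \<nu> g - 1) * \<delta> k = (z - 1) * v2"
    using L_powi_minus_one[OF \<delta>_L[OF g(1)], of "\<nu> k"] L_powi_minus_one[OF \<delta>_L[OF g(2)], of "\<nu> g"] by blast
  let ?n = "\<nu> (k \<otimes> g)"
  have "\<chi> ?h = z powi (- ?n) * (z powi ?n * \<chi> ?h)"
    using eigenvalue_nonzero by (simp add: power_int_minus)
  also have "\<dots> = (z - 1) * (z powi (- ?n) * (v1 + - v2))"
    unfolding e v(3,4) by (simp add: algebra_simps)
  finally show ?thesis using L_powi[OF L_add[OF v(1) L_minus[OF v(2)]]] by blast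
qed

text \<open>Commutators generate the derived group, and the elements with value in (z - 1) L form a
  subgroup. This supplies the divisibility hypothesis of Nakayama's lemma.\<close>

lemma eigencharacter_derived:
  assumes "g \<in> N" "g \<in> derived G (carrier G)"
  shows "\<exists>v\<in>L. \<chi> g = (z - 1) * v"
proof -
  define U where "U = {g \<in> N. \<exists>v\<in>L. \<chi> g = (z - 1) * v}"
  have "subgroup U G"
  proof (rule subgroupI)
    show "U \<subseteq> carrier G" using N.subset by (auto simp: U_def)
    have "\<one> \<in> U" unfolding U_def using L_zero character_one[OF \<chi>_character] by force
    then show "U \<noteq> {}" by blast
  next
    fix a assume "a \<in> U"
    then obtain v where v: "a \<in> N" "v \<in> L" "\<chi> a = (z - 1) * v" by (auto simp: U_def)
    then have "\<chi> (inv a) = (z - 1) * - v" using character_inv[OF \<chi>_character v(1)] by simp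
    then show "inv a \<in> U" unfolding U_def using v L_minus by blast
  next
    fix a b assume "a \<in> U" "b \<in> U"
    then obtain u v where v: "a \<in> N" "b \<in> N" "u \<in> L" "v \<in> L" "\<chi> a = (z - 1) * u" "\<chi> b = (z - 1) * v"
      by (auto simp: U_def)
    then have "\<chi> (a \<otimes> b) = (z - 1) * (u + v)" by (simp add: \<chi>_mult distrib_left)
    then show "a \<otimes> b \<in> U" unfolding U_def using v L_add by blast
  qed
  moreover have "derived_set G (carrier G) \<subseteq> U"
    unfolding U_def using commutator_eigencharacter by (auto simp: \<nu>_mult intro!: N_I)
  ultimately have "derived G (carrier G) \<subseteq> U"
    unfolding derived_def by (intro generate_subgroup_incl)
  then show ?thesis using assms(2) by (auto simp: U_def)
qed

text \<open>\<open>L\<close> is generated over Z[z] by the values of \<open>\<chi>\<close> at the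
  \<open>inv x0 \<otimes> x\<close>: this is \<open>N_minimal\<close> for the set of elements whose
  value lies in the span. By assumption these elements are in the derived group.\<close>

lemma eigenvalue_unit_condition:
  assumes "N \<subseteq> derived G (carrier G)"
  shows "\<exists>F. poly F 1 = 1 \<and> poly (cpoly F) z = 0"
proof -
  obtain xs where xs: "set xs = gs" using finite_list[OF gs_fin] by blast
  let ?n = "length xs"
  define \<beta> where "\<beta> j = \<chi> (inv x0 \<otimes> xs ! j)" for j
  have a: "inv x0 \<otimes> x \<in> N" if "x \<in> gs" for x
    using that gs_sub C_sub \<nu>_C x0 by (intro N_I) (auto simp: \<nu>_mult subset_iff)
  define U where "U = {g \<in> N. \<chi> g \<in> int_poly_span z ?n \<beta>}"
  have zero: "0 \<in> int_poly_span z ?n \<beta>" by (rule int_poly_spanI[where p = "\<lambda>_. 0"]) simp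
  have neg: "- u \<in> int_poly_span z ?n \<beta>" if "u \<in> int_poly_span z ?n \<beta>" for u
    using int_poly_span_mult[OF that, of "- 1"] by (simp add: of_int_poly_hom.hom_uminus)
  have zmul: "z * u \<in> int_poly_span z ?n \<beta>" if "u \<in> int_poly_span z ?n \<beta>" for u
    using int_poly_span_mult[OF that, of "[:0, 1:]"] by (simp add: map_poly_pCons)
  have one: "\<one> \<in> U" using zero character_one[OF \<chi>_character] by (simp add: U_def)
  have "subgroup U G"
  proof (rule subgroupI)
    show "U \<noteq> {}" using one by blast
  qed (auto simp: U_def character_inv[OF \<chi>_character] \<chi>_mult intro: neg int_poly_span_add)
  moreover have "D \<subseteq> U"
    using D_sub_N character_D[OF \<chi>_character] zero by (auto simp: U_def)
  moreover have "inv x0 \<otimes> u \<otimes> x0 \<in> U" if "u \<in> U" for u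
    using that x0 zmul by (simp add: U_def conj_N \<chi>_conj)
  moreover have "inv x0 \<otimes> x \<in> U" if x: "x \<in> gs" for x
  proof -
    obtain j where j: "j < ?n" "x = xs ! j" using x xs by (metis in_set_conv_nth)
    have "(\<Sum>i<?n. \<beta> i * (if j = i then 1 else 0)) = \<beta> j" using j by (intro sum_Kronecker) auto
    moreover have "(\<Sum>i<?n. \<beta> i * (if j = i then 1 else 0))
        = (\<Sum>i<?n. poly (cpoly (if j = i then 1 else 0)) z * \<beta> i)"
      by (intro sum.cong) auto
    ultimately have "\<beta> j = (\<Sum>i<?n. poly (cpoly (if j = i then 1 else 0)) z * \<beta> i)" by metis
    then have "\<beta> j \<in> int_poly_span z ?n \<beta>" by (rule int_poly_spanI)
    then show ?thesis using a[OF x] j by (simp add: U_def \<beta>_def)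
  qed
  ultimately have "N \<subseteq> U" by (intro N_minimal[OF x0(2,3)]) (auto simp: U_def)
  then have "L \<subseteq> int_poly_span z ?n \<beta>" by (auto simp: L_def U_def)
  moreover have "\<exists>u\<in>L. \<beta> j = (z - 1) * u" if "j < ?n" for j
    unfolding \<beta>_def using that xs a assms by (intro eigencharacter_derived) auto
  moreover have "\<exists>u\<in>L. u \<noteq> 0" using ev by (auto simp: eigencharacter_def L_def)
  ultimately show ?thesis by (rule Nakayama)
qed

end

text \<open>An isomorphism of G/G' with Z gives \<open>f\<close> with kernel G' and
  \<open>f g0 = 1\<close>. As \<open>\<nu>\<close> vanishes on G', it is \<open>\<nu> g0\<close>
  times \<open>f\<close>; since \<open>\<nu>\<close> is not zero, its kernel lies in that of
  \<open>f\<close>.\<close>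

lemma irreducible_kernel:
  assumes irr: "irreducible_C_group G"
  shows "N \<subseteq> derived G (carrier G)"
proof
  let ?D = "derived G (carrier G)"
  interpret DD: normal ?D G by (rule derived_self_is_normal)
  obtain \<psi> where \<psi>: "\<psi> \<in> iso (G Mod ?D) integer_group"
    using irr by (auto simp: irreducible_C_group_def is_iso_def)
  define f where "f g = \<psi> (?D #> g)" for g
  have f_hom: "f \<in> hom G integer_group"
  proof (rule homI)
    fix g k assume "g \<in> carrier G" "k \<in> carrier G"
    then show "f (g \<otimes> k) = f g \<otimes>\<^bsub>integer_group\<^esub> f k"
      using hom_mult[of \<psi> "G Mod ?D" integer_group "?D #> g" "?D #> k"] \<psi>
      by (simp add: f_def iso_def carrier_FactGroup DD.rcos_sum)
  qed simp
  interpret f: group_hom G integer_group f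
    by (simp add: group_hom_def group_hom_axioms_def is_group f_hom)
  have bij: "bij_betw \<psi> (carrier (G Mod ?D)) UNIV" using \<psi> by (simp add: iso_def)
  have inj: "g \<in> ?D" if g: "g \<in> carrier G" "f g = 0" for g
  proof -
    have "\<psi> (?D #> g) = \<psi> (?D #> \<one>)" using g f.hom_one by (simp add: f_def)
    then have "?D #> g = ?D #> \<one>"
      using bij g unfolding bij_betw_def inj_on_def carrier_FactGroup by blast
    then show ?thesis using rcos_self[OF g(1) DD.is_subgroup] DD.subset by simp
  qed
  obtain g0 where g0: "g0 \<in> carrier G" "f g0 = 1"
  proof -
    have "1 \<in> \<psi> ` carrier (G Mod ?D)" using bij by (simp add: bij_betw_def)
    then show ?thesis using that by (auto simp: carrier_FactGroup f_def)
  qed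
  have \<nu>_D: "\<nu> g = 0" if "g \<in> ?D" for g
  proof -
    have "derived_set G (carrier G) \<subseteq> N" by (auto simp: \<nu>_mult intro!: N_I)
    then have "?D \<subseteq> N" unfolding derived_def by (intro generate_subgroup_incl N.is_subgroup)
    then show ?thesis using that by (auto intro: N_\<nu>)
  qed
  have fac: "\<nu> g = f g * \<nu> g0" if g: "g \<in> carrier G" for g
  proof -
    let ?d = "inv (g0 [^] f g) \<otimes> g"
    have "f ?d = 0" using g g0 f.hom_int_pow[of g0 "f g"] by simp
    then have "\<nu> ?d = 0" using inj[of ?d] \<nu>_D g g0 by simp
    then show ?thesis using g g0 \<nu>.hom_int_pow[of g0 "f g"] by (simp add: \<nu>_mult)
  qed
  have "\<nu> g0 \<noteq> 0" using fac[OF x0(2)] x0(3) by auto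
  fix g assume g: "g \<in> N"
  then have "f g = 0" using fac[of g] N_\<nu>[OF g] \<open>\<nu> g0 \<noteq> 0\<close> by simp
  then show "g \<in> ?D" using inj g by simp
qed

text \<open>The sign: P(1) is a unit, hence odd, so the degree is even. Then the leading coefficient
  (-1)^degree is 1, and \<open>poly_one_pos\<close> gives P(1) > 0.\<close>

lemma Alexander_polynomial_irreducible:
  assumes irr: "irreducible_C_group G" and P: "Alexander_polynomial G C = cpoly P"
  shows "poly (cpoly P) z = 0 \<Longrightarrow> root_of_unity z" "poly P 1 = 1"
proof -
  have ec: "\<exists>\<chi>. eigencharacter z \<chi>" if "poly (cpoly P) z = 0" for z
    using Alexander_polynomial_root_character[of z] that by (simp add: P eigencharacter_def)
  show roots: "root_of_unity z" if "poly (cpoly P) z = 0" for z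
    using ec[OF that] eigenvalue_power e_pos unfolding root_of_unity_def by blast
  have lc: "lead_coeff P = (- 1) ^ degree P"
  proof -
    have "(of_int (lead_coeff P) :: complex) = of_int ((- 1) ^ degree P)"
      using Alexander_polynomial_lead_coeff by (simp add: P)
    then show ?thesis unfolding of_int_eq_iff .
  qed
  have unit: "poly P 1 dvd 1"
  proof (rule poly_one_unit)
    fix z assume z: "poly (cpoly P) z = 0"
    then show "root_of_unity z \<and> (\<exists>F. poly F 1 = 1 \<and> poly (cpoly F) z = 0)"
      using roots ec[OF z] eigenvalue_unit_condition irreducible_kernel[OF irr] by blast
  qed (simp add: lc)
  then have "odd (poly P 1)" by (metis dvd_trans odd_one)
  then have "even (degree P)" using even_degree roots by blast
  then have "lead_coeff P = 1" by (simp add: lc)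
  then have "poly P 1 > 0" using unit roots by (intro poly_one_pos) auto
  then show "poly P 1 = 1" using unit by simp
qed

end

text \<open>The central element is the image of x_1 ... x_m: the first relation for each pair (i, i)
  says that it commutes with the i-th generator.\<close>

lemma (in C_presented) C_group_degree_iso:
  fixes G (structure)
  assumes H: "Hurwitz_C_presentation m l w" and G: "group G" and \<phi>: "\<phi> \<in> iso PG G"
  shows "\<exists>\<nu> c. C_group_degree G (\<phi> ` presented_C_generators m l w) ((\<lambda>i. \<phi> (q (fgen m i))) ` {1..m}) \<nu> c m"
proof -
  interpret G: group G by fact
  let ?C = "\<phi> ` presented_C_generators m l w"
  define x where "x i = \<phi> (q (fgen m i))" for i
  have \<phi>_hom: "\<phi> \<in> hom PG G" and \<phi>_bij: "bij_betw \<phi> (carrier PG) (carrier G)"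
    using \<phi> by (auto simp: iso_def)
  interpret \<phi>: group_hom PG G \<phi> by unfold_locales (rule \<phi>_hom)
  have m: "m \<ge> 1" using pres by (simp add: C_presentation_def)
  have qc: "q (fgen m i) \<in> carrier PG" if "i \<in> {1..m}" for i using fgen_carrier[OF that] by simp
  have C: "?C = {inv g \<otimes> x i \<otimes> g | g i. g \<in> carrier G \<and> i \<in> {1..m}}"
  proof -
    have e: "\<phi> (inv\<^bsub>PG\<^esub> g \<otimes>\<^bsub>PG\<^esub> q (fgen m i) \<otimes>\<^bsub>PG\<^esub> g) = inv \<phi> g \<otimes> x i \<otimes> \<phi> g"
      if "g \<in> carrier PG" "i \<in> {1..m}" for g i
      using that qc[OF that(2)] by (simp add: x_def)
    have s: "carrier G = \<phi> ` carrier PG" using \<phi>_bij by (simp add: bij_betw_def)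
    show ?thesis
      unfolding presented_C_generators_def Let_def s using e by (auto simp: image_iff) (metis e)+
  qed
  have xc: "x i \<in> carrier G" if "i \<in> {1..m}" for i unfolding x_def using qc[OF that] by simp
  have gen: "carrier G = generate G (x ` {1..m})"
  proof -
    have "\<phi> ` generate PG ((\<lambda>i. q (fgen m i)) ` {1..m}) = generate G (\<phi> ` (\<lambda>i. q (fgen m i)) ` {1..m})"
      using qc by (intro \<phi>.generate_img[symmetric]) auto
    then show ?thesis
      using \<phi>_bij by (simp add: PG_generated[symmetric] bij_betw_def image_image x_def)
  qed
  obtain \<nu>0 where \<nu>0: "\<nu>0 \<in> hom PG integer_group" "\<forall>i\<in>{1..m}. \<nu>0 (q (fgen m i)) = 1"
    using degree_hom by blast
  let ?P = "\<lambda>\<nu>. \<nu> \<in> hom G integer_group \<and> (\<forall>c\<in>?C. \<nu> c = 1)"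
  have "\<exists>\<nu>. ?P \<nu>"
  proof -
    have h: "inv_into (carrier PG) \<phi> \<in> hom G PG"
      using PG.iso_set_sym[OF \<phi>] by (simp add: iso_def)
    define \<nu> where "\<nu> = \<nu>0 \<circ> inv_into (carrier PG) \<phi>"
    have \<nu>: "\<nu> \<in> hom G integer_group" unfolding \<nu>_def using hom_compose[OF h \<nu>0(1)] .
    interpret \<nu>: group_hom G integer_group \<nu>
      by (simp add: group_hom_def group_hom_axioms_def G \<nu>)
    have "\<nu> (x i) = 1" if "i \<in> {1..m}" for i
      using \<nu>0(2) that \<phi>_bij qc[OF that] by (simp add: \<nu>_def x_def bij_betw_def)
    then have "\<nu> c = 1" if "c \<in> ?C" for c
      using that xc unfolding C by auto
    then show ?thesis using \<nu> by blast
  qed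
  then have \<nu>: "?P (SOME \<nu>. ?P \<nu>)" by (rule someI_ex)
  \<comment> \<open>Literally the choice made in \<open>C_kernel\<close>, so that the kernels
    agree.\<close>
  define \<nu> where "\<nu> = (SOME \<nu>. ?P \<nu>)"
  have \<nu>_hom: "\<nu> \<in> hom G integer_group" and \<nu>_C: "\<And>c. c \<in> ?C \<Longrightarrow> \<nu> c = 1"
    using \<nu> by (auto simp: \<nu>_def)
  interpret \<nu>: group_hom G integer_group \<nu>
    by (simp add: group_hom_def group_hom_axioms_def G \<nu>_hom)
  have xC: "x ` {1..m} \<subseteq> ?C"
  proof
    fix y assume "y \<in> x ` {1..m}"
    then obtain i where i: "i \<in> {1..m}" "y = x i" by blast
    then have "y = inv \<one> \<otimes> x i \<otimes> \<one>" using xc by simp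
    then show "y \<in> ?C" unfolding C using i by blast
  qed
  define prd where "prd = foldr (\<lambda>j p. fgen m j \<otimes>\<^bsub>FG m\<^esub> p) [1..<Suc m] \<one>\<^bsub>FG m\<^esub>"
  have fold: "foldr (\<lambda>j p. fgen m j \<otimes>\<^bsub>FG m\<^esub> p) js \<one>\<^bsub>FG m\<^esub> \<in> carrier (FG m) \<and>
      \<nu> (\<phi> (q (foldr (\<lambda>j p. fgen m j \<otimes>\<^bsub>FG m\<^esub> p) js \<one>\<^bsub>FG m\<^esub>))) = int (length js)"
    if "set js \<subseteq> {1..m}" for js
    using that
  proof (induction js)
    case (Cons j js)
    let ?p = "foldr (\<lambda>j p. fgen m j \<otimes>\<^bsub>FG m\<^esub> p) js \<one>\<^bsub>FG m\<^esub>"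
    have j: "j \<in> {1..m}" and p: "?p \<in> carrier (FG m)" "\<nu> (\<phi> (q ?p)) = int (length js)"
      using Cons by auto
    have f: "fgen m j \<in> carrier (FG m)" by (rule fgen_carrier[OF j])
    have "\<nu> (\<phi> (q (fgen m j))) = 1" using \<nu>_C xC j unfolding x_def by blast
    then have "\<nu> (\<phi> (q (fgen m j \<otimes>\<^bsub>FG m\<^esub> ?p))) = 1 + int (length js)"
      using p f by simp
    then show ?case using p f by simp
  qed simp
  have prd: "prd \<in> carrier (FG m)" "\<nu> (\<phi> (q prd)) = int m"
  proof -
    have "set [1..<Suc m] \<subseteq> {1..m}" "length [1..<Suc m] = m" by auto
    then show "prd \<in> carrier (FG m)" "\<nu> (\<phi> (q prd)) = int m"
      using fold[of "[1..<Suc m]"] unfolding prd_def by metis+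
  qed
  define c where "c = \<phi> (q prd)"
  have cc: "c \<in> carrier G" unfolding c_def using prd(1) by simp
  have "x i \<otimes> c = c \<otimes> x i" if i: "i \<in> {1..m}" for i
  proof -
    have l: "1 \<in> {1..l i i}" and w: "w i i 1 = prd"
      using H i by (auto simp: Hurwitz_C_presentation_def prd_def)
    have "q (fgen m i) = inv\<^bsub>PG\<^esub> q prd \<otimes>\<^bsub>PG\<^esub> q (fgen m i) \<otimes>\<^bsub>PG\<^esub> q prd"
      using relation[OF i i l] unfolding w .
    then have "x i = \<phi> (inv\<^bsub>PG\<^esub> q prd \<otimes>\<^bsub>PG\<^esub> q (fgen m i) \<otimes>\<^bsub>PG\<^esub> q prd)"
      unfolding x_def by (rule arg_cong)
    also have "\<dots> = inv c \<otimes> x i \<otimes> c"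
      using qc[OF i] prd(1) by (simp add: x_def c_def)
    finally have "c \<otimes> x i = c \<otimes> (inv c \<otimes> x i \<otimes> c)" by simp
    then show ?thesis using cc xc[OF i] by (simp add: G.group_simps)
  qed
  then have "x ` {1..m} \<subseteq> {g \<in> carrier G. g \<otimes> c = c \<otimes> g}" using xc by auto
  moreover have "subgroup {g \<in> carrier G. g \<otimes> c = c \<otimes> g} G"
  proof (rule G.subgroupI)
    fix a assume "a \<in> {g \<in> carrier G. g \<otimes> c = c \<otimes> g}"
    then have a: "a \<in> carrier G" "a \<otimes> c = c \<otimes> a" by auto
    have "inv a \<otimes> (a \<otimes> c) \<otimes> inv a = c \<otimes> inv a"
      using a(1) cc by (simp add: G.group_simps)
    moreover have "inv a \<otimes> (c \<otimes> a) \<otimes> inv a = inv a \<otimes> c"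
      using a(1) cc by (simp add: G.group_simps)
    ultimately show "inv a \<in> {g \<in> carrier G. g \<otimes> c = c \<otimes> g}" using a by simp
  next
    fix a b assume "a \<in> {g \<in> carrier G. g \<otimes> c = c \<otimes> g}" "b \<in> {g \<in> carrier G. g \<otimes> c = c \<otimes> g}"
    then show "a \<otimes> b \<in> {g \<in> carrier G. g \<otimes> c = c \<otimes> g}"
      using cc by (auto simp: G.m_assoc) (simp add: G.m_assoc[symmetric])
  qed (use cc in \<open>auto intro: exI[of _ "\<one>"]\<close>)
  ultimately have central: "g \<otimes> c = c \<otimes> g" if "g \<in> carrier G" for g
    using G.generate_subgroup_incl gen that by blast
  have "C_group_degree G ?C (x ` {1..m}) \<nu> c m"
  proof (intro C_group_degree.intro C_group_degree_axioms.intro G)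
    show "?C \<subseteq> carrier G" unfolding C using xc by auto
    show "C_kernel G ?C = kernel G integer_group \<nu>" by (simp add: C_kernel_def \<nu>_def)
    show "\<nu> c = int m" using prd(2) by (simp add: c_def)
  qed (use xC m gen \<nu>_hom \<nu>_C cc central in auto)
  then show ?thesis unfolding x_def by blast
qed

lemma Hurwitz_irreducible_Alexander_polynomial:
  assumes "Hurwitz_C_group G C" "irreducible_C_group G" "Alexander_polynomial G C = cpoly P"
  shows "poly (cpoly P) z = 0 \<Longrightarrow> root_of_unity z" "poly P 1 = 1"
proof -
  obtain m l w \<phi> where p: "group G" "C_presentation m l w" "\<phi> \<in> iso (presented_group m l w) G"
    "C = \<phi> ` presented_C_generators m l w" "Hurwitz_C_presentation m l w"
    using assms(1) by (auto simp: Hurwitz_C_group_def has_C_presentation_def)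
  interpret C_presented m l w by unfold_locales (rule p(2))
  obtain \<nu> c gs where "C_group_degree G C gs \<nu> c m"
    using C_group_degree_iso[OF p(5,1,3)] p(4) by blast
  then interpret C_group_degree G C gs \<nu> c m .
  show "poly (cpoly P) z = 0 \<Longrightarrow> root_of_unity z" "poly P 1 = 1"
    using Alexander_polynomial_irreducible[OF assms(2,3)] by auto
qed

section \<open>Diagonalization of the Alexander module\<close>

text \<open>A Horner scheme: with a = x^-1 y and u = k_0 + k_1 t + ..., it is the product of the
  x^-i a^(k_i) x^i, which represents u(h) a in the Alexander module. It is defined in every group so
  that homomorphisms can transport it.\<close>

definition conj_word :: "('g, 'e) monoid_scheme \<Rightarrow> 'g \<Rightarrow> 'g \<Rightarrow> int poly \<Rightarrow> 'g" where
  "conj_word H x y u = fold_coeffs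
     (\<lambda>k W. (inv\<^bsub>H\<^esub> x \<otimes>\<^bsub>H\<^esub> y) [^]\<^bsub>H\<^esub> k \<otimes>\<^bsub>H\<^esub> (inv\<^bsub>H\<^esub> x \<otimes>\<^bsub>H\<^esub> W \<otimes>\<^bsub>H\<^esub> x)) u \<one>\<^bsub>H\<^esub>"

context group
begin

lemma conj_word_0: "conj_word G x y 0 = \<one>"
  by (simp add: conj_word_def)

lemma conj_word_pCons:
  assumes "x \<in> carrier G" "y \<in> carrier G"
  shows "conj_word G x y (pCons k u) = (inv x \<otimes> y) [^] k \<otimes> (inv x \<otimes> conj_word G x y u \<otimes> x)"
proof (cases "k = 0 \<and> u = 0")
  case True
  then show ?thesis using assms by (simp add: conj_word_0 int_pow_0)
next
  case False
  then show ?thesis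
    unfolding conj_word_def by (cases "u = 0") auto
qed

lemma conj_word_closed:
  assumes "x \<in> carrier G" "y \<in> carrier G"
  shows "conj_word G x y u \<in> carrier G"
  using assms by (induction u) (auto simp: conj_word_0 conj_word_pCons)

end

lemma (in group_hom) hom_conj_word:
  assumes "x \<in> carrier G" "y \<in> carrier G"
  shows "h (conj_word G x y u) = conj_word H (h x) (h y) u"
  using assms
  by (induction u)
    (auto simp: G.conj_word_0 H.conj_word_0 G.conj_word_pCons H.conj_word_pCons G.conj_word_closed hom_int_pow)

section \<open>Affine representations\<close>

text \<open>The pair \<open>(k, b)\<close> stands for the affine map \<open>u \<mapsto> z\<^sup>k u + b\<close>; maps are composed
  from left to right.\<close>

definition affine_group :: "complex \<Rightarrow> (int \<times> complex) monoid" where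
  "affine_group z = \<lparr>carrier = UNIV,
     monoid.mult = (\<lambda>(k, b) (j, d). (k + j, z powi j * b + d)), one = (0, 0)\<rparr>"

lemma affine_group_simps [simp]:
  "carrier (affine_group z) = UNIV"
  "(k, b) \<otimes>\<^bsub>affine_group z\<^esub> (j, d) = (k + j, z powi j * b + d)"
  "\<one>\<^bsub>affine_group z\<^esub> = (0, 0)"
  by (simp_all add: affine_group_def)

lemma group_affine_group:
  assumes "z \<noteq> 0" shows "group (affine_group z)"
proof (rule groupI)
  fix p assume "p \<in> carrier (affine_group z)"
  show "\<exists>y\<in>carrier (affine_group z). y \<otimes>\<^bsub>affine_group z\<^esub> p = \<one>\<^bsub>affine_group z\<^esub>"
    using assms by (cases p) (auto intro!: exI[of _ "- fst p"] exI[of _ "- (z powi (- fst p)) * snd p"]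
        simp: power_int_minus)
qed (use assms in \<open>auto simp: power_int_add algebra_simps\<close>)

lemma inv_affine_group:
  assumes "z \<noteq> 0"
  shows "inv\<^bsub>affine_group z\<^esub> (k, b) = (- k, - (z powi (- k)) * b)"
  using assms by (intro group.inv_equality[OF group_affine_group]) (auto simp: power_int_minus)

lemma int_pow_affine_group:
  assumes "z \<noteq> 0"
  shows "(0, b) [^]\<^bsub>affine_group z\<^esub> (k :: int) = (0, of_int k * b)"
proof -
  interpret group "affine_group z" by (rule group_affine_group[OF assms])
  have nat: "(0, b) [^]\<^bsub>affine_group z\<^esub> (n :: nat) = (0, of_nat n * b)" for n
    by (induction n) (auto simp: algebra_simps)
  show ?thesis
    by (cases k rule: int_cases2)
      (auto simp: int_pow_int int_pow_neg nat inv_affine_group[OF assms])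
qed

text \<open>Here x^-1 y is the translation by \<open>b\<close>, and conjugation by (1, 0) multiplies
  translations by \<open>z\<close>.\<close>

lemma conj_word_affine_group:
  assumes z: "z \<noteq> 0"
  shows "conj_word (affine_group z) (1, 0) (1, b) u = (0, poly (cpoly u) z * b)"
proof -
  interpret group "affine_group z" by (rule group_affine_group[OF z])
  show ?thesis
    by (induction u)
      (auto simp: conj_word_0 conj_word_pCons inv_affine_group[OF z] int_pow_affine_group[OF z]
        map_poly_pCons algebra_simps)
qed

text \<open>Each translation is multiplied by \<open>z\<close> once for every factor to its
  right.\<close>

lemma foldr_affine_group:
  "foldr (\<lambda>j p. (1, b j) \<otimes>\<^bsub>affine_group z\<^esub> p) js \<one>\<^bsub>affine_group z\<^esub>
    = (int (length js), \<Sum>t<length js. z ^ (length js - Suc t) * b (js ! t))"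
proof (induction js)
  case (Cons j js)
  have "(\<Sum>t<length (j # js). z ^ (length (j # js) - Suc t) * b ((j # js) ! t))
      = z ^ length js * b j + (\<Sum>t<length js. z ^ (length js - Suc t) * b (js ! t))"
    unfolding length_Cons by (subst sum.lessThan_Suc_shift) simp
  note sum_eq = this
  have "foldr (\<lambda>j p. (1, b j) \<otimes>\<^bsub>affine_group z\<^esub> p) (j # js) \<one>\<^bsub>affine_group z\<^esub>
      = (1, b j) \<otimes>\<^bsub>affine_group z\<^esub> foldr (\<lambda>j p. (1, b j) \<otimes>\<^bsub>affine_group z\<^esub> p) js \<one>\<^bsub>affine_group z\<^esub>"
    by simp
  then show ?case unfolding Cons.IH sum_eq by simp
qed simp

text \<open>The origin of the n-fold repetition: each block of equal generators contributes a
  multiple of 1 + z + ... + z^(n-1) = 0 to the translation part of the product.\<close>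

lemma unity_block_sum:
  fixes z :: complex
  assumes "z ^ n = 1" "z \<noteq> 1"
  shows "(\<Sum>t<s * n. z ^ (s * n - Suc t) * B (t div n)) = 0"
proof (cases "n = 0")
  case False
  have geo: "(\<Sum>r<n. z ^ r) = 0" using assms by (simp add: geometric_sum)
  have block: "(\<Sum>t = c * n..<c * n + n. z ^ (s * n - Suc t) * B (t div n)) = 0" if c: "c < s" for c
  proof -
    have le: "c * n + n \<le> s * n" using c by (metis Suc_leI add.commute mult_Suc mult_le_mono1)
    have "(\<Sum>t = c * n..<c * n + n. z ^ (s * n - Suc t) * B (t div n))
        = (\<Sum>r<n. z ^ (s * n - Suc (c * n + r)) * B ((c * n + r) div n))"
      by (rule sum.reindex_bij_witness[of _ "\<lambda>r. c * n + r" "\<lambda>t. t - c * n"]) auto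
    also have "\<dots> = (\<Sum>r<n. z ^ (s * n - (c * n + n)) * B c * z ^ (n - Suc r))"
    proof (rule sum.cong)
      fix r assume "r \<in> {..<n}"
      then have r: "r < n" by simp
      have "s * n - Suc (c * n + r) = (s * n - (c * n + n)) + (n - Suc r)" using r le by simp
      moreover have "(c * n + r) div n = c" using r by simp
      ultimately show "z ^ (s * n - Suc (c * n + r)) * B ((c * n + r) div n)
          = z ^ (s * n - (c * n + n)) * B c * z ^ (n - Suc r)"
        by (simp only: power_add mult_ac)
    qed simp
    also have "\<dots> = z ^ (s * n - (c * n + n)) * B c * (\<Sum>r<n. z ^ (n - Suc r))"
      by (simp add: sum_distrib_left)
    also have "(\<Sum>r<n. z ^ (n - Suc r)) = (\<Sum>r<n. z ^ r)" by (rule sum.nat_diff_reindex)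
    finally show ?thesis by (simp add: geo)
  qed
  have "(\<Sum>t<s * n. z ^ (s * n - Suc t) * B (t div n))
      = (\<Sum>c<s. \<Sum>t = c * n..<c * n + n. z ^ (s * n - Suc t) * B (t div n))"
    by (rule sum.nat_group[symmetric])
  also have "\<dots> = 0" using block by simp
  finally show ?thesis .
qed simp

section \<open>Lagrange interpolation and the action of polynomials in h\<close>

lemma prod_linear_dvd:
  fixes p :: "complex poly"
  assumes "finite R" "\<And>r. r \<in> R \<Longrightarrow> poly p r = 0"
  shows "(\<Prod>r\<in>R. [:- r, 1:]) dvd p"
  using assms
proof (induction R rule: finite_induct)
  case (insert r R)
  then obtain k where k: "p = (\<Prod>r\<in>R. [:- r, 1:]) * k" by (auto simp: dvd_def)
  have "poly (\<Prod>r\<in>R. [:- r, 1:]) r \<noteq> 0" using insert by (auto simp: poly_prod)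
  then have "poly k r = 0" using insert.prems[of r] by (simp add: k)
  then have "[:- r, 1:] dvd k" by (simp add: poly_eq_0_iff_dvd)
  then have "(\<Prod>r\<in>R. [:- r, 1:]) * [:- r, 1:] dvd p" unfolding k by (rule mult_dvd_mono[OF dvd_refl])
  then show ?case using insert.hyps by (simp add: mult.commute)
qed simp

text \<open>The \<open>g z\<close> represent the primitive idempotents of C[t]/(f): each spans the
  eigenspace of t for \<open>z\<close>, and they add up to 1.\<close>

lemma Lagrange_basis:
  fixes f :: "complex poly"
  assumes f: "f = (\<Prod>z\<in>R. [:- z, 1:])" and R: "finite R"
  shows "\<exists>g. (\<forall>z\<in>R. f dvd [:- z, 1:] * g z) \<and> (\<forall>z\<in>R. \<forall>w\<in>R. poly (g z) w = (if z = w then 1 else 0))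
    \<and> f dvd 1 - (\<Sum>z\<in>R. g z)"
proof -
  define h where "h z = (\<Prod>w\<in>R - {z}. [:- w, 1:])" for z :: complex
  define g where "g z = smult (1 / poly (h z) z) (h z)" for z
  have hz: "poly (h z) w = 0 \<longleftrightarrow> w \<in> R - {z}" for z w
    unfolding h_def using R by (auto simp: poly_prod)
  have gw: "poly (g z) w = (if z = w then 1 else 0)" if "z \<in> R" "w \<in> R" for z w
    using that hz[of z w] by (auto simp: g_def)
  have fh: "f = [:- z, 1:] * h z" if "z \<in> R" for z
    unfolding f h_def using R that by (rule prod.remove)
  have "f dvd [:- z, 1:] * g z" if "z \<in> R" for z
  proof -
    have "[:- z, 1:] * g z = smult (1 / poly (h z) z) f"
      unfolding g_def fh[OF that] by (rule mult_smult_right)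
    then show ?thesis by (simp add: dvd_smult)
  qed
  moreover have "f dvd 1 - (\<Sum>z\<in>R. g z)"
    unfolding f
  proof (rule prod_linear_dvd[OF R])
    fix w assume w: "w \<in> R"
    have "(\<Sum>z\<in>R. poly (g z) w) = (\<Sum>z\<in>R. if z = w then 1 else 0)" using w gw by (intro sum.cong) auto
    then show "poly (1 - (\<Sum>z\<in>R. g z)) w = 0" using w R by (simp add: poly_sum)
  qed
  ultimately show ?thesis using gw by (intro exI[of _ g]) blast
qed

context C_group_degree
begin

lemma T_closed: "v \<in> carrier V \<Longrightarrow> T v \<in> carrier V"
  and T_add: "u \<in> carrier V \<Longrightarrow> v \<in> carrier V \<Longrightarrow> T (u \<oplus>\<^bsub>V\<^esub> v) = T u \<oplus>\<^bsub>V\<^esub> T v"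
  and T_smult: "v \<in> carrier V \<Longrightarrow> T (z \<odot>\<^bsub>V\<^esub> v) = z \<odot>\<^bsub>V\<^esub> T v"
  using T_linear unfolding linear_endo_def by auto

text \<open>\<open>V\<close> as a module over C[t] in which t acts as \<open>T\<close>, by a Horner
  scheme parallel to \<open>conj_word\<close>.\<close>

definition act where "act p v = fold_coeffs (\<lambda>a w. a \<odot>\<^bsub>V\<^esub> v \<oplus>\<^bsub>V\<^esub> T w) p \<zero>\<^bsub>V\<^esub>"

lemma act_0 [simp]: "act 0 v = \<zero>\<^bsub>V\<^esub>"
  by (simp add: act_def)

lemma act_pCons:
  assumes "v \<in> carrier V" shows "act (pCons a p) v = a \<odot>\<^bsub>V\<^esub> v \<oplus>\<^bsub>V\<^esub> T (act p v)"
proof (cases "a = 0 \<and> p = 0")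
  case True
  then show ?thesis using assms Z.linear_endo_zero[OF T_linear] by simp
next
  case False
  then show ?thesis unfolding act_def by (cases "p = 0") auto
qed

lemma act_closed: "v \<in> carrier V \<Longrightarrow> act p v \<in> carrier V"
  by (induction p) (auto simp: act_pCons T_closed)

lemma act_add:
  assumes v: "v \<in> carrier V" shows "act (p + r) v = act p v \<oplus>\<^bsub>V\<^esub> act r v"
proof (induction p r rule: poly_induct2)
  case (pCons a p b r)
  then show ?case
    using v by (simp add: act_pCons Z.smult_add_left T_add T_closed act_closed Z.M.a_ac)
qed simp

lemma act_smult:
  assumes v: "v \<in> carrier V" shows "act (smult z p) v = z \<odot>\<^bsub>V\<^esub> act p v"
proof (induction p)
  case 0
  show ?case using Z.smult_r_null[of z] by simp
next
  case (pCons a p)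
  then show ?case
    using v by (simp add: act_pCons Z.smult_add_right Z.smult_assoc' T_smult T_closed act_closed)
qed

lemma act_const: "v \<in> carrier V \<Longrightarrow> act [:a:] v = a \<odot>\<^bsub>V\<^esub> v"
  by (simp add: act_pCons Z.linear_endo_zero[OF T_linear])

lemma act_one: "v \<in> carrier V \<Longrightarrow> act 1 v = v"
  using act_const[of v 1] by (simp add: one_pCons)

lemma act_X: "v \<in> carrier V \<Longrightarrow> act (pCons 0 p) v = T (act p v)"
  by (simp add: act_pCons T_closed act_closed)

lemma act_mult:
  assumes v: "v \<in> carrier V" shows "act (p * r) v = act p (act r v)"
proof (induction p)
  case (pCons a p)
  then show ?case
    using v by (simp add: act_pCons act_add act_smult act_closed T_closed)
qed simp

lemma act_multiple_zero:
  assumes "v \<in> carrier V" "act f v = \<zero>\<^bsub>V\<^esub>" "f dvd p"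
  shows "act p v = \<zero>\<^bsub>V\<^esub>"
proof -
  obtain k where k: "p = k * f" using assms(3) by (metis dvd_def mult.commute)
  have "act k \<zero>\<^bsub>V\<^esub> = \<zero>\<^bsub>V\<^esub>"
  proof (induction k)
    case (pCons a k)
    then show ?case
      using Z.smult_r_null[of a] Z.linear_endo_zero[OF T_linear] by (simp add: act_pCons)
  qed simp
  then show ?thesis unfolding k act_mult[OF assms(1)] assms(2) .
qed

lemma \<tau>_int_pow:
  assumes g: "g \<in> N" shows "\<tau> (g [^] (k::int)) = of_int k \<odot>\<^bsub>V\<^esub> \<tau> g"
proof -
  have gc: "g \<in> carrier G" using g by simp
  have nat: "g [^] n \<in> N \<and> \<tau> (g [^] n) = of_nat n \<odot>\<^bsub>V\<^esub> \<tau> g" for n :: nat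
    by (induction n) (use g in \<open>auto simp: \<tau>_one \<tau>_mult Z.smult_add_left Z.M.a_comm\<close>)
  show ?thesis
    by (cases k rule: int_cases2)
      (use nat gc g in \<open>auto simp: int_pow_int int_pow_neg \<tau>_inv Z.smult_neg\<close>)
qed

lemma \<tau>_conj_word:
  assumes x: "x \<in> carrier G" "\<nu> x = 1" "y \<in> carrier G" "\<nu> y = 1"
  shows "conj_word G x y u \<in> N" "\<tau> (conj_word G x y u) = act (cpoly u) (\<tau> (inv x \<otimes> y))"
proof -
  have a: "inv x \<otimes> y \<in> N" using x by (intro N_I) (auto simp: \<nu>_mult)
  have ap: "(inv x \<otimes> y) [^] (k::int) \<in> N" for k
    using subgroup_int_pow_closed[OF N.is_subgroup a] .
  have "conj_word G x y u \<in> N \<and> \<tau> (conj_word G x y u) = act (cpoly u) (\<tau> (inv x \<otimes> y))"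
  proof (induction u)
    case (pCons k u)
    have c: "inv x \<otimes> conj_word G x y u \<otimes> x \<in> N" using pCons x by (intro conj_N) auto
    have "\<tau> (inv x \<otimes> conj_word G x y u \<otimes> x) = T (act (cpoly u) (\<tau> (inv x \<otimes> y)))"
      using T_\<tau>[OF x(1,2)] pCons by metis
    then show ?case
      using c ap x a by (simp add: conj_word_pCons \<tau>_mult \<tau>_int_pow of_int_hom.map_poly_pCons_hom act_pCons)
  qed (simp add: conj_word_0 \<tau>_one)
  then show "conj_word G x y u \<in> N" "\<tau> (conj_word G x y u) = act (cpoly u) (\<tau> (inv x \<otimes> y))" by auto
qed

text \<open>The relation makes x^-1 y the product of x^-1 W^-1 x and \<open>W\<close>. The class of
  this product is (1 - t) u = 1 - f applied to the class of x^-1 y, so f annihilates that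
  class.\<close>

lemma act_relation:
  assumes x: "x \<in> carrier G" "\<nu> x = 1" "y \<in> carrier G" "\<nu> y = 1"
    and W: "W = conj_word G x y u" and rel: "y = inv W \<otimes> x \<otimes> W"
    and u: "[:1, - 1:] * u = 1 - f"
  shows "act (cpoly f) (\<tau> (inv x \<otimes> y)) = \<zero>\<^bsub>V\<^esub>"
proof -
  let ?a = "\<tau> (inv x \<otimes> y)"
  have a: "?a \<in> carrier V" using x by (intro \<tau>_carrier N_I) (auto simp: \<nu>_mult)
  have WN: "W \<in> N" and \<tau>W: "\<tau> W = act (cpoly u) ?a" using \<tau>_conj_word[OF x] W by auto
  have Wc: "W \<in> carrier G" using WN by simp
  have cN: "inv x \<otimes> inv W \<otimes> x \<in> N" using WN x by (intro conj_N) auto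
  have "inv x \<otimes> y = (inv x \<otimes> inv W \<otimes> x) \<otimes> W"
    using x Wc by (subst rel) (simp add: group_simps)
  then have "?a = \<tau> (inv x \<otimes> inv W \<otimes> x) \<oplus>\<^bsub>V\<^esub> \<tau> W" using cN WN by (simp add: \<tau>_mult)
  also have "\<tau> (inv x \<otimes> inv W \<otimes> x) = T (\<tau> (inv W))" using T_\<tau>[OF x(1,2), of "inv W"] WN by simp
  also have "\<tau> (inv W) = (- 1) \<odot>\<^bsub>V\<^esub> \<tau> W" using \<tau>_inv[OF WN] Z.smult_neg[of "\<tau> W" 1] WN by simp
  also have "T \<dots> = act (pCons 0 (- cpoly u)) ?a"
    unfolding \<tau>W using a act_smult[OF a, of "- 1" "cpoly u"] by (simp add: act_X)
  also have "\<dots> \<oplus>\<^bsub>V\<^esub> \<tau> W = act (pCons 0 (- cpoly u) + cpoly u) ?a"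
    unfolding \<tau>W using a by (simp add: act_add)
  also have "pCons 0 (- cpoly u) + cpoly u = cpoly ([:1, - 1:] * u)"
    by (simp add: of_int_poly_hom.hom_add of_int_poly_hom.hom_uminus of_int_hom.map_poly_pCons_hom)
  also have "cpoly ([:1, - 1:] * u) = 1 + smult (- 1) (cpoly f)"
    unfolding u by (simp add: of_int_poly_hom.hom_minus)
  also have "act \<dots> ?a = ?a \<oplus>\<^bsub>V\<^esub> (- 1) \<odot>\<^bsub>V\<^esub> act (cpoly f) ?a"
    unfolding act_add[OF a] act_smult[OF a] act_one[OF a] ..
  finally have "(- 1) \<odot>\<^bsub>V\<^esub> act (cpoly f) ?a = \<zero>\<^bsub>V\<^esub>"
    using a act_closed[OF a, of "cpoly f"] by (metis Z.M.add.r_cancel_one' Z.smult_closed' Z.M.a_comm)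
  then have "(- 1) \<odot>\<^bsub>V\<^esub> ((- 1) \<odot>\<^bsub>V\<^esub> act (cpoly f) ?a) = (- 1) \<odot>\<^bsub>V\<^esub> \<zero>\<^bsub>V\<^esub>" by simp
  then show ?thesis
    using Z.smult_assoc'[OF act_closed[OF a, of "cpoly f"], of "- 1" "- 1"] Z.smult_r_null[of "- 1"]
      act_closed[OF a, of "cpoly f"] by simp
qed

lemma functional_act:
  assumes \<xi>: "additive_scaling V \<xi>" and T: "\<And>v. v \<in> carrier V \<Longrightarrow> \<xi> (T v) = z * \<xi> v"
    and v: "v \<in> carrier V"
  shows "\<xi> (act p v) = poly p z * \<xi> v"
proof (induction p)
  case 0
  show ?case using Z.additive_scaling_zero[OF \<xi>] by simp
next
  case (pCons a p)
  have "\<xi> (act (pCons a p) v) = \<xi> (a \<odot>\<^bsub>V\<^esub> v) + \<xi> (T (act p v))"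
    using \<xi> v by (simp add: act_pCons additive_scaling_def T_closed act_closed)
  then show ?case
    using \<xi> v pCons by (simp add: additive_scaling_def T act_closed algebra_simps)
qed

end

text \<open>Lagrange idempotents applied to the \<open>\<tau> (a d)\<close> give the eigenvectors,
  and the given characters give the dual family. Biorthogonality yields independence; spanning
  follows from \<open>N_minimal\<close>, since the \<open>a d\<close> generate the module.\<close>

lemma (in C_group_degree) Alexander_polynomial_diagonal:
  fixes J :: "nat set" and a :: "nat \<Rightarrow> 'a" and f :: "nat \<Rightarrow> int poly" and R :: "nat \<Rightarrow> complex set"
  assumes x: "x \<in> carrier G" "\<nu> x = 1" and J: "finite J"
    and a: "\<And>d. d \<in> J \<Longrightarrow> a d \<in> N" and fin: "\<And>d. d \<in> J \<Longrightarrow> finite (R d)"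
    and split: "\<And>d. d \<in> J \<Longrightarrow> cpoly (f d) = (\<Prod>z\<in>R d. [:- z, 1:])"
    and zero: "\<And>d. d \<in> J \<Longrightarrow> act (cpoly (f d)) (\<tau> (a d)) = \<zero>\<^bsub>V\<^esub>"
    and chars: "\<And>d z. d \<in> J \<Longrightarrow> z \<in> R d \<Longrightarrow> \<exists>\<chi>. character \<chi> \<and>
      (\<forall>g\<in>N. \<chi> (inv x \<otimes> g \<otimes> x) = z * \<chi> g) \<and> (\<forall>d'\<in>J. \<chi> (a d') = (if d' = d then 1 else 0))"
    and gens: "\<And>g. g \<in> gs \<Longrightarrow> inv x \<otimes> g \<in> insert \<one> (a ` J)"
  shows "Alexander_polynomial G C = (\<Prod>d\<in>J. \<Prod>z\<in>R d. [:z, - 1:])"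
proof -
  define dual where "dual d z \<xi> \<longleftrightarrow> additive_scaling V \<xi> \<and> (\<forall>v\<in>carrier V. \<xi> (T v) = z * \<xi> v) \<and>
      (\<forall>d'\<in>J. \<xi> (\<tau> (a d')) = (if d' = d then 1 else 0))" for d z \<xi>
  have "\<exists>\<xi>. dual d z \<xi>" if "d \<in> J" "z \<in> R d" for d z
  proof -
    obtain \<chi> where \<chi>: "character \<chi>" "\<forall>g\<in>N. \<chi> (inv x \<otimes> g \<otimes> x) = z * \<chi> g"
      "\<forall>d'\<in>J. \<chi> (a d') = (if d' = d then 1 else 0)" using chars \<open>d \<in> J\<close> \<open>z \<in> R d\<close> by blast
    obtain \<xi> where \<xi>: "additive_scaling V \<xi>" "\<forall>g\<in>N. \<xi> (\<tau> g) = \<chi> g"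
      using character_extension[OF \<chi>(1)] by blast
    have "\<xi> (T v) = z * \<xi> v" if "v \<in> carrier V" for v
      using that
    proof (induction v rule: spanned_induct)
      case (\<tau> g)
      then show ?case using \<xi>(2) \<chi>(2) x by (simp add: T_\<tau>[OF x] conj_N)
    next
      case (add u w)
      then show ?case using \<xi>(1) by (simp add: additive_scaling_def T_add T_closed distrib_left)
    next
      case (smult y u)
      then show ?case using \<xi>(1) by (simp add: additive_scaling_def T_smult T_closed)
    qed
    then show ?thesis using \<xi> \<chi>(3) a unfolding dual_def by (intro exI[of _ \<xi>]) simp
  qed
  then have dual: "dual d z (SOME \<xi>. dual d z \<xi>)" if "d \<in> J" "z \<in> R d" for d z
    using that by (metis someI_ex)
  define \<xi> where "\<xi> d z = (SOME \<xi>. dual d z \<xi>)" for d z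
  have \<xi>: "\<And>d z. d \<in> J \<Longrightarrow> z \<in> R d \<Longrightarrow> additive_scaling V (\<xi> d z)"
    "\<And>d z v. d \<in> J \<Longrightarrow> z \<in> R d \<Longrightarrow> v \<in> carrier V \<Longrightarrow> \<xi> d z (T v) = z * \<xi> d z v"
    "\<And>d z d'. d \<in> J \<Longrightarrow> z \<in> R d \<Longrightarrow> d' \<in> J \<Longrightarrow> \<xi> d z (\<tau> (a d')) = (if d' = d then 1 else 0)"
    using dual unfolding \<xi>_def dual_def by blast+
  have "\<forall>d\<in>J. \<exists>g. (\<forall>z\<in>R d. cpoly (f d) dvd [:- z, 1:] * g z) \<and>
      (\<forall>z\<in>R d. \<forall>w\<in>R d. poly (g z) w = (if z = w then 1 else 0)) \<and> cpoly (f d) dvd 1 - (\<Sum>z\<in>R d. g z)"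
    using Lagrange_basis split fin by blast
  then obtain g where "\<forall>d\<in>J. (\<forall>z\<in>R d. cpoly (f d) dvd [:- z, 1:] * g d z) \<and>
      (\<forall>z\<in>R d. \<forall>w\<in>R d. poly (g d z) w = (if z = w then 1 else 0)) \<and>
      cpoly (f d) dvd 1 - (\<Sum>z\<in>R d. g d z)"
    by (rule bchoice[THEN exE])
  then have g: "\<And>d z. d \<in> J \<Longrightarrow> z \<in> R d \<Longrightarrow> cpoly (f d) dvd [:- z, 1:] * g d z"
    "\<And>d z w. d \<in> J \<Longrightarrow> z \<in> R d \<Longrightarrow> w \<in> R d \<Longrightarrow> poly (g d z) w = (if z = w then 1 else 0)"
    "\<And>d. d \<in> J \<Longrightarrow> cpoly (f d) dvd 1 - (\<Sum>z\<in>R d. g d z)"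
    by auto
  \<comment> \<open>An eigenvector for \<open>z\<close>, because t - z times \<open>g d z\<close> is
    a multiple of \<open>f d\<close>, which annihilates \<open>\<tau> (a d)\<close>.\<close>
  define v where "v d z = act (g d z) (\<tau> (a d))" for d z
  have \<tau>a: "\<tau> (a d) \<in> carrier V" if "d \<in> J" for d using a[OF that] by simp
  have v: "v d z \<in> carrier V" if "d \<in> J" for d z unfolding v_def using \<tau>a[OF that] by (rule act_closed)
  have Tv: "T (v d z) = z \<odot>\<^bsub>V\<^esub> v d z" if dz: "d \<in> J" "z \<in> R d" for d z
  proof -
    have "T (v d z) = act (pCons 0 (g d z)) (\<tau> (a d))"
      unfolding v_def using \<tau>a[OF dz(1)] by (simp add: act_X)
    also have "pCons 0 (g d z) = [:- z, 1:] * g d z + smult z (g d z)" by simp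
    also have "act \<dots> (\<tau> (a d)) = act ([:- z, 1:] * g d z) (\<tau> (a d)) \<oplus>\<^bsub>V\<^esub> z \<odot>\<^bsub>V\<^esub> v d z"
      unfolding v_def by (simp only: act_add[OF \<tau>a[OF dz(1)]] act_smult[OF \<tau>a[OF dz(1)]])
    also have "act ([:- z, 1:] * g d z) (\<tau> (a d)) = \<zero>\<^bsub>V\<^esub>"
      using act_multiple_zero[OF \<tau>a[OF dz(1)] zero[OF dz(1)] g(1)[OF dz]] .
    finally show ?thesis using v[OF dz(1)] by simp
  qed
  have \<xi>v: "\<xi> d z (v d' z') = (if (d, z) = (d', z') then 1 else 0)"
    if dz: "d \<in> J" "z \<in> R d" "d' \<in> J" "z' \<in> R d'" for d z d' z'
  proof -
    have "\<xi> d z (v d' z') = poly (g d' z') z * \<xi> d z (\<tau> (a d'))"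
      unfolding v_def using \<xi>(2)[OF dz(1,2)]
      by (rule functional_act[OF \<xi>(1)[OF dz(1,2)] _ \<tau>a[OF dz(3)]])
    then show ?thesis using \<xi>(3)[OF dz(1-3)] g(2)[of d' z' z] dz by auto
  qed
  \<comment> \<open>Bases are lists, so the pairs of an index and a root are enumerated; the same
    root may occur with several indices.\<close>
  obtain ix where ix: "distinct ix" "set ix = Sigma J R"
    using finite_distinct_list[of "Sigma J R"] J fin by auto
  let ?n = "length ix"
  have mem: "fst (ix ! i) \<in> J" "snd (ix ! i) \<in> R (fst (ix ! i))" if "i < ?n" for i
    using nth_mem[OF that] ix(2) by auto
  define b where "b i = v (fst (ix ! i)) (snd (ix ! i))" for i
  define \<phi> where "\<phi> w i = \<xi> (fst (ix ! i)) (snd (ix ! i)) w" for w i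
  have b: "b i \<in> carrier V" if "i < ?n" for i unfolding b_def using v mem[OF that] by blast
  have \<phi>: "additive_scaling V (\<lambda>w. \<phi> w i)" if "i < ?n" for i
    unfolding \<phi>_def using \<xi>(1) mem[OF that] by blast
  have \<phi>b: "\<phi> (b j) i = (if i = j then 1 else 0)" if ij: "i < ?n" "j < ?n" for i j
    unfolding \<phi>_def b_def using \<xi>v[of "fst (ix ! i)" "snd (ix ! i)" "fst (ix ! j)" "snd (ix ! j)"]
      mem[OF ij(1)] mem[OF ij(2)] nth_eq_iff_index_eq[OF ix(1) ij] by (simp add: prod_eq_iff)
  \<comment> \<open>The projection onto the span of the eigenvectors. It is linear and commutes with
    \<open>T\<close>, so it is the identity as soon as it fixes the module generators
    \<open>\<tau> (a d)\<close>.\<close>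
  define comb where "comb w = (\<Oplus>\<^bsub>V\<^esub>i\<in>{..<?n}. \<phi> w i \<odot>\<^bsub>V\<^esub> b i)" for w
  have comb: "comb w \<in> carrier V" for w unfolding comb_def using b by (intro Z.M.finsum_closed) auto
  have comb_add: "comb (u \<oplus>\<^bsub>V\<^esub> w) = comb u \<oplus>\<^bsub>V\<^esub> comb w" if uw: "u \<in> carrier V" "w \<in> carrier V" for u w
  proof -
    have "comb (u \<oplus>\<^bsub>V\<^esub> w) = (\<Oplus>\<^bsub>V\<^esub>i\<in>{..<?n}. \<phi> u i \<odot>\<^bsub>V\<^esub> b i \<oplus>\<^bsub>V\<^esub> \<phi> w i \<odot>\<^bsub>V\<^esub> b i)"
      unfolding comb_def using b uw \<phi>
      by (intro Z.M.finsum_cong') (auto simp: additive_scaling_def Z.smult_add_left)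
    also have "\<dots> = comb u \<oplus>\<^bsub>V\<^esub> comb w" unfolding comb_def using b by (intro Z.M.finsum_addf) auto
    finally show ?thesis .
  qed
  have comb_smult: "comb (y \<odot>\<^bsub>V\<^esub> w) = y \<odot>\<^bsub>V\<^esub> comb w" if w: "w \<in> carrier V" for y w
  proof -
    have "comb (y \<odot>\<^bsub>V\<^esub> w) = (\<Oplus>\<^bsub>V\<^esub>i\<in>{..<?n}. y \<odot>\<^bsub>V\<^esub> (\<phi> w i \<odot>\<^bsub>V\<^esub> b i))"
      unfolding comb_def using b w \<phi>
      by (intro Z.M.finsum_cong') (auto simp: additive_scaling_def Z.smult_assoc')
    also have "\<dots> = y \<odot>\<^bsub>V\<^esub> comb w"
      unfolding comb_def using b Z.finsum_smult[of y "\<lambda>i. \<phi> w i \<odot>\<^bsub>V\<^esub> b i" "{..<?n}"] by auto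
    finally show ?thesis .
  qed
  have comb_b: "comb (b j) = b j" if j: "j < ?n" for j
  proof -
    have "comb (b j) = (\<Oplus>\<^bsub>V\<^esub>i\<in>{..<?n}. if j = i then b i else \<zero>\<^bsub>V\<^esub>)"
      unfolding comb_def using b \<phi>b j by (intro Z.M.finsum_cong') auto
    also have "\<dots> = b j" using j b Z.M.finsum_singleton[of j "{..<?n}" b] by auto
    finally show ?thesis .
  qed
  have comb_T: "comb (T w) = T (comb w)" if w: "w \<in> carrier V" for w
  proof -
    have "T (comb w) = (\<Oplus>\<^bsub>V\<^esub>i\<in>{..<?n}. \<phi> w i \<odot>\<^bsub>V\<^esub> T (b i))"
      unfolding comb_def using b by (intro Z.linear_endo_comb[OF T_linear]) auto
    also have "\<dots> = comb (T w)"
      unfolding comb_def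
    proof (intro Z.M.finsum_cong' refl)
      fix i assume "i \<in> {..<?n}"
      then have i: "i < ?n" by simp
      have "\<phi> w i \<odot>\<^bsub>V\<^esub> T (b i) = \<phi> w i \<odot>\<^bsub>V\<^esub> (snd (ix ! i) \<odot>\<^bsub>V\<^esub> b i)"
        unfolding b_def using Tv mem[OF i] by simp
      also have "\<dots> = (snd (ix ! i) * \<phi> w i) \<odot>\<^bsub>V\<^esub> b i"
        using Z.smult_assoc'[OF b[OF i]] by (simp add: mult.commute)
      also have "snd (ix ! i) * \<phi> w i = \<phi> (T w) i"
        unfolding \<phi>_def using \<xi>(2)[OF mem[OF i] w] by simp
      finally show "\<phi> w i \<odot>\<^bsub>V\<^esub> T (b i) = \<phi> (T w) i \<odot>\<^bsub>V\<^esub> b i" .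
    qed (use b in auto)
    finally show ?thesis by simp
  qed
  have comb_act: "comb (act p w) = act p w" if w: "w \<in> carrier V" "comb w = w" for p w
  proof (induction p)
    case 0
    show ?case using comb_smult[OF w(1), of 0] w comb[of w] by simp
  next
    case (pCons k p)
    then show ?case
      using w by (simp add: act_pCons comb_add comb_smult comb_T act_closed T_closed)
  qed
  have comb_v: "comb (v d z) = v d z" if "d \<in> J" "z \<in> R d" for d z
  proof -
    have "(d, z) \<in> set ix" using that ix(2) by simp
    then obtain i where "i < ?n" "ix ! i = (d, z)" by (metis in_set_conv_nth)
    then show ?thesis using comb_b[of i] by (simp add: b_def)
  qed
  have comb_a: "comb (\<tau> (a d)) = \<tau> (a d)" if d: "d \<in> J" for d
  proof -
    have sum_act: "comb (act (\<Sum>z\<in>Q. g d z) (\<tau> (a d))) = act (\<Sum>z\<in>Q. g d z) (\<tau> (a d))"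
      if "finite Q" "Q \<subseteq> R d" for Q
      using that
    proof (induction Q rule: finite_induct)
      case empty
      show ?case using comb_smult[OF \<tau>a[OF d], of 0] comb \<tau>a[OF d] by simp
    next
      case (insert z Q)
      then show ?case
        using comb_v[OF d, of z] \<tau>a[OF d]
        by (simp add: act_add comb_add act_closed v_def)
    qed
    \<comment> \<open>The idempotents add up to 1 modulo \<open>f d\<close>, so
      \<open>\<tau> (a d)\<close> is the sum of the eigenvectors \<open>v d z\<close>.\<close>
    have "act 1 (\<tau> (a d)) = act ((1 - (\<Sum>z\<in>R d. g d z)) + (\<Sum>z\<in>R d. g d z)) (\<tau> (a d))" by simp
    also have "\<dots> = act (1 - (\<Sum>z\<in>R d. g d z)) (\<tau> (a d)) \<oplus>\<^bsub>V\<^esub> act (\<Sum>z\<in>R d. g d z) (\<tau> (a d))"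
      by (rule act_add[OF \<tau>a[OF d]])
    also have "act (1 - (\<Sum>z\<in>R d. g d z)) (\<tau> (a d)) = \<zero>\<^bsub>V\<^esub>"
      using act_multiple_zero[OF \<tau>a[OF d] zero[OF d] g(3)[OF d]] .
    finally have "\<tau> (a d) = act (\<Sum>z\<in>R d. g d z) (\<tau> (a d))"
      using \<tau>a[OF d] by (simp add: act_one act_closed)
    then show ?thesis using sum_act[OF fin[OF d] subset_refl] by simp
  qed
  define U where "U = {g \<in> N. comb (\<tau> g) = \<tau> g}"
  have c0: "comb \<zero>\<^bsub>V\<^esub> = \<zero>\<^bsub>V\<^esub>"
    using comb_smult[of "\<zero>\<^bsub>V\<^esub>" 0] comb by simp
  have cneg: "comb (\<ominus>\<^bsub>V\<^esub> w) = \<ominus>\<^bsub>V\<^esub> comb w" if "w \<in> carrier V" for w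
    using comb_smult[OF that, of "- 1"] Z.smult_neg[OF that, of 1] Z.smult_neg[OF comb[of w], of 1] that comb
    by simp
  have "\<one> \<in> U" using c0 by (simp add: U_def \<tau>_one)
  have "subgroup U G"
  proof (rule subgroupI)
    show "U \<noteq> {}" using \<open>\<one> \<in> U\<close> by blast
  qed (auto simp: U_def \<tau>_inv \<tau>_mult cneg comb_add)
  moreover have "D \<subseteq> U" using D_sub_N \<tau>_D c0 by (auto simp: U_def)
  moreover have "inv x \<otimes> u \<otimes> x \<in> U" if "u \<in> U" for u
    using that comb_T[of "\<tau> u"] x by (auto simp: U_def conj_N T_\<tau>[OF x])
  moreover have "inv x \<otimes> g \<in> U" if "g \<in> gs" for g
    using gens[OF that] \<open>\<one> \<in> U\<close> comb_a a by (auto simp: U_def)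
  ultimately have NU: "N \<subseteq> U" by (intro N_minimal[OF x]) (auto simp: U_def)
  have rep: "w = comb w" if "w \<in> carrier V" for w
    using that
  proof (induction w rule: spanned_induct)
    case (\<tau> g)
    then show ?case using NU by (auto simp: U_def)
  qed (simp_all add: comb_add comb_smult)
  define bs where "bs = map b [0..<?n]"
  have bs: "length bs = ?n" "\<And>i. i < ?n \<Longrightarrow> bs ! i = b i" by (simp_all add: bs_def)
  have "(\<Oplus>\<^bsub>V\<^esub>i\<in>{..<?n}. \<phi> w i \<odot>\<^bsub>V\<^esub> bs ! i) = comb w" for w
    unfolding comb_def using b bs by (intro Z.M.finsum_cong') auto
  then have "Z.coordinates bs \<phi>"
    unfolding Z.coordinates_def bs(1)
    using b \<phi> \<phi>b rep bs(2) by (auto simp: bs_def)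
  then have "endo_polynomial V T = (\<Prod>i<?n. [:snd (ix ! i), - 1:])"
    using Z.endo_polynomial_eigenbasis(2)[OF T_linear, of bs \<phi> "\<lambda>i. snd (ix ! i)"] Tv mem bs
    by (simp add: b_def)
  also have "\<dots> = (\<Prod>(d, z)\<in>Sigma J R. [:z, - 1:])"
    using prod.reindex_bij_betw[OF bij_betw_nth[OF ix(1) refl ix(2)[symmetric]], of "\<lambda>(d, z). [:z, - 1:]"]
    by (simp add: case_prod_beta)
  also have "\<dots> = (\<Prod>d\<in>J. \<Prod>z\<in>R d. [:z, - 1:])"
    using J fin by (intro prod.Sigma[symmetric]) auto
  finally show ?thesis by (simp add: Alexander_polynomial_eq)
qed

section \<open>Realization\<close>

text \<open>Generators come in \<open>length fs + 1\<close> consecutive blocks of \<open>n\<close>. All generators are conjugate to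
  the first one by words that force the generators of a block to coincide; in the Alexander module,
  the difference of a generator in block \<open>d \<ge> 1\<close> and the first generator is annihilated by the
  \<open>d\<close>-th polynomial.\<close>

locale block_presentation =
  fixes fs :: "int poly list" and n :: nat
  assumes n: "n \<ge> 1"
    and fs: "\<And>f. f \<in> set fs \<Longrightarrow> poly f 1 = 1"
    and split: "\<And>f. f \<in> set fs \<Longrightarrow> cpoly f = (\<Prod>z | poly (cpoly f) z = 0. [:- z, 1:])"
    and unity: "\<And>f z. f \<in> set fs \<Longrightarrow> poly (cpoly f) z = 0 \<Longrightarrow> z ^ n = 1"
begin

definition m :: nat where "m = Suc (length fs) * n"

text \<open>Generators are numbered from 1, blocks from 0. Block 0 holds the copies of the base
  generator and carries no polynomial, so block \<open>d\<close> belongs to entry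
  \<open>d - 1\<close> of \<open>fs\<close>.\<close>

definition blk :: "nat \<Rightarrow> nat" where "blk i = (i - 1) div n"

definition rep :: "nat \<Rightarrow> nat" where "rep d = d * n + 1"

definition fac :: "nat \<Rightarrow> int poly" where "fac d = fs ! (d - 1)"

definition cof :: "nat \<Rightarrow> int poly" where "cof d = (SOME u. [:1, - 1:] * u = 1 - fac d)"

text \<open>It depends on the block only and is built from the first generator of the block, so that
  all generators of a block become the same conjugate.\<close>

definition W :: "nat \<Rightarrow> nat word set" where
  "W d = (if d = 0 then \<one>\<^bsub>FG m\<^esub> else conj_word (FG m) (fgen m 1) (fgen m (rep d)) (cof d))"

definition prd :: "nat word set" where
  "prd = foldr (\<lambda>j p. fgen m j \<otimes>\<^bsub>FG m\<^esub> p) [1..<Suc m] \<one>\<^bsub>FG m\<^esub>"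

text \<open>The pairs (i, i) carry the Hurwitz relations, the pairs (i, 1) the conjugations. They
  meet only at (1, 1), where the conjugation relation would be trivial because \<open>W 0\<close> is
  the identity.\<close>

definition l :: "nat \<Rightarrow> nat \<Rightarrow> nat" where "l i j = (if i = j \<or> j = 1 then 1 else 0)"

definition w :: "nat \<Rightarrow> nat \<Rightarrow> nat \<Rightarrow> nat word set" where
  "w i j k = (if i = j then prd else W (blk i))"

lemma m_pos: "m \<ge> 1"
  using n by (simp add: m_def)

lemma one_in: "1 \<in> {1..m}"
  using m_pos by simp

lemma blk_le: "i \<in> {1..m} \<Longrightarrow> blk i \<le> length fs"
proof -
  assume i: "i \<in> {1..m}"
  then have "i - 1 < Suc (length fs) * n" by (auto simp: m_def)
  then have "blk i < Suc (length fs)" unfolding blk_def by (rule less_mult_imp_div_less)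
  then show ?thesis by simp
qed

lemma rep_in: "d \<le> length fs \<Longrightarrow> rep d \<in> {1..m}"
proof -
  assume "d \<le> length fs"
  then have "d * n \<le> length fs * n" by (rule mult_le_mono1)
  then have "d * n + 1 \<le> Suc (length fs) * n" using n unfolding mult_Suc by linarith
  then show ?thesis unfolding rep_def m_def by (metis atLeastAtMost_iff le_add2)
qed

lemma blk_rep: "blk (rep d) = d"
  using n by (simp add: blk_def rep_def)

lemma blk_1: "blk 1 = 0"
  by (simp add: blk_def)

lemma fac_in: "1 \<le> d \<Longrightarrow> d \<le> length fs \<Longrightarrow> fac d \<in> set fs"
  unfolding fac_def by (intro nth_mem) auto

lemma cof: "1 \<le> d \<Longrightarrow> d \<le> length fs \<Longrightarrow> [:1, - 1:] * cof d = 1 - fac d"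
proof -
  assume d: "1 \<le> d" "d \<le> length fs"
  have "poly (1 - fac d) 1 = 0" using fs[OF fac_in[OF d]] by simp
  then have "[:- 1, 1:] dvd 1 - fac d" by (rule iffD1[OF poly_eq_0_iff_dvd])
  then obtain k where "1 - fac d = [:- 1, 1:] * k" by (auto simp: dvd_def)
  then have "[:1, - 1:] * (- k) = 1 - fac d" by simp
  then show ?thesis unfolding cof_def by (rule someI)
qed

lemma prd_closed: "prd \<in> carrier (FG m)"
proof -
  interpret group "FG m" by (rule group_free_group)
  have "foldr (\<lambda>j p. fgen m j \<otimes>\<^bsub>FG m\<^esub> p) js \<one>\<^bsub>FG m\<^esub> \<in> carrier (FG m)" if "set js \<subseteq> {1..m}" for js
    using that by (induction js) (auto intro!: m_closed free_gen_carrier)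
  moreover have "set [1..<Suc m] \<subseteq> {1..m}" by auto
  ultimately show ?thesis unfolding prd_def by blast
qed

lemma W_closed: "d \<le> length fs \<Longrightarrow> W d \<in> carrier (FG m)"
proof -
  interpret group "FG m" by (rule group_free_group)
  assume "d \<le> length fs"
  then show ?thesis
    unfolding W_def using conj_word_closed[OF free_gen_carrier[OF one_in] free_gen_carrier[OF rep_in]] by simp
qed

sublocale C_presented m l w
proof
  show "C_presentation m l w"
    unfolding C_presentation_def
  proof (intro conjI ballI m_pos)
    fix i j k assume "i \<in> {1..m}"
    then show "w i j k \<in> carrier (FG m)"
      unfolding w_def using prd_closed W_closed[OF blk_le] by simp
  qed
qed

lemma Hurwitz: "Hurwitz_C_presentation m l w"
  unfolding Hurwitz_C_presentation_def using pres by (auto simp: l_def w_def prd_def)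

section \<open>The group of the block presentation\<close>

abbreviation xg :: "nat \<Rightarrow> nat word set set" where "xg i \<equiv> q (fgen m i)"

lemma xg_closed: "i \<in> {1..m} \<Longrightarrow> xg i \<in> carrier PG"
  using fgen_carrier by simp

lemma qW: "d \<le> length fs \<Longrightarrow> q (W d) = (if d = 0 then \<one>\<^bsub>PG\<^esub> else conj_word PG (xg 1) (xg (rep d)) (cof d))"
  unfolding W_def
  using Q.hom_conj_word[OF fgen_carrier[OF one_in] fgen_carrier[OF rep_in]] by simp

lemma xg_relation: "i \<in> {1..m} \<Longrightarrow> xg i = inv\<^bsub>PG\<^esub> q (W (blk i)) \<otimes>\<^bsub>PG\<^esub> xg 1 \<otimes>\<^bsub>PG\<^esub> q (W (blk i))"
proof (cases "i = 1")
  case True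
  then show ?thesis using qW[of 0] xg_closed[OF one_in] by (simp add: blk_1)
next
  case False
  assume i: "i \<in> {1..m}"
  have "1 \<in> {1..l i 1}" by (simp add: l_def)
  from relation[OF i one_in this] show ?thesis using False by (simp add: w_def)
qed

lemma xg_block: "i \<in> {1..m} \<Longrightarrow> xg i = xg (rep (blk i))"
  using xg_relation[of i] xg_relation[OF rep_in[OF blk_le, of i]] by (simp add: blk_rep)

text \<open>Block \<open>d\<close> acts by u |-> z u + 1, every other generator by u |-> z u.
  Conjugating the latter by the translation by b adds (1 - z) b, so the relation for block
  \<open>d\<close> asks for (1 - z) \<open>cof d\<close>(z) = 1, which is the defining equation of
  \<open>cof d\<close> at a root of \<open>fac d\<close>.\<close>

lemma affine_representation:
  assumes d: "1 \<le> d" "d \<le> length fs" and z: "poly (cpoly (fac d)) z = 0"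
  shows "\<exists>\<Psi>\<in>hom PG (affine_group z). \<forall>i\<in>{1..m}. \<Psi> (xg i) = (1, if blk i = d then 1 else 0)"
proof -
  have zn: "z ^ n = 1" using unity[OF fac_in[OF d] z] .
  then have z0: "z \<noteq> 0" using n by (auto simp: power_0_left)
  \<comment> \<open>The geometric sum in \<open>unity_block_sum\<close> requires z to differ from 1,
    which is ensured by the value 1 of \<open>fac d\<close> at 1.\<close>
  have "poly (cpoly (fac d)) 1 = of_int (poly (fac d) 1)" by (induction "fac d") (auto simp: map_poly_pCons)
  then have z1: "z \<noteq> 1" using z fs[OF fac_in[OF d]] by auto
  let ?H = "affine_group z"
  interpret H: group ?H by (rule group_affine_group[OF z0])
  define b :: "nat \<Rightarrow> complex" where "b i = (if blk i = d then 1 else 0)" for i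
  obtain \<Phi> where \<Phi>: "\<Phi> \<in> hom (FG m) ?H" "\<forall>i\<in>{1..m}. \<Phi> (fgen m i) = (1, b i)"
    using free_group_universal[OF H.is_group, of "{1..m}" "\<lambda>i. (1, b i)"] by auto
  interpret \<Phi>: group_hom "FG m" ?H \<Phi> by unfold_locales (rule \<Phi>(1))
  have foldr_eq: "foldr (\<lambda>j p. fgen m j \<otimes>\<^bsub>FG m\<^esub> p) js \<one>\<^bsub>FG m\<^esub> \<in> carrier (FG m) \<and>
      \<Phi> (foldr (\<lambda>j p. fgen m j \<otimes>\<^bsub>FG m\<^esub> p) js \<one>\<^bsub>FG m\<^esub>)
      = foldr (\<lambda>j p. (1, b j) \<otimes>\<^bsub>?H\<^esub> p) js \<one>\<^bsub>?H\<^esub>" if "set js \<subseteq> {1..m}" for js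
    using that
  proof (induction js)
    case (Cons j js)
    let ?p = "foldr (\<lambda>j p. fgen m j \<otimes>\<^bsub>FG m\<^esub> p) js \<one>\<^bsub>FG m\<^esub>"
    have j: "j \<in> {1..m}" and p: "?p \<in> carrier (FG m)"
      "\<Phi> ?p = foldr (\<lambda>j p. (1, b j) \<otimes>\<^bsub>?H\<^esub> p) js \<one>\<^bsub>?H\<^esub>" using Cons by auto
    have "\<Phi> (fgen m j \<otimes>\<^bsub>FG m\<^esub> ?p) = (1, b j) \<otimes>\<^bsub>?H\<^esub> \<Phi> ?p"
      using \<Phi>.hom_mult[OF fgen_carrier[OF j] p(1)] \<Phi>(2) j by simp
    then show ?case using p fgen_carrier[OF j] by simp
  qed simp
  have "\<Phi> prd = (int m, \<Sum>t<m. z ^ (m - Suc t) * b (t + 1))"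
  proof -
    have js: "set [1..<Suc m] \<subseteq> {1..m}" "length [1..<Suc m] = m" by auto
    have "\<Phi> prd = (int m, \<Sum>t<m. z ^ (m - Suc t) * b ([1..<Suc m] ! t))"
      unfolding prd_def using foldr_eq[OF js(1)] foldr_affine_group[where b = b and z = z and js = "[1..<Suc m]"] js(2) by metis
    also have "(\<Sum>t<m. z ^ (m - Suc t) * b ([1..<Suc m] ! t)) = (\<Sum>t<m. z ^ (m - Suc t) * b (t + 1))"
      by (intro sum.cong refl) (simp add: nth_upt add.commute del: upt_Suc)
    finally show ?thesis .
  qed
  also have "(\<Sum>t<m. z ^ (m - Suc t) * b (t + 1)) = 0"
    using unity_block_sum[OF zn z1, of "Suc (length fs)" "\<lambda>c. if c = d then 1 else 0"]
    by (simp add: m_def b_def blk_def)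
  finally have \<Phi>prd: "\<Phi> prd = (int m, 0)" .
  \<comment> \<open>This makes (m, 0), the image of the product of all generators, central.\<close>
  have zm: "z ^ m = 1" using zn unfolding m_def mult.commute[of _ n] power_mult by simp
  have "\<exists>\<Psi>\<in>hom PG ?H. \<forall>g\<in>carrier (FG m). \<Psi> (q g) = \<Phi> g"
  proof (rule universal[OF H.is_group \<Phi>(1)])
    fix i j k assume ij: "i \<in> {1..m}" "j \<in> {1..m}" "k \<in> {1..l i j}"
    show "\<Phi> (fgen m i) = inv\<^bsub>?H\<^esub> \<Phi> (w i j k) \<otimes>\<^bsub>?H\<^esub> \<Phi> (fgen m j) \<otimes>\<^bsub>?H\<^esub> \<Phi> (w i j k)"
    proof (cases "i = j")
      case True
      then show ?thesis
        using \<Phi>(2) ij zm by (simp add: w_def \<Phi>prd inv_affine_group[OF z0])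
    next
      case False
      then have j: "j = 1" using ij(3) by (auto simp: l_def split: if_splits)
      have b1: "b 1 = 0" using d by (simp add: b_def blk_1)
      let ?u = "poly (cpoly (cof (blk i))) z * b i"
      have \<Phi>W: "\<Phi> (w i j k) = (0, if blk i = 0 then 0 else ?u)"
      proof (cases "blk i = 0")
        case True
        then show ?thesis using False by (simp add: w_def W_def)
      next
        case nz: False
        have "\<Phi> (W (blk i)) = conj_word ?H (\<Phi> (fgen m 1)) (\<Phi> (fgen m (rep (blk i)))) (cof (blk i))"
          unfolding W_def using nz \<Phi>.hom_conj_word[OF fgen_carrier[OF one_in] fgen_carrier[OF rep_in[OF blk_le[OF ij(1)]]]]
          by simp
        also have "\<Phi> (fgen m 1) = (1, 0)" using \<Phi>(2) one_in b1 by simp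
        also have "\<Phi> (fgen m (rep (blk i))) = (1, b i)"
          using \<Phi>(2) rep_in[OF blk_le[OF ij(1)]] by (simp add: b_def blk_rep)
        finally show ?thesis using False nz by (simp add: w_def conj_word_affine_group[OF z0])
      qed
      have "(1 - z) * ?u = b i" if nz: "blk i \<noteq> 0"
      proof (cases "blk i = d")
        case True
        have "poly (cpoly ([:1, - 1:] * cof d)) z = poly (cpoly (1 - fac d)) z" using cof[OF d] by simp
        then have "(1 - z) * poly (cpoly (cof d)) z = 1"
          using z by (simp add: cpoly_mult of_int_poly_hom.hom_minus of_int_hom.map_poly_pCons_hom
              del: mult_pCons_left)
        then show ?thesis using True by (simp add: b_def)
      qed (simp add: b_def)
      moreover have "b i = 0" if "blk i = 0" using that d by (simp add: b_def)
      ultimately show ?thesis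
        using \<Phi>(2) ij(1) one_in b1 unfolding \<Phi>W
        by (auto simp: j inv_affine_group[OF z0] algebra_simps)
    qed
  qed
  then obtain \<Psi> where "\<Psi> \<in> hom PG ?H" "\<forall>g\<in>carrier (FG m). \<Psi> (q g) = \<Phi> g" by blast
  then show ?thesis using \<Phi>(2) fgen_carrier unfolding b_def by (intro bexI[of _ \<Psi>]) auto
qed

definition CG :: "nat word set set set" where "CG = presented_C_generators m l w"

lemma C_group_degree_PG: "\<exists>\<nu> c. C_group_degree PG CG (xg ` {1..m}) \<nu> c m"
proof -
  have "(\<lambda>g. g) \<in> iso PG PG" by (auto simp: iso_def hom_def bij_betw_def)
  from C_group_degree_iso[OF Hurwitz PG.is_group this] show ?thesis by (simp add: CG_def)
qed

lemma Hurwitz_C_group_PG: "Hurwitz_C_group PG CG"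
proof -
  have "(\<lambda>g. g) \<in> iso PG PG" by (auto simp: iso_def hom_def bij_betw_def)
  then have "has_C_presentation PG CG m l w"
    unfolding has_C_presentation_def CG_def using pres PG.is_group by force
  then show ?thesis unfolding Hurwitz_C_group_def using Hurwitz by blast
qed

text \<open>Every generator is a conjugate of the first, so the quotients of generators that
  generate N in \<open>N_minimal\<close> are commutators and N = G'. The degree map then induces
  G/G' = Z.\<close>

lemma irreducible_PG: "irreducible_C_group PG"
proof -
  obtain \<nu> c where "C_group_degree PG CG (xg ` {1..m}) \<nu> c m" using C_group_degree_PG by blast
  then interpret C_group_degree PG CG "xg ` {1..m}" \<nu> c m .
  let ?D = "derived PG (carrier PG)"
  interpret DD: normal ?D PG by (rule PG.derived_self_is_normal)
  have x1: "xg 1 \<in> carrier PG" "\<nu> (xg 1) = 1"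
    using xg_closed[OF one_in] \<nu>_C[of "xg 1"] gs_sub one_in by blast+
  have "derived_set PG (carrier PG) \<subseteq> N" by (auto simp: \<nu>_mult intro!: N_I)
  then have DN: "?D \<subseteq> N" unfolding derived_def by (intro PG.generate_subgroup_incl N.is_subgroup)
  have "inv\<^bsub>PG\<^esub> xg 1 \<otimes>\<^bsub>PG\<^esub> g \<in> ?D" if g: "g \<in> xg ` {1..m}" for g
  proof -
    obtain i where i: "i \<in> {1..m}" "g = xg i" using g by blast
    define V where "V = q (W (blk i))"
    have V: "V \<in> carrier PG" unfolding V_def using W_closed[OF blk_le[OF i(1)]] by simp
    have "inv\<^bsub>PG\<^esub> xg 1 \<otimes>\<^bsub>PG\<^esub> g = inv\<^bsub>PG\<^esub> xg 1 \<otimes>\<^bsub>PG\<^esub> inv\<^bsub>PG\<^esub> V \<otimes>\<^bsub>PG\<^esub>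
        inv\<^bsub>PG\<^esub> (inv\<^bsub>PG\<^esub> xg 1) \<otimes>\<^bsub>PG\<^esub> inv\<^bsub>PG\<^esub> (inv\<^bsub>PG\<^esub> V)"
      unfolding i(2) by (subst xg_relation[OF i(1)]) (use x1 V in \<open>simp add: V_def[symmetric] PG.m_assoc\<close>)
    also have "\<dots> \<in> derived_set PG (carrier PG)" using x1 V PG.inv_closed by blast
    finally show ?thesis unfolding derived_def by (rule generate.incl)
  qed
  moreover have "D \<subseteq> ?D" unfolding D_def using PG.mono_derived N.subset by blast
  ultimately have "N \<subseteq> ?D"
    using N_minimal[OF x1 DD.is_subgroup DN] DD.inv_op_closed1 x1 by blast
  then have "?D = kernel PG integer_group \<nu>" using DN N_eq kernel_eq by auto
  moreover have "\<nu> ` carrier PG = carrier integer_group"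
  proof -
    have "\<nu> (xg 1 [^]\<^bsub>PG\<^esub> k) = k" for k :: int using x1 \<nu>.hom_int_pow[of "xg 1" k] by simp
    then have "k \<in> \<nu> ` carrier PG" for k using x1(1) PG.int_pow_closed by (metis imageI)
    then show ?thesis by auto
  qed
  ultimately show ?thesis
    unfolding irreducible_C_group_def using \<nu>.FactGroup_iso by simp
qed

lemma Alexander_polynomial_PG:
  "Alexander_polynomial PG CG = (\<Prod>d\<in>{1..length fs}. \<Prod>z | poly (cpoly (fac d)) z = 0. [:z, - 1:])"
proof -
  obtain \<nu> c where "C_group_degree PG CG (xg ` {1..m}) \<nu> c m" using C_group_degree_PG by blast
  then interpret C_group_degree PG CG "xg ` {1..m}" \<nu> c m .
  have x: "xg i \<in> carrier PG" "\<nu> (xg i) = 1" if "i \<in> {1..m}" for i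
    using xg_closed[OF that] \<nu>_C[of "xg i"] gs_sub that by blast+
  note x1 = x[OF one_in]
  define a where "a d = inv\<^bsub>PG\<^esub> xg 1 \<otimes>\<^bsub>PG\<^esub> xg (rep d)" for d
  have aN: "a d \<in> N" if "d \<le> length fs" for d
    unfolding a_def using x1 x[OF rep_in[OF that]] by (intro N_I) (auto simp: \<nu>_mult)
  show ?thesis
  proof (rule Alexander_polynomial_diagonal[OF x1, where a = a and f = fac])
    fix d assume "d \<in> {1..length fs}"
    then have d: "1 \<le> d" "d \<le> length fs" by auto
    show "a d \<in> N" by (rule aN[OF d(2)])
    show "cpoly (fac d) = (\<Prod>z | poly (cpoly (fac d)) z = 0. [:- z, 1:])" by (rule split[OF fac_in[OF d]])
    have "fac d \<noteq> 0" using fs[OF fac_in[OF d]] by auto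
    then show "finite {z. poly (cpoly (fac d)) z = 0}" by (intro poly_roots_finite) simp
    have "xg (rep d) = inv\<^bsub>PG\<^esub> q (W d) \<otimes>\<^bsub>PG\<^esub> xg 1 \<otimes>\<^bsub>PG\<^esub> q (W d)"
      using xg_relation[OF rep_in[OF d(2)]] by (simp add: blk_rep)
    moreover have "q (W d) = conj_word PG (xg 1) (xg (rep d)) (cof d)" using qW[OF d(2)] d(1) by simp
    ultimately show "act (cpoly (fac d)) (\<tau> (a d)) = \<zero>\<^bsub>complexification (Alexander_group PG CG)\<^esub>"
      unfolding a_def using act_relation[OF x1 x[OF rep_in[OF d(2)]] _ _ cof[OF d]] by blast
  next
    fix d z assume "d \<in> {1..length fs}" "z \<in> {z. poly (cpoly (fac d)) z = 0}"
    then have d: "1 \<le> d" "d \<le> length fs" and z: "poly (cpoly (fac d)) z = 0" by auto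
    have z0: "z \<noteq> 0" using unity[OF fac_in[OF d] z] n by (auto simp: power_0_left)
    obtain \<Psi> where \<Psi>: "\<Psi> \<in> hom PG (affine_group z)"
      "\<forall>i\<in>{1..m}. \<Psi> (xg i) = (1, if blk i = d then 1 else 0)"
      using affine_representation[OF d z] by blast
    interpret H: group "affine_group z" by (rule group_affine_group[OF z0])
    interpret \<Psi>: group_hom PG "affine_group z" \<Psi> by unfold_locales (rule \<Psi>(1))
    have fst_mult: "fst (p \<otimes>\<^bsub>affine_group z\<^esub> r) = fst p + fst r" for p r
      by (cases p, cases r) simp
    have fst_inv: "fst (inv\<^bsub>affine_group z\<^esub> p) = - fst p" for p
      by (cases p) (simp add: inv_affine_group[OF z0])
    \<comment> \<open>On the generators, hence everywhere, the exponent component of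
      \<open>\<Psi>\<close> is the degree; so \<open>\<Psi>\<close> maps N to translations, and the
      translation part is a character.\<close>
    define U where "U = {g \<in> carrier PG. fst (\<Psi> g) = \<nu> g}"
    have "subgroup U PG"
    proof (rule PG.subgroupI)
      have "\<one>\<^bsub>PG\<^esub> \<in> U" by (simp add: U_def)
      then show "U \<noteq> {}" by blast
    qed (auto simp: U_def \<nu>_mult fst_mult fst_inv)
    moreover have "xg ` {1..m} \<subseteq> U" using \<Psi>(2) x by (auto simp: U_def)
    ultimately have "carrier PG \<subseteq> U" unfolding generated by (intro PG.generate_subgroup_incl)
    then have \<Psi>N: "\<Psi> g = (0, snd (\<Psi> g))" if "g \<in> N" for g
      using that N_\<nu>[OF that] N.subset by (auto simp: U_def prod_eq_iff)
    have \<Psi>1: "\<Psi> (xg 1) = (1, 0)" using \<Psi>(2) one_in d by (simp add: blk_1)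
    have "character (\<lambda>g. snd (\<Psi> g))"
      unfolding character_def
    proof (intro ballI)
      fix g k assume gk: "g \<in> N" "k \<in> N"
      have "\<Psi> (g \<otimes>\<^bsub>PG\<^esub> k) = (0, snd (\<Psi> g)) \<otimes>\<^bsub>affine_group z\<^esub> (0, snd (\<Psi> k))"
        using gk \<Psi>N[OF gk(1)] \<Psi>N[OF gk(2)] \<Psi>.hom_mult[of g k] by simp
      then show "snd (\<Psi> (g \<otimes>\<^bsub>PG\<^esub> k)) = snd (\<Psi> g) + snd (\<Psi> k)" by simp
    qed
    moreover have "snd (\<Psi> (inv\<^bsub>PG\<^esub> xg 1 \<otimes>\<^bsub>PG\<^esub> g \<otimes>\<^bsub>PG\<^esub> xg 1)) = z * snd (\<Psi> g)" if g: "g \<in> N" for g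
    proof -
      have "\<Psi> (inv\<^bsub>PG\<^esub> xg 1 \<otimes>\<^bsub>PG\<^esub> g \<otimes>\<^bsub>PG\<^esub> xg 1)
          = inv\<^bsub>affine_group z\<^esub> (1, 0) \<otimes>\<^bsub>affine_group z\<^esub> (0, snd (\<Psi> g)) \<otimes>\<^bsub>affine_group z\<^esub> (1, 0)"
        using g x1 \<Psi>1 \<Psi>N[OF g] by simp
      then show ?thesis by (simp add: inv_affine_group[OF z0])
    qed
    moreover have "snd (\<Psi> (a d')) = (if d' = d then 1 else 0)" if "d' \<in> {1..length fs}" for d'
    proof -
      have r: "rep d' \<in> {1..m}" using that by (intro rep_in) auto
      have "\<Psi> (a d') = inv\<^bsub>affine_group z\<^esub> (1, 0) \<otimes>\<^bsub>affine_group z\<^esub> (1, if d' = d then 1 else 0)"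
        unfolding a_def using x1 x[OF r] \<Psi>1 \<Psi>(2) r by (simp add: blk_rep)
      then show ?thesis by (simp add: inv_affine_group[OF z0])
    qed
    ultimately show "\<exists>\<chi>. character \<chi> \<and>
        (\<forall>g\<in>N. \<chi> (inv\<^bsub>PG\<^esub> xg 1 \<otimes>\<^bsub>PG\<^esub> g \<otimes>\<^bsub>PG\<^esub> xg 1) = z * \<chi> g) \<and>
        (\<forall>d'\<in>{1..length fs}. \<chi> (a d') = (if d' = d then 1 else 0))"
      by blast
  next
    fix g assume "g \<in> xg ` {1..m}"
    then obtain i where i: "i \<in> {1..m}" "g = xg i" by blast
    show "inv\<^bsub>PG\<^esub> xg 1 \<otimes>\<^bsub>PG\<^esub> g \<in> insert \<one>\<^bsub>PG\<^esub> (a ` {1..length fs})"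
    proof (cases "blk i = 0")
      case True
      then have "g = xg 1" using xg_block[OF i(1)] xg_block[OF one_in] i(2) blk_1 by simp
      then show ?thesis using x1 by simp
    next
      case False
      then have "blk i \<in> {1..length fs}" using blk_le[OF i(1)] by simp
      then show ?thesis unfolding a_def i(2) using xg_block[OF i(1)] by auto
    qed
  qed simp
qed

text \<open>The determinant yields factors z - t instead of t - z; the signs cancel because each
  polynomial has even degree.\<close>

lemma Alexander_polynomial_PG_eq: "Alexander_polynomial PG CG = cpoly (prod_list fs)"
proof -
  have neg: "(\<Prod>z | poly (cpoly f) z = 0. [:z, - 1:]) = cpoly f" if f: "f \<in> set fs" for f
  proof -
    let ?R = "{z. poly (cpoly f) z = 0}"
    have "root_of_unity z" if "poly (cpoly f) z = 0" for z
      using unity[OF f that] n unfolding root_of_unity_def by blast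
    then have "even (degree f)" using fs[OF f] by (intro even_degree) auto
    moreover have "degree (cpoly f) = card ?R"
      using split[OF f] degree_prod_sum_eq[of ?R "\<lambda>z. [:- z, 1:]"] by simp
    ultimately have ev: "even (card ?R)" by simp
    have "(\<Prod>z\<in>?R. [:z, - 1:]) = (\<Prod>z\<in>?R. - [:- z, 1:])" by simp
    also have "\<dots> = (- 1) ^ card ?R * (\<Prod>z\<in>?R. [:- z, 1:])" by (rule prod_uminus)
    finally show ?thesis using ev split[OF f] by simp
  qed
  have "(\<Prod>d\<in>{1..length fs}. \<Prod>z | poly (cpoly (fac d)) z = 0. [:z, - 1:]) = (\<Prod>d\<in>{1..length fs}. cpoly (fac d))"
    using neg fac_in by (intro prod.cong) auto
  also have "\<dots> = (\<Prod>i<length fs. cpoly (fs ! i))"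
    by (rule prod.reindex_bij_witness[of _ Suc "\<lambda>d. d - 1"]) (auto simp: fac_def)
  also have "\<dots> = prod_list (map cpoly fs)"
    by (simp add: prod.list_conv_set_nth lessThan_atLeast0)
  also have "\<dots> = cpoly (prod_list fs)"
    by (induction fs) (simp_all add: cpoly_mult)
  finally show ?thesis by (simp add: Alexander_polynomial_PG)
qed

end

lemma Hurwitz_group_with_polynomial:
  assumes roots: "\<And>z. poly (cpoly P) z = 0 \<Longrightarrow> root_of_unity z" and P1: "poly P 1 = 1"
  shows "\<exists>(G :: nat word set set monoid) C.
    Hurwitz_C_group G C \<and> irreducible_C_group G \<and> Alexander_polynomial G C = cpoly P"
proof -
  obtain fs where P: "P = prod_list fs"
    and fs: "\<forall>f\<in>set fs. lead_coeff f = 1 \<and> poly f 1 = 1 \<and> (\<exists>n\<ge>1. f dvd monom 1 n - 1)"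
    using unity_factorization[OF roots P1] by blast
  define e where "e f = (SOME n. n \<ge> 1 \<and> f dvd monom 1 n - 1)" for f :: "int poly"
  have e: "e f \<ge> 1" "f dvd monom 1 (e f) - 1" if "f \<in> set fs" for f
    using someI_ex[of "\<lambda>n. n \<ge> 1 \<and> f dvd monom 1 n - 1"] fs that by (auto simp: e_def)
  \<comment> \<open>A common exponent for all roots. For P = 1 there are no factors,
    \<open>n = 1\<close>, and the group has a single generator.\<close>
  define n where "n = prod_list (map e fs)"
  have "block_presentation fs n"
  proof
    have "e f > 0" if "f \<in> set fs" for f using e(1)[OF that] by simp
    then have "n > 0" unfolding n_def by (induction fs) auto
    then show "n \<ge> 1" by simp
  next
    fix f assume f: "f \<in> set fs"
    then show "poly f 1 = 1" using fs by blast
    show "cpoly f = (\<Prod>z | poly (cpoly f) z = 0. [:- z, 1:])"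
      using unity_divisor_splits(1)[OF e[OF f]] fs f by blast
    fix z assume "poly (cpoly f) z = 0"
    then have z: "z ^ e f = 1" using unity_divisor_splits(2)[OF e[OF f]] fs f by blast
    have "e f dvd n" unfolding n_def using f by (intro prod_list_dvd) simp
    then show "z ^ n = 1" using z by (auto simp: dvd_def power_mult)
  qed
  then interpret block_presentation fs n .
  show ?thesis
    using Hurwitz_C_group_PG irreducible_PG Alexander_polynomial_PG_eq unfolding P by blast
qed

theorem theorem0p1:
  fixes P :: "int poly"
  shows "(\<exists>(G :: nat word set set monoid) C.
            Hurwitz_C_group G C \<and> irreducible_C_group G \<and>
            Alexander_polynomial G C = map_poly of_int P)
         \<longleftrightarrow>
         (\<forall>z :: complex. poly (map_poly of_int P) z = 0 \<longrightarrow> (\<exists>n\<ge>1::nat. z ^ n = 1))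
         \<and> poly P 1 = 1"
  using Hurwitz_irreducible_Alexander_polynomial[of _ _ P] Hurwitz_group_with_polynomial[of P]
  unfolding root_of_unity_def by blast

end
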